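(* Let $W\subset X^+$ be a nonempty antichain of Lyndon words of arbitrary cardinality with $W\cap X=\emptyset$, let $A=K\langle X\rangle/(W)$, and let $N=N(W)$ be the set of Lyndon atoms. (1) $A=K\langle X\rangle/(W)$ is a standard finite presentation if and only if $W$ is finite. (2) Suppose $W$ is finite with $|W|=r$, and let $m$ be the maximal length of words in $W$. Then: (i) the global dimension of $A$ is finite and at most $r+1$; (ii) $A$ either has polynomial growth or contains a free subalgebra generated by two monomials; (iii) $A$ has polynomial growth if and only if every word $l\in N$ has length $|l|\le m-1$. (3) Suppose $A$ has polynomial growth of degree $d$. Then $A$ has finite global dimension $d$, and $W$ is finite with $$d-1\le |W|\le \frac{d(d-1)}{2},$$ so $A$ is standard finitely presented. Furthermore, the following conditions are equivalent: (i) $|W|=d(d-1)/2$; (ii) $d=g$ and $W=\{x_ix_j\mid 1\le i<j\le d\}$; (iii) $N=X$.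
   Context: $K$ is a field; $X=\{x_1,\dots,x_g\}$, $g\ge 2$, is a finite alphabet with $x_1<\cdots<x_g$; $X^*$ is the free monoid on $X$; $X^+=X^*\setminus\{1\}$; $|w|$ is the length of $w$; $K\langle X\rangle$ is the free associative algebra, graded by length; $(W)$ is the two-sided ideal generated by $W$. The lexicographic order on $X^+$: $u<v$ iff either $u$ is a proper left factor of $v$ (i.e. $v=uz$ with $z\in X^+$), or $u=axb$, $v=ayc$ with $x,y\in X$, $x<y$, $a,b,c\in X^*$. A word $u\in X^+$ is a Lyndon word if it is nonperiodic (not a proper power) and minimal in its conjugacy class: $u=ab$ with $a,b\in X^+$ implies $u<ba$. $L$ is the set of all Lyndon words. $W\subset X^+$ is an antichain if no element of $W$ is a proper subword (contiguous factor) of another. $\mathfrak N$ is the set of normal words, i.e. words in $X^*$ with no subword in $W$; the set of Lyndon atoms is $N=N(W)=\mathfrak N\cap L$. A presentation $K\langle X\rangle/I$ is a standard finite presentation (and the algebra is then standard finitely presented, s.f.p.) if the reduced Gröbner basis of the ideal $I$ is finite (with respect to an admissible order such as degree-lexicographic). $A=\bigoplus_n A_n$ has polynomial growth if there are real $e$ and $C>0$ with $\sum_{i\le n}\dim_K A_i\le C n^e$ for all $n\geq 1$; the infimum of such $e$ is the Gelfand-Kirillov dimension; polynomial growth of degree $d$ means polynomial growth with Gelfand-Kirillov dimension $d$. A free subalgebra generated by two monomials means: there are two words $u,v$ whose images in $A$ generate a free associative subalgebra on these two generators. *)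

theory Defs
  imports
    "HOL-Library.Poly_Mapping"
    "HOL-Library.Sublist"
    "HOL-Library.Extended_Nat"
    "HOL-Library.Cardinality"
    "HOL-Algebra.QuotRing"
    "HOL-Algebra.Embedded_Algebras"
    "HOL-Algebra.Module"
    "HOL-Algebra.Algebraic_Closure_Type"
begin

section \<open>Words\<close>

definition lex_less :: "'x::linorder list \<Rightarrow> 'x list \<Rightarrow> bool" where
  "lex_less u v \<longleftrightarrow> (u, v) \<in> lexord {(x, y). x < y}"

definition proper_power :: "'x list \<Rightarrow> bool" where
  "proper_power u \<longleftrightarrow> (\<exists>v n. 2 \<le> n \<and> u = concat (replicate n v))"

definition lyndon :: "'x::linorder list \<Rightarrow> bool" where
  "lyndon u \<longleftrightarrow> u \<noteq> [] \<and> \<not> proper_power u \<and>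
     (\<forall>a b. a \<noteq> [] \<and> b \<noteq> [] \<and> u = a @ b \<longrightarrow> lex_less u (b @ a))"

definition antichain :: "'x list set \<Rightarrow> bool" where
  "antichain W \<longleftrightarrow> (\<forall>u\<in>W. \<forall>v\<in>W. \<not> strict_sublist u v)"

definition normal_words :: "'x list set \<Rightarrow> 'x list set" where
  "normal_words W = {w. \<forall>u\<in>W. \<not> sublist u w}"

definition lyndon_atoms :: "'x::linorder list set \<Rightarrow> 'x list set" where
  "lyndon_atoms W = normal_words W \<inter> {w. lyndon w}"


section \<open>The free associative algebra and its quotients\<close>

text \<open>
  With concatenation as the monoid operation on lists, \<open>'x list \<Rightarrow>\<^sub>0 'k\<close> carries the
  convolution product of \<^theory>\<open>HOL-Library.Poly_Mapping\<close>: it is the monoid algebra of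
  the free monoid on \<open>'x\<close>, i.e. the free associative \<open>'k\<close>-algebra on \<open>'x\<close>.
\<close>

instantiation list :: (type) monoid_add
begin

definition zero_list :: "'a list" where "zero_list = []"

definition plus_list :: "'a list \<Rightarrow> 'a list \<Rightarrow> 'a list" where "plus_list u v = u @ v"

instance by standard (simp_all add: zero_list_def plus_list_def)

end

definition free_algebra :: "('x list \<Rightarrow>\<^sub>0 'k::field) ring" where
  "free_algebra = ring_of_type_algebra"

definition word_monom :: "'x list \<Rightarrow> ('x list \<Rightarrow>\<^sub>0 'k::field)" where
  "word_monom w = Poly_Mapping.single w 1"

definition word_ideal :: "'x list set \<Rightarrow> ('x list \<Rightarrow>\<^sub>0 'k::field) set" where
  "word_ideal W = genideal free_algebra (word_monom ` W)"

definition quotient_algebra ::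
    "('x list \<Rightarrow>\<^sub>0 'k::field) set \<Rightarrow> ('x list \<Rightarrow>\<^sub>0 'k) set ring" where
  "quotient_algebra I = free_algebra Quot I"

definition residue_class ::
    "('x list \<Rightarrow>\<^sub>0 'k::field) set \<Rightarrow> ('x list \<Rightarrow>\<^sub>0 'k) \<Rightarrow> ('x list \<Rightarrow>\<^sub>0 'k) set" where
  "residue_class I f = I +>\<^bsub>free_algebra\<^esub> f"

definition scalar_class ::
    "('x list \<Rightarrow>\<^sub>0 'k::field) set \<Rightarrow> 'k \<Rightarrow> ('x list \<Rightarrow>\<^sub>0 'k) set" where
  "scalar_class I c = residue_class I (Poly_Mapping.single [] c)"


section \<open>Groebner bases and standard finite presentations\<close>

text \<open>An admissible order is given by its strict part.\<close>

definition admissible_order :: "('x list \<times> 'x list) set \<Rightarrow> bool" where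
  "admissible_order r \<longleftrightarrow> wf r \<and> trans r \<and> total r \<and>
     (\<forall>a b u v. (u, v) \<in> r \<longrightarrow> (a @ u @ b, a @ v @ b) \<in> r)"

definition deglex :: "('x::linorder list \<times> 'x list) set" where
  "deglex = lenlex {(x, y). x < y}"

lemma admissible_deglex: "admissible_order (deglex :: ('x::{finite,linorder} list \<times> _) set)"
proof -
  let ?r = "{(x, y). x < (y::'x)}"
  have t: "trans ?r" and tot: "total ?r"
    by (auto simp: trans_def total_on_def)
  have "irrefl ?r" by (auto simp: irrefl_def)
  then have "acyclic ?r" using t by (simp add: acyclic_irrefl)
  then have "wf ?r" by (rule finite_acyclic_wf[rotated]) simp
  moreover have "(a @ u @ b, a @ v @ b) \<in> lenlex ?r" if "(u, v) \<in> lenlex ?r" for a b u v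
  proof -
    have "(u @ b, v @ b) \<in> lenlex ?r"
      using that lenlex_append1[of u v ?r b b] by (auto simp: lenlex_conv lex_conv)
    then show ?thesis
      by (induction a) (auto simp: Cons_lenlex_iff lenlex_conv)
  qed
  ultimately show ?thesis
    unfolding admissible_order_def deglex_def
    using lenlex_transI[OF t] total_lenlex[OF tot] wf_lenlex by blast
qed

definition leading_word ::
    "('x list \<times> 'x list) set \<Rightarrow> ('x list \<Rightarrow>\<^sub>0 'k::field) \<Rightarrow> 'x list" where
  "leading_word r f = (THE u. u \<in> Poly_Mapping.keys f \<and> (\<forall>v\<in>Poly_Mapping.keys f. v \<noteq> u \<longrightarrow> (v, u) \<in> r))"

definition groebner_basis ::
    "('x list \<times> 'x list) set \<Rightarrow> ('x list \<Rightarrow>\<^sub>0 'k::field) set \<Rightarrow> ('x list \<Rightarrow>\<^sub>0 'k) set \<Rightarrow> bool" where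
  "groebner_basis r I G \<longleftrightarrow> G \<subseteq> I - {0} \<and>
     (\<forall>f\<in>I - {0}. \<exists>g\<in>G. sublist (leading_word r g) (leading_word r f))"

definition reduced_groebner_basis ::
    "('x list \<times> 'x list) set \<Rightarrow> ('x list \<Rightarrow>\<^sub>0 'k::field) set \<Rightarrow> ('x list \<Rightarrow>\<^sub>0 'k) set \<Rightarrow> bool" where
  "reduced_groebner_basis r I G \<longleftrightarrow> groebner_basis r I G \<and>
     (\<forall>g\<in>G. Poly_Mapping.lookup g (leading_word r g) = 1 \<and>
        (\<forall>h\<in>G - {g}. \<forall>u\<in>Poly_Mapping.keys g. \<not> sublist (leading_word r h) u))"

definition standard_finite_presentation ::
    "('x list \<times> 'x list) set \<Rightarrow> ('x list \<Rightarrow>\<^sub>0 'k::field) set \<Rightarrow> bool" where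
  "standard_finite_presentation r I \<longleftrightarrow> (\<exists>G. reduced_groebner_basis r I G \<and> finite G)"


section \<open>Growth\<close>

definition graded_part ::
    "('x list \<Rightarrow>\<^sub>0 'k::field) set \<Rightarrow> nat \<Rightarrow> ('x list \<Rightarrow>\<^sub>0 'k) set set" where
  "graded_part I n = residue_class I ` {f. \<forall>w\<in>Poly_Mapping.keys f. length w = n}"

definition graded_dim :: "('x list \<Rightarrow>\<^sub>0 'k::field) set \<Rightarrow> nat \<Rightarrow> nat" where
  "graded_dim I n = ring.dim (quotient_algebra I) (range (scalar_class I)) (graded_part I n)"

definition growth_bounded_by :: "('x list \<Rightarrow>\<^sub>0 'k::field) set \<Rightarrow> real \<Rightarrow> bool" where
  "growth_bounded_by I e \<longleftrightarrow>
     (\<exists>C>0. \<forall>n\<ge>1. real (\<Sum>i\<le>n. graded_dim I i) \<le> C * real n powr e)"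

definition polynomial_growth :: "('x list \<Rightarrow>\<^sub>0 'k::field) set \<Rightarrow> bool" where
  "polynomial_growth I \<longleftrightarrow> (\<exists>e. growth_bounded_by I e)"

definition gk_dimension :: "('x list \<Rightarrow>\<^sub>0 'k::field) set \<Rightarrow> real" where
  "gk_dimension I = Inf {e. growth_bounded_by I e}"

definition polynomial_growth_of_degree ::
    "('x list \<Rightarrow>\<^sub>0 'k::field) set \<Rightarrow> real \<Rightarrow> bool" where
  "polynomial_growth_of_degree I d \<longleftrightarrow> polynomial_growth I \<and> gk_dimension I = d"


section \<open>Free subalgebras\<close>

definition word_eval :: "('r, 'm) ring_scheme \<Rightarrow> ('y \<Rightarrow> 'r) \<Rightarrow> 'y list \<Rightarrow> 'r" where
  "word_eval A h w = foldr (\<lambda>y a. h y \<otimes>\<^bsub>A\<^esub> a) w \<one>\<^bsub>A\<^esub>"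

definition algebra_eval ::
    "('r, 'm) ring_scheme \<Rightarrow> ('k::field \<Rightarrow> 'r) \<Rightarrow> ('y \<Rightarrow> 'r) \<Rightarrow> ('y list \<Rightarrow>\<^sub>0 'k) \<Rightarrow> 'r" where
  "algebra_eval A s h f =
     (\<Oplus>\<^bsub>A\<^esub>w\<in>Poly_Mapping.keys f. s (Poly_Mapping.lookup f w) \<otimes>\<^bsub>A\<^esub> word_eval A h w)"

text \<open>
  The words \<open>u\<close>, \<open>v\<close> generate a free subalgebra on two generators: the algebra homomorphism
  from the free algebra on the two-letter alphabet \<open>bool\<close> that sends the letters to the
  classes of \<open>u\<close> and \<open>v\<close> is injective.
\<close>

definition generate_free_subalgebra ::
    "('x list \<Rightarrow>\<^sub>0 'k::field) set \<Rightarrow> 'x list \<Rightarrow> 'x list \<Rightarrow> bool" where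
  "generate_free_subalgebra I u v \<longleftrightarrow>
     inj (algebra_eval (quotient_algebra I) (scalar_class I)
            (\<lambda>b. residue_class I (word_monom (if b then v else u))))"


section \<open>Global dimension\<close>

text \<open>
  The locale \<^locale>\<open>module\<close> requires a commutative ring, so left modules over an arbitrary
  ring are introduced here, on the same record type (whose ring multiplication is unused).
\<close>

locale left_module = R?: ring R + M?: abelian_group M
  for R :: "('r, 'c) ring_scheme" (structure) and M :: "('r, 'm, 'e) module_scheme" (structure) +
  assumes smult_closed:
      "\<lbrakk>a \<in> carrier R; x \<in> carrier M\<rbrakk> \<Longrightarrow> a \<odot>\<^bsub>M\<^esub> x \<in> carrier M"
    and smult_l_distr:
      "\<lbrakk>a \<in> carrier R; b \<in> carrier R; x \<in> carrier M\<rbrakk> \<Longrightarrow>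
      (a \<oplus> b) \<odot>\<^bsub>M\<^esub> x = a \<odot>\<^bsub>M\<^esub> x \<oplus>\<^bsub>M\<^esub> b \<odot>\<^bsub>M\<^esub> x"
    and smult_r_distr:
      "\<lbrakk>a \<in> carrier R; x \<in> carrier M; y \<in> carrier M\<rbrakk> \<Longrightarrow>
      a \<odot>\<^bsub>M\<^esub> (x \<oplus>\<^bsub>M\<^esub> y) = a \<odot>\<^bsub>M\<^esub> x \<oplus>\<^bsub>M\<^esub> a \<odot>\<^bsub>M\<^esub> y"
    and smult_assoc:
      "\<lbrakk>a \<in> carrier R; b \<in> carrier R; x \<in> carrier M\<rbrakk> \<Longrightarrow>
      (a \<otimes> b) \<odot>\<^bsub>M\<^esub> x = a \<odot>\<^bsub>M\<^esub> (b \<odot>\<^bsub>M\<^esub> x)"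
    and smult_one:
      "x \<in> carrier M \<Longrightarrow> \<one> \<odot>\<^bsub>M\<^esub> x = x"

definition left_module_hom ::
    "('r, 'c) ring_scheme \<Rightarrow> ('r, 'm) module \<Rightarrow> ('r, 'n) module \<Rightarrow> ('m \<Rightarrow> 'n) set" where
  "left_module_hom R M N = {f. f \<in> carrier M \<rightarrow> carrier N \<and>
     (\<forall>x\<in>carrier M. \<forall>y\<in>carrier M. f (x \<oplus>\<^bsub>M\<^esub> y) = f x \<oplus>\<^bsub>N\<^esub> f y) \<and>
     (\<forall>a\<in>carrier R. \<forall>x\<in>carrier M. f (a \<odot>\<^bsub>M\<^esub> x) = a \<odot>\<^bsub>N\<^esub> f x)}"

text \<open>
  A definition cannot quantify over all types, so the modules entering the following
  definitions have their elements in a type \<open>nat + 'r + 'u\<close>, where \<open>'r\<close> is the type of ring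
  elements.  The summands \<open>nat\<close> and \<open>'r\<close> make this type infinite and at least as large as
  the ring; hence every module on it has a free cover on it, and projectivity and projective
  dimension do not depend on the restriction.  As \<open>'u\<close> is arbitrary, a statement polymorphic
  in \<open>'u\<close> speaks about modules of every type.
\<close>

type_synonym ('r, 'u) universe = "nat + 'r + 'u"

definition projective_module ::
    "('r, 'c) ring_scheme \<Rightarrow> ('r, ('r, 'u) universe) module \<Rightarrow> bool" where
  "projective_module R P \<longleftrightarrow> left_module R P \<and>
     (\<forall>(M :: ('r, ('r, 'u) universe) module) (N :: ('r, ('r, 'u) universe) module) f g.
        left_module R M \<and> left_module R N \<and>
        f \<in> left_module_hom R M N \<and> f ` carrier M = carrier N \<and> g \<in> left_module_hom R P N \<longrightarrow>
        (\<exists>h\<in>left_module_hom R P M. \<forall>x\<in>carrier P. f (h x) = g x))"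

text \<open>
  \<open>\<dots> \<rightarrow> P 1 \<rightarrow> P 0 \<rightarrow> M \<rightarrow> 0\<close> with \<open>d 0 : P 0 \<rightarrow> M\<close> and \<open>d (i + 1) : P (i + 1) \<rightarrow> P i\<close>.
\<close>

definition projective_resolution ::
    "('r, 'c) ring_scheme \<Rightarrow> ('r, ('r, 'u) universe) module \<Rightarrow>
     (nat \<Rightarrow> ('r, ('r, 'u) universe) module) \<Rightarrow>
     (nat \<Rightarrow> ('r, 'u) universe \<Rightarrow> ('r, 'u) universe) \<Rightarrow> bool" where
  "projective_resolution R M P d \<longleftrightarrow>
     (\<forall>i. projective_module R (P i)) \<and>
     d 0 \<in> left_module_hom R (P 0) M \<and> d 0 ` carrier (P 0) = carrier M \<and>
     (\<forall>i. d (Suc i) \<in> left_module_hom R (P (Suc i)) (P i)) \<and>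
     d (Suc 0) ` carrier (P (Suc 0)) = {x \<in> carrier (P 0). d 0 x = \<zero>\<^bsub>M\<^esub>} \<and>
     (\<forall>i. d (Suc (Suc i)) ` carrier (P (Suc (Suc i))) =
        {x \<in> carrier (P (Suc i)). d (Suc i) x = \<zero>\<^bsub>P i\<^esub>})"

definition projective_dimension ::
    "('r, 'c) ring_scheme \<Rightarrow> ('r, ('r, 'u) universe) module \<Rightarrow> enat" where
  "projective_dimension R M = Inf {enat n | n.
     \<exists>P d. projective_resolution R M P d \<and> (\<forall>i>n. carrier (P i) = {\<zero>\<^bsub>P i\<^esub>})}"

definition global_dimension :: "'u itself \<Rightarrow> ('r, 'c) ring_scheme \<Rightarrow> enat" where
  "global_dimension _ R = Sup {projective_dimension R M | M :: ('r, ('r, 'u) universe) module.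
     left_module R M}"

end

theory Submission
  imports Defs "HOL-Library.List_Lexorder"
begin

text \<open>
  Write \<open>N\<close> for the set of atoms.  A Lyndon factor of a nonincreasing product of Lyndon words
  lies inside one of the factors.  Hence the normal words are exactly the nonincreasing products of atoms,
  and the growth of \<open>A\<close> is polynomial iff \<open>N\<close> is finite, the degree being \<open>card N\<close>.  If \<open>l\<close>
  and \<open>l'\<close> are consecutive atoms, then \<open>l @ l'\<close> is not normal, so some word of \<open>W\<close> is longer than
  \<open>l\<close>; conversely an atom that is at least as long as all words of \<open>W\<close> yields two words all of whose products
  are normal.

  Every module has a resolution by free modules on Anick chains.  Along a chain \<open>t\<^sub>k \<dots> t\<^sub>0\<close> the relations
  increase strictly, which bounds the global dimension by \<open>card W + 1\<close>, and so do the longest Lyndon prefixes of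
  the \<open>t\<^sub>i\<close>, which are atoms; this gives the bound \<open>card N\<close>.  The increasing list of all atoms is itself a
  chain, and the chain resolution of the field is minimal, so the bound \<open>card N\<close> is attained.  Finally each word of
  \<open>W\<close> is a product \<open>u @ v\<close> of two atoms \<open>u < v\<close>, and in the extremal case every such product lies in
  \<open>W\<close>, which leaves only letters as atoms.
\<close>

section \<open>Lyndon words\<close>

text \<open>A module over \<open>A\<close> need not be graded, so its chain resolution is built from
  a filtration. A \<open>K\<close>-basis \<open>B\<close> of the module indexes copies of the
  chains, and the degree of a monomial is the length of its word plus that of the chain. Only the
  top-degree terms are prescribed: there the differential is the monomial one that belongs to the
  field, so exactness reduces to a statement on words, while the lower terms absorb the module
  structure and need only exist. For the field all lower terms vanish; then no boundary has a
  constant coefficient, which gives minimality.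

  A second constraint comes from the definition of global dimension, which sees only modules on one
  fixed type. Free modules are therefore coded injectively into that type before they serve as terms
  of a resolution.

  The inequality \<open>d - 1 \<le> card W\<close> comes from comparing chains: one of length
  \<open>card N\<close> exists, and no chain is longer than \<open>card W + 1\<close>.\<close>

lemma lex_less_iff: "lex_less u v \<longleftrightarrow> u < v"
  by (simp add: lex_less_def list_less_def)

lemma append_less_append_left [simp]:
  fixes u v :: "'x::linorder list"
  shows "a @ u < a @ v \<longleftrightarrow> u < v"
  by (induction a) auto

lemma prefix_imp_le:
  fixes u v :: "'x::linorder list"
  shows "prefix u v \<Longrightarrow> u \<le> v"
proof (induction u arbitrary: v)
  case (Cons x u)
  then show ?case by (cases v) auto
qed simp

lemma less_append:
  fixes u v :: "'x::linorder list"
  shows "v \<noteq> [] \<Longrightarrow> u < u @ v"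
  by (induction u) (auto simp: neq_Nil_conv)

text \<open>The hypotheses produce a first position where the letters differ, and whatever is
  appended comes after it.\<close>

lemma less_append_if_not_prefix:
  fixes u v :: "'x::linorder list"
  shows "u < v \<Longrightarrow> \<not> prefix u v \<Longrightarrow> u @ a < v @ b"
proof (induction u arbitrary: v)
  case (Cons x u)
  then show ?case by (cases v) auto
qed simp

lemma less_append_if_longer:
  fixes u v :: "'x::linorder list"
  shows "u < v \<Longrightarrow> length v \<le> length u \<Longrightarrow> u @ a < v @ b"
  by (rule less_append_if_not_prefix) (auto simp: prefix_def)

text \<open>Lyndon words are defined by rotations, but all later comparisons are with suffixes. If
  \<open>b < w\<close> and \<open>b\<close> is no prefix of \<open>w\<close>, the rotation
  \<open>b @ a\<close> is already smaller than \<open>w\<close>. If \<open>w = b @ c\<close>, two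
  rotations conflict: \<open>w < b @ a\<close> forces \<open>c < a\<close>, and equal lengths turn
  this into \<open>c @ b < w\<close>.\<close>

lemma proper_suffix_less_if_lyndon:
  assumes "lyndon w" "w = a @ b" "a \<noteq> []" "b \<noteq> []"
  shows "w < b"
proof (rule ccontr)
  assume "\<not> w < b"
  moreover have "b \<noteq> w" using assms by simp
  ultimately have "b < w" by simp
  have wba: "w < b @ a" using assms by (auto simp: lyndon_def lex_less_iff)
  show False
  proof (cases "prefix b w")
    case False
    then have "b @ a < w @ []" using \<open>b < w\<close> by (intro less_append_if_not_prefix)
    then show False using wba by simp
  next
    case True
    then obtain c where c: "w = b @ c" by (auto simp: prefix_def)
    then have len: "length c = length a" using assms by (metis add_left_cancel add.commute length_append)
    have "c \<noteq> []" using len assms by auto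
    moreover have "b \<noteq> []" "w = b @ c" using assms c by simp_all
    ultimately have "w < c @ b" using assms(1) unfolding lyndon_def lex_less_iff by blast
    moreover have "c < a" using wba c by simp
    then have "c @ b < a @ b" using len by (intro less_append_if_longer) auto
    ultimately show False using assms by simp
  qed
qed

text \<open>A proper power has a proper suffix that is also a prefix, and a prefix is never greater
  than the word. For the rotations, \<open>b\<close> is a prefix of \<open>b @ a\<close>.\<close>

lemma lyndonI:
  assumes "w \<noteq> []" and less: "\<And>a b. w = a @ b \<Longrightarrow> a \<noteq> [] \<Longrightarrow> b \<noteq> [] \<Longrightarrow> w < b"
  shows "lyndon w"
  unfolding lyndon_def lex_less_iff
proof (intro conjI allI impI)
  show "\<not> proper_power w"
  proof
    assume "proper_power w"
    then obtain v n where vn: "2 \<le> n" "w = concat (replicate n v)"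
      by (auto simp: proper_power_def)
    then obtain k where k: "n = Suc (Suc k)" by (metis Suc_le_D numeral_2_eq_2 Suc_le_mono)
    define u where "u = concat (replicate (Suc k) v)"
    have comm: "v @ concat (replicate j v) = concat (replicate j v) @ v" for j
      by (induction j) simp_all
    have w1: "w = v @ u" using vn k by (simp add: u_def)
    have w2: "w = u @ v" using comm[of "Suc k"] vn k by (simp add: u_def)
    have "v \<noteq> []" using vn assms(1) by auto
    then have "u \<noteq> []" by (simp add: u_def)
    then have "w < u" using less[OF w1 \<open>v \<noteq> []\<close>] by blast
    then show False using w2 by (metis prefixI prefix_imp_le leD)
  qed
next
  fix a b assume "a \<noteq> [] \<and> b \<noteq> [] \<and> w = a @ b"
  then have "w < b" using less by auto
  also have "b \<le> b @ a" by (simp add: prefix_imp_le)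
  finally show "w < b @ a" .
qed fact

lemma lyndon_nonempty: "lyndon w \<Longrightarrow> w \<noteq> []"
  by (simp add: lyndon_def)

lemma lyndon_less_suffix:
  assumes "lyndon w" "strict_suffix b w" "b \<noteq> []"
  shows "w < b"
  using assms proper_suffix_less_if_lyndon[of w _ b] by (auto simp: strict_suffix_def suffix_def)

lemma lyndon_le_suffix:
  assumes "lyndon w" "suffix b w" "b \<noteq> []"
  shows "w \<le> b"
  using assms lyndon_less_suffix[of w b] by (cases "b = w") (auto simp: strict_suffix_def)

lemma lyndon_single: "lyndon [x]"
  by (rule lyndonI) (auto simp: Cons_eq_append_conv)

text \<open>If \<open>v = u @ z\<close>, then \<open>v < z\<close> because \<open>v\<close> is
  Lyndon, and putting \<open>u\<close> in front of both sides gives the claim. Otherwise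
  \<open>u\<close> and \<open>v\<close> already differ at some letter.\<close>

lemma append_less_if_lyndon:
  assumes "lyndon v" "u \<noteq> []" "u < v"
  shows "u @ v < v"
proof (cases "prefix u v")
  case True
  then obtain z where z: "v = u @ z" by (auto simp: prefix_def)
  with assms have "z \<noteq> []" by auto
  then have "v < z" using assms z by (intro proper_suffix_less_if_lyndon[of v u z]) auto
  then have "u @ v < u @ z" by simp
  then show ?thesis using z by simp
next
  case False
  then show ?thesis using less_append_if_not_prefix[OF assms(3), of v "[]"] by simp
qed

text \<open>A proper suffix of the product is either a suffix of \<open>v\<close>, hence at least
  \<open>v\<close>, or \<open>s @ v\<close> with \<open>s\<close> a proper suffix of
  \<open>u\<close>; in the latter case \<open>u < s\<close> is decided at a letter of
  \<open>s\<close>.\<close>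

lemma lyndon_append:
  assumes "lyndon u" "lyndon v" "u < v"
  shows "lyndon (u @ v)"
proof (rule lyndonI)
  show "u @ v \<noteq> []" using assms lyndon_nonempty by auto
next
  have uv: "u @ v < v" using assms lyndon_nonempty by (intro append_less_if_lyndon) auto
  fix a b assume ab: "u @ v = a @ b" "a \<noteq> []" "b \<noteq> []"
  then consider z where "v = z @ b" | s where "s \<noteq> []" "u = a @ s" "b = s @ v"
    unfolding append_eq_append_conv2 by (metis append_Nil)
  then show "u @ v < b"
  proof cases
    case 1
    then have "v \<le> b" using assms ab by (intro lyndon_le_suffix) (auto intro: suffixI)
    then show ?thesis using uv by simp
  next
    case 2
    then have "u < s" using assms ab by (intro proper_suffix_less_if_lyndon[of u a]) auto
    from less_append_if_longer[OF this, of v v] show ?thesis using 2 by simp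
  qed
qed

section \<open>Nonincreasing Lyndon factorizations\<close>

definition lyndon_factors :: "'x::linorder list list \<Rightarrow> bool" where
  "lyndon_factors ls \<longleftrightarrow> (\<forall>l\<in>set ls. lyndon l) \<and> sorted_wrt (\<ge>) ls"

lemma lyndon_factors_Nil [simp]: "lyndon_factors []"
  by (simp add: lyndon_factors_def)

lemma lyndon_factors_Cons:
  "lyndon_factors (l # ls) \<longleftrightarrow> lyndon l \<and> (\<forall>m\<in>set ls. m \<le> l) \<and> lyndon_factors ls"
  by (auto simp: lyndon_factors_def)

lemma lyndon_factors_append:
  "lyndon_factors (ks @ ls) \<longleftrightarrow>
     lyndon_factors ks \<and> lyndon_factors ls \<and> (\<forall>k\<in>set ks. \<forall>l\<in>set ls. l \<le> k)"
  by (auto simp: lyndon_factors_def sorted_wrt_append)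

text \<open>Insertion at the front: as long as the new word is smaller than the first factor, the
  two merge into one Lyndon word by \<open>lyndon_append\<close>; once it is not, it can stand as a
  factor of its own.\<close>

lemma lyndon_factors_absorb:
  assumes "lyndon u" "lyndon_factors ls"
  shows "\<exists>ms. lyndon_factors ms \<and> concat ms = u @ concat ls"
  using assms
proof (induction ls arbitrary: u)
  case Nil
  then show ?case by (intro exI[of _ "[u]"]) (simp add: lyndon_factors_Cons)
next
  case (Cons l ls)
  show ?case
  proof (cases "u < l")
    case True
    then have "lyndon (u @ l)" using Cons.prems by (intro lyndon_append) (auto simp: lyndon_factors_Cons)
    then show ?thesis using Cons.IH[of "u @ l"] Cons.prems by (auto simp: lyndon_factors_Cons)
  next
    case False
    then show ?thesis using Cons.prems
      by (intro exI[of _ "u # l # ls"]) (auto simp: lyndon_factors_Cons)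
  qed
qed

lemma lyndon_factors_exist: "\<exists>ls. lyndon_factors ls \<and> concat ls = w"
proof (induction w)
  case Nil
  then show ?case by (intro exI[of _ "[]"]) simp
next
  case (Cons x w)
  then obtain ls where "lyndon_factors ls" "concat ls = w" by blast
  then show ?case using lyndon_factors_absorb[OF lyndon_single[of x]] by fastforce
qed

text \<open>\<open>q\<close> ends in a nonempty prefix of one of the factors, and a prefix of a word
  is at most that word.\<close>

lemma prefix_concat_small_suffix:
  fixes l :: "'x::linorder list"
  assumes "\<forall>m\<in>set ls. m \<le> l" "prefix q (concat ls)" "q \<noteq> []"
  shows "\<exists>q'. suffix q' q \<and> q' \<noteq> [] \<and> q' \<le> l"
  using assms
proof (induction ls arbitrary: q)
  case (Cons m ls)
  from Cons.prems(2) consider "prefix q m" | q' where "q = m @ q'" "prefix q' (concat ls)" "q' \<noteq> []"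
    unfolding concat.simps prefix_append by (metis append_Nil2 prefix_order.refl)
  then show ?case
  proof cases
    case 1
    then have "q \<le> l" using Cons.prems prefix_imp_le by fastforce
    then show ?thesis using Cons.prems by blast
  next
    case 2
    then obtain q'' where "suffix q'' q'" "q'' \<noteq> []" "q'' \<le> l" using Cons by auto
    moreover have "suffix q'' q" using \<open>suffix q'' q'\<close> 2 by (simp add: suffix_appendI)
    ultimately show ?thesis by blast
  qed
qed auto

text \<open>This confines Lyndon words inside a nonincreasing product: \<open>s\<close> is the part
  within the factor \<open>l\<close> and \<open>q\<close> the part beyond it. A suffix of
  \<open>q\<close> that is at most \<open>l\<close> is at most \<open>s @ q\<close>, which no proper
  suffix of a Lyndon word can be.\<close>

lemma lyndon_not_across:
  assumes "lyndon (s @ q)" "s \<noteq> []" "q \<noteq> []" "l \<le> s" "\<forall>m\<in>set ls. m \<le> l" "prefix q (concat ls)"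
  shows False
proof -
  obtain q' where q': "suffix q' q" "q' \<noteq> []" "q' \<le> l"
    using prefix_concat_small_suffix assms by blast
  then obtain z where z: "q = z @ q'" by (auto simp: suffix_def)
  have "s @ q < q'" using assms q' z by (intro proper_suffix_less_if_lyndon[of _ "s @ z"]) auto
  also have "q' \<le> s" using q' assms by simp
  also have "s \<le> s @ q" by (simp add: prefix_imp_le)
  finally show False by simp
qed

lemma sublist_append_cases:
  assumes "sublist w (u @ v)"
  obtains "sublist w u" | "sublist w v"
    | s q where "w = s @ q" "s \<noteq> []" "q \<noteq> []" "suffix s u" "prefix q v"
proof -
  from assms consider "sublist w u" | "sublist w v"
    | s q where "w = s @ q" "suffix s u" "prefix q v"
    unfolding sublist_append by blast
  then show thesis
  proof cases
    case (3 s q)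
    then show thesis using that by (cases "s = []"; cases "q = []") auto
  qed (use that in auto)
qed

lemma lyndon_sublist_factor:
  assumes "lyndon_factors ls" "lyndon w" "sublist w (concat ls)"
  shows "\<exists>l\<in>set ls. sublist w l"
  using assms
proof (induction ls)
  case Nil
  then show ?case by (simp add: lyndon_nonempty)
next
  case (Cons l ls)
  from Cons.prems have "sublist w (l @ concat ls)" by simp
  then show ?case
  proof (cases rule: sublist_append_cases)
    case (3 s q)
    then have "l \<le> s" using Cons.prems by (intro lyndon_le_suffix) (auto simp: lyndon_factors_Cons)
    then have False using 3 Cons.prems lyndon_not_across[of s q l ls] by (auto simp: lyndon_factors_Cons)
    then show ?thesis ..
  qed (use Cons in \<open>auto simp: lyndon_factors_Cons\<close>)
qed

lemma lyndon_prefix_first_factor: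
  assumes "lyndon_factors (l # ls)" "lyndon p" "prefix p (l @ concat ls)"
  shows "prefix p l"
proof -
  from assms(3) consider "prefix p l" | q where "p = l @ q" "prefix q (concat ls)" "q \<noteq> []"
    unfolding prefix_append by (metis append_Nil2 prefix_order.refl)
  then show ?thesis
  proof cases
    case 2
    then show ?thesis
      using assms lyndon_not_across[of l q l ls] by (auto simp: lyndon_factors_Cons lyndon_nonempty)
  qed
qed

text \<open>The first factor is the longest Lyndon prefix of the word and thus determined by it;
  then it can be cancelled.\<close>

lemma lyndon_factors_unique:
  assumes "lyndon_factors ls" "lyndon_factors ms" "concat ls = concat ms"
  shows "ls = ms"
  using assms
proof (induction ls arbitrary: ms)
  case Nil
  then show ?case by (cases ms) (auto simp: lyndon_factors_Cons lyndon_nonempty)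
next
  case (Cons l ls)
  have "lyndon l" using Cons.prems by (simp add: lyndon_factors_Cons)
  then obtain m ms' where ms: "ms = m # ms'"
    using Cons.prems by (cases ms) (auto simp: lyndon_nonempty)
  have "lyndon m" using Cons.prems ms by (simp add: lyndon_factors_Cons)
  have "prefix l (m @ concat ms')" "prefix m (l @ concat ls)"
    using Cons.prems ms by (auto simp: prefix_def) metis
  then have "prefix l m" "prefix m l"
    using lyndon_prefix_first_factor \<open>lyndon l\<close> \<open>lyndon m\<close> Cons.prems ms by blast+
  then have "l = m" by (simp add: prefix_order.eq_iff)
  then show ?case using Cons ms by (auto simp: lyndon_factors_Cons)
qed

definition lyndon_fact :: "'x::linorder list \<Rightarrow> 'x list list" where
  "lyndon_fact w = (THE ls. lyndon_factors ls \<and> concat ls = w)"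

lemma lyndon_fact: "lyndon_factors (lyndon_fact w)" "concat (lyndon_fact w) = w"
proof -
  have "\<exists>!ls. lyndon_factors ls \<and> concat ls = w"
    using lyndon_factors_exist lyndon_factors_unique by metis
  from theI'[OF this] show "lyndon_factors (lyndon_fact w)" "concat (lyndon_fact w) = w"
    by (auto simp: lyndon_fact_def)
qed

lemma lyndon_fact_Nil_iff [simp]: "lyndon_fact w = [] \<longleftrightarrow> w = []"
proof
  show "lyndon_fact w = [] \<Longrightarrow> w = []" using lyndon_fact(2)[of w] by simp
  show "lyndon_fact w = []" if "w = []"
    using lyndon_factors_unique[of "lyndon_fact w" "[]"] lyndon_fact[of w] that by simp
qed

text \<open>The longest Lyndon prefix of a nonempty word; on the empty word the value is
  unspecified.\<close>

definition first_factor :: "'x::linorder list \<Rightarrow> 'x list" where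
  "first_factor w = hd (lyndon_fact w)"

definition last_factor :: "'x::linorder list \<Rightarrow> 'x list" where
  "last_factor w = last (lyndon_fact w)"

lemma first_factor:
  assumes "w \<noteq> []"
  shows "lyndon (first_factor w)" "prefix (first_factor w) w"
    and "lyndon p \<Longrightarrow> prefix p w \<Longrightarrow> prefix p (first_factor w)"
proof -
  obtain l ls where *: "lyndon_fact w = l # ls" using assms by (cases "lyndon_fact w") auto
  have "lyndon_factors (l # ls)" "w = l @ concat ls" using lyndon_fact[of w] * by auto
  moreover have "first_factor w = l" by (simp add: first_factor_def *)
  ultimately show "lyndon (first_factor w)" "prefix (first_factor w) w"
    "lyndon p \<Longrightarrow> prefix p w \<Longrightarrow> prefix p (first_factor w)"
    using lyndon_prefix_first_factor[of l ls p] by (auto simp: lyndon_factors_Cons)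
qed

lemma last_factor:
  assumes "w \<noteq> []"
  shows "lyndon (last_factor w)" "suffix (last_factor w) w" "last_factor w \<le> first_factor w"
proof -
  obtain ls l where *: "lyndon_fact w = ls @ [l]" using assms by (cases "lyndon_fact w" rule: rev_cases) auto
  have **: "lyndon_factors (ls @ [l])" "w = concat ls @ l" using lyndon_fact[of w] * by auto
  moreover have "last_factor w = l" by (simp add: last_factor_def *)
  ultimately show "lyndon (last_factor w)" "suffix (last_factor w) w"
    by (auto simp: lyndon_factors_append lyndon_factors_Cons intro: suffixI)
  show "last_factor w \<le> first_factor w"
    using ** unfolding last_factor_def first_factor_def *
    by (cases ls) (auto simp: lyndon_factors_append lyndon_factors_Cons)
qed

lemma first_factor_mono:
  assumes "prefix v t" "v \<noteq> []"
  shows "first_factor v \<le> first_factor t"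
proof -
  have "t \<noteq> []" using assms by auto
  moreover have "prefix (first_factor v) t" using first_factor(2) assms prefix_order.trans by blast
  ultimately show ?thesis using first_factor[of t] first_factor(1)[of v] assms by (simp add: prefix_imp_le)
qed

text \<open>\<open>p @ v\<close> has \<open>first_factor p\<close> as a prefix and lies below its
  own suffix \<open>last_factor v\<close>, and factors do not increase from first to last. In the
  application \<open>p\<close> is an entry of a chain, \<open>t\<close> is the next entry and
  \<open>p @ v\<close> is the relation joining them.\<close>

lemma first_factor_less:
  assumes "lyndon (p @ v)" "p \<noteq> []" "v \<noteq> []" "prefix v t"
  shows "first_factor p < first_factor t"
proof -
  obtain z where z: "v = z @ last_factor v" using last_factor(2)[of v] assms by (auto simp: suffix_def)
  have "first_factor p \<le> p @ v"
    using first_factor(2)[of p] assms by (intro prefix_imp_le) (auto intro: prefix_order.trans)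
  also have "\<dots> < last_factor v"
    using z assms last_factor(1)[of v] lyndon_nonempty
    by (intro proper_suffix_less_if_lyndon[of _ "p @ z"]) auto
  also have "\<dots> \<le> first_factor v" using assms by (simp add: last_factor)
  also have "\<dots> \<le> first_factor t" using assms by (simp add: first_factor_mono)
  finally show ?thesis .
qed

text \<open>\<open>v\<close> is the least proper suffix, and this minimality is kept as a
  conclusion. A proper suffix \<open>b\<close> of \<open>u\<close> below \<open>u\<close> would
  either make \<open>b @ v\<close> smaller than \<open>w\<close>, or be a prefix,
  \<open>u = b @ z\<close>, and then \<open>z @ v\<close> would be a suffix of \<open>w\<close>
  smaller than \<open>v\<close>.\<close>

lemma standard_factorization:
  assumes "lyndon w" "2 \<le> length w"
  obtains u v where "w = u @ v" "lyndon u" "lyndon v" "u < v"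
    "\<And>b. strict_suffix b w \<Longrightarrow> b \<noteq> [] \<Longrightarrow> v \<le> b"
proof -
  let ?S = "{b. strict_suffix b w \<and> b \<noteq> []}"
  have "finite ?S" by (rule finite_subset[of _ "set (suffixes w)"]) (auto simp: strict_suffix_def)
  moreover have "tl w \<in> ?S" using assms by (cases w) (auto simp: strict_suffix_def suffix_def)
  ultimately have v: "Min ?S \<in> ?S" "\<And>b. b \<in> ?S \<Longrightarrow> Min ?S \<le> b"
    by (intro Min_in, auto)[1] (intro Min_le, auto simp: \<open>finite ?S\<close>)
  define v where "v = Min ?S"
  have vs: "strict_suffix v w" "v \<noteq> []" using v(1) by (auto simp: v_def)
  have vmin: "v \<le> b" if "strict_suffix b w" "b \<noteq> []" for b
    using v(2)[of b] that by (simp add: v_def)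
  obtain u where u: "w = u @ v" "u \<noteq> []" using vs by (auto simp: strict_suffix_def suffix_def)
  have "lyndon v"
  proof (rule lyndonI[OF vs(2)])
    fix a b assume ab: "v = a @ b" "a \<noteq> []" "b \<noteq> []"
    then have "v \<le> b" using u by (intro vmin) (auto simp: strict_suffix_def suffix_def)
    moreover have "v \<noteq> b" using ab by auto
    ultimately show "v < b" by simp
  qed
  moreover have "lyndon u"
  proof (rule lyndonI[OF u(2)])
    fix a b assume ab: "u = a @ b" "a \<noteq> []" "b \<noteq> []"
    show "u < b"
    proof (rule ccontr)
      assume "\<not> u < b"
      moreover have "b \<noteq> u" using ab by auto
      ultimately have "b < u" by simp
      have "w < b @ v" using assms ab u by (intro proper_suffix_less_if_lyndon[of _ a]) auto
      show False
      proof (cases "prefix b u")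
        case False
        then have "b @ v < u @ v" using \<open>b < u\<close> by (intro less_append_if_not_prefix)
        then show False using \<open>w < b @ v\<close> u by simp
      next
        case True
        then obtain z where z: "u = b @ z" by (auto simp: prefix_def)
        then have "z @ v < v" using \<open>w < b @ v\<close> u by simp
        moreover have "v \<le> z @ v" using z u ab by (intro vmin) (auto simp: strict_suffix_def suffix_def)
        ultimately show False by simp
      qed
    qed
  qed
  moreover have "u < v"
  proof -
    have "u < w" using u vs by (simp add: less_append)
    also have "w < v" using assms vs by (intro lyndon_less_suffix)
    finally show ?thesis .
  qed
  ultimately show ?thesis using that u vmin by blast
qed

section \<open>Normal words, atoms and chains\<close>

lemma normal_words_sublist: "w \<in> normal_words W \<Longrightarrow> sublist v w \<Longrightarrow> v \<in> normal_words W"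
  unfolding normal_words_def by (blast intro: sublist_order.order.trans)

lemma card_strict_sorted:
  fixes xs :: "'a::linorder list"
  assumes "sorted_wrt (<) xs" "set xs \<subseteq> S" "finite S"
  shows "length xs \<le> card S"
proof -
  have "distinct xs" using assms(1) by (simp add: strict_sorted_iff)
  then show ?thesis using card_mono[OF assms(3,2)] by (simp add: distinct_card)
qed

lemma card_ordered_pairs:
  fixes S :: "'a::linorder set"
  assumes "finite S"
  shows "finite {(u, v). u \<in> S \<and> v \<in> S \<and> u < v}"
    and "2 * card {(u, v). u \<in> S \<and> v \<in> S \<and> u < v} = card S * (card S - 1)"
proof -
  let ?L = "{(u, v). u \<in> S \<and> v \<in> S \<and> u < v}" and ?G = "{(u, v). u \<in> S \<and> v \<in> S \<and> v < u}"
    and ?E = "(\<lambda>u. (u, u)) ` S"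
  have fin: "finite (S \<times> S)" using assms by simp
  have sub: "?L \<subseteq> S \<times> S" "?G \<subseteq> S \<times> S" "?E \<subseteq> S \<times> S" by auto
  note f = finite_subset[OF sub(1) fin] finite_subset[OF sub(2) fin] finite_subset[OF sub(3) fin]
  show "finite ?L" by (rule f)
  have "card S * card S = card (?L \<union> ?G \<union> ?E)"
    unfolding card_cartesian_product[symmetric] by (rule arg_cong[of _ _ card]) auto
  also have "\<dots> = card (?L \<union> ?G) + card ?E"
    using f by (intro card_Un_disjoint) auto
  also have "card (?L \<union> ?G) = card ?L + card ?G" using f by (intro card_Un_disjoint) auto
  also have "card ?G = card (prod.swap ` ?L)" by (rule arg_cong[of _ _ card]) auto
  also have "\<dots> = card ?L" by (rule card_image) (auto simp: inj_on_def)
  also have "card ?E = card S" by (intro card_image inj_onI) simp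
  finally have "card S * card S = 2 * card ?L + card S" by simp
  then show "2 * card ?L = card S * (card S - 1)" by (simp add: right_diff_distrib')
qed

lemma sorted_wrt_if_no_ascent:
  fixes l :: "'a::linorder list"
  assumes "\<And>a b. sublist [a, b] l \<Longrightarrow> b \<le> a"
  shows "sorted_wrt (\<ge>) l"
  using assms
proof (induction l)
  case (Cons x l)
  have "sorted_wrt (\<ge>) l" by (rule Cons.IH) (rule Cons.prems, simp add: sublist_Cons_right)
  moreover have "z \<le> x" if z: "z \<in> set l" for z
  proof -
    obtain y k where l: "l = y # k" using z by (cases l) auto
    have "z \<le> y" using z \<open>sorted_wrt (\<ge>) l\<close> unfolding l by auto
    also have "y \<le> x" by (rule Cons.prems) (simp add: l sublist_Cons_right)
    finally show ?thesis .
  qed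
  ultimately show ?case by simp
qed simp

locale lyndon_antichain =
  fixes W :: "'x::{finite,linorder} list set"
  assumes lyndon_W: "w \<in> W \<Longrightarrow> lyndon w"
    and antichain_W: "antichain W"
    and letters_W: "[x] \<notin> W"
begin

abbreviation "NW \<equiv> normal_words W"
abbreviation "N \<equiv> lyndon_atoms W"

lemma atom_iff: "l \<in> N \<longleftrightarrow> l \<in> NW \<and> lyndon l"
  by (auto simp: lyndon_atoms_def)

lemma length_W: "w \<in> W \<Longrightarrow> 2 \<le> length w"
  using lyndon_W[of w] letters_W lyndon_nonempty[of w]
  by (cases w; cases "tl w") auto

lemma sublist_W_eq: "u \<in> W \<Longrightarrow> v \<in> W \<Longrightarrow> sublist u v \<Longrightarrow> u = v"
  using antichain_W by (auto simp: antichain_def strict_sublist_def)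

lemma normal_if_shorter:
  assumes "length v < 2"
  shows "v \<in> NW"
  using length_W assms by (fastforce simp: normal_words_def dest: sublist_length_le)

lemma Nil_normal [simp]: "[] \<in> NW"
  by (rule normal_if_shorter) simp

lemma single_normal [simp]: "[x] \<in> NW"
  by (rule normal_if_shorter) simp

lemma single_atom [simp]: "[x] \<in> N"
  by (simp add: atom_iff lyndon_single)

lemma not_normal_W: "w \<in> W \<Longrightarrow> w \<notin> NW"
  by (auto simp: normal_words_def)

lemma proper_sublist_W_normal:
  assumes "w \<in> W" "sublist v w" "v \<noteq> w"
  shows "v \<in> NW"
proof -
  have False if "u \<in> W" "sublist u v" for u
  proof -
    have "sublist u w" using that assms by (blast intro: sublist_order.order.trans)
    then have "u = w" using sublist_W_eq that assms by blast
    then show False using that assms by (auto intro: sublist_order.order.antisym)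
  qed
  then show ?thesis by (auto simp: normal_words_def)
qed

section \<open>Normal words as products of atoms\<close>

lemma concat_normal:
  assumes "lyndon_factors ls" "set ls \<subseteq> N"
  shows "concat ls \<in> NW"
proof -
  have False if w: "w \<in> W" "sublist w (concat ls)" for w
  proof -
    obtain l where "l \<in> set ls" "sublist w l"
      using lyndon_sublist_factor assms(1) lyndon_W w by blast
    then have "l \<in> NW" "sublist w l" using assms(2) by (auto simp: atom_iff)
    then show False using w by (auto simp: normal_words_def)
  qed
  then show ?thesis by (auto simp: normal_words_def)
qed

lemma set_lyndon_fact_normal:
  assumes "w \<in> NW"
  shows "set (lyndon_fact w) \<subseteq> N"
proof
  fix l assume l: "l \<in> set (lyndon_fact w)"
  then obtain xs ys where "lyndon_fact w = xs @ l # ys" by (auto simp: in_set_conv_decomp)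
  then have "w = concat xs @ l @ concat ys" using lyndon_fact(2)[of w] by simp
  then have "sublist l w" by (metis sublist_appendI)
  then show "l \<in> N" using assms l lyndon_fact(1)[of w]
    by (auto simp: atom_iff lyndon_factors_def intro: normal_words_sublist)
qed

lemma append_normal:
  assumes "s \<in> NW" "l \<in> N" "s \<noteq> []" "l \<le> last_factor s"
  shows "s @ l \<in> NW"
proof -
  obtain ls m where *: "lyndon_fact s = ls @ [m]"
    using assms by (cases "lyndon_fact s" rule: rev_cases) auto
  have f: "lyndon_factors (ls @ [m])" "s = concat (ls @ [m])" using lyndon_fact[of s] * by auto
  have "l \<le> m" using assms by (simp add: last_factor_def *)
  then have "lyndon_factors ((ls @ [m]) @ [l])"
    using f(1) assms(2) by (auto simp: lyndon_factors_append lyndon_factors_Cons atom_iff)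
  then have "concat ((ls @ [m]) @ [l]) \<in> NW"
    using set_lyndon_fact_normal[OF assms(1)] * assms(2) by (intro concat_normal) auto
  then show ?thesis using f by simp
qed

lemma last_factor_atom: "s \<in> NW \<Longrightarrow> s \<noteq> [] \<Longrightarrow> last_factor s \<in> N"
  using set_lyndon_fact_normal[of s] by (auto simp: last_factor_def)

lemma first_factor_atom: "s \<in> NW \<Longrightarrow> s \<noteq> [] \<Longrightarrow> first_factor s \<in> N"
  using set_lyndon_fact_normal[of s] by (auto simp: first_factor_def)

text \<open>The last Lyndon factor of a nonempty \<open>s\<close> is a Lyndon proper suffix of
  \<open>l\<close>, so by minimality it is at least \<open>p\<close>, and appending \<open>p\<close>
  prolongs a nonincreasing product of atoms.\<close>

lemma suffix_append_normal:
  assumes "l \<in> N" "p \<in> N" and min: "\<And>e. lyndon e \<Longrightarrow> e \<in> N \<Longrightarrow> strict_suffix e l \<Longrightarrow> p \<le> e"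
    and s: "strict_suffix s l"
  shows "s @ p \<in> NW"
proof (cases "s = []")
  case True
  then show ?thesis using assms by (simp add: atom_iff)
next
  case False
  have sN: "s \<in> NW"
    using assms by (auto simp: atom_iff strict_suffix_def intro: normal_words_sublist suffix_imp_sublist)
  have "strict_suffix (last_factor s) l"
    using last_factor(2)[OF False] s by (metis suffix_order.le_less_trans)
  then have "p \<le> last_factor s"
    using last_factor_atom[OF sN False] min by (auto simp: atom_iff)
  then show ?thesis using append_normal sN False assms by blast
qed

text \<open>The offending relation starts with the first letter, since \<open>tl s @ p\<close> is
  normal, and reaches into \<open>p\<close>, since \<open>s\<close> is normal.\<close>

lemma W_prefix:
  assumes "s @ p \<notin> NW" "s \<noteq> []" "tl s @ p \<in> NW" "s \<in> NW"
  obtains q where "s @ q \<in> W" "prefix q p" "q \<noteq> []"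
proof -
  obtain w where w: "w \<in> W" "sublist w (s @ p)" using assms(1) by (auto simp: normal_words_def)
  obtain x t where s: "s = x # t" using assms(2) by (cases s) auto
  have "\<not> sublist w (t @ p)" using assms(3) w s by (auto simp: normal_words_def)
  then have "prefix w (s @ p)" using w s by (auto simp: sublist_Cons_right)
  moreover have "\<not> prefix w s" using assms(4) w by (auto simp: normal_words_def)
  ultimately obtain q where "w = s @ q" "prefix q p" by (auto simp: prefix_append)
  moreover have "q \<noteq> []" using \<open>\<not> prefix w s\<close> \<open>w = s @ q\<close> by auto
  ultimately show thesis using w that by blast
qed

lemma W_prefix_atoms:
  assumes "l \<in> N" "p \<in> N" and min: "\<And>e. lyndon e \<Longrightarrow> e \<in> N \<Longrightarrow> strict_suffix e l \<Longrightarrow> p \<le> e"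
    and "l @ p \<notin> NW"
  obtains q where "l @ q \<in> W" "prefix q p" "q \<noteq> []"
proof -
  have "l \<noteq> []" using assms by (auto simp: atom_iff lyndon_nonempty)
  then have "strict_suffix (tl l) l" by (cases l) (auto simp: strict_suffix_def suffix_def)
  then have "tl l @ p \<in> NW" using assms by (intro suffix_append_normal[of l]) auto
  then show thesis using W_prefix[of l p] assms \<open>l \<noteq> []\<close> that by (auto simp: atom_iff)
qed

text \<open>If \<open>l @ p\<close> were normal, it would be an atom strictly between
  \<open>l\<close> and \<open>p\<close>. Proper suffixes of \<open>l\<close> in front of
  \<open>p\<close> do give normal words, so a relation starts exactly at \<open>l\<close>; these are
  the conditions under which \<open>l\<close> is a chain step over \<open>p\<close>.\<close>

lemma consecutive_atoms:
  assumes "l \<in> N" "p \<in> N" "l < p" and cons: "\<And>e. e \<in> N \<Longrightarrow> l < e \<Longrightarrow> p \<le> e"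
  shows "l @ p \<notin> NW" "strict_suffix s l \<Longrightarrow> s @ p \<in> NW"
    and "\<exists>q. l @ q \<in> W \<and> prefix q p \<and> q \<noteq> []"
proof -
  show 1: "l @ p \<notin> NW"
  proof
    assume "l @ p \<in> NW"
    then have "l @ p \<in> N" using assms by (auto simp: atom_iff intro: lyndon_append)
    moreover have "l < l @ p" using assms by (auto simp: atom_iff intro!: less_append lyndon_nonempty)
    ultimately have "p \<le> l @ p" using cons by blast
    moreover have "l @ p < p" using assms by (auto simp: atom_iff intro!: append_less_if_lyndon lyndon_nonempty)
    ultimately show False by simp
  qed
  have min: "p \<le> e" if "lyndon e" "e \<in> N" "strict_suffix e l" for e
    using that assms by (intro cons lyndon_less_suffix) (auto simp: atom_iff lyndon_nonempty)
  show "strict_suffix s l \<Longrightarrow> s @ p \<in> NW" using assms min by (intro suffix_append_normal) auto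
  show "\<exists>q. l @ q \<in> W \<and> prefix q p \<and> q \<noteq> []"
    using W_prefix_atoms[OF assms(1,2) min 1] by blast
qed

lemma length_W_Max: "finite W \<Longrightarrow> w \<in> W \<Longrightarrow> length w \<le> Max (length ` W)"
  by simp

text \<open>The letter \<open>[Max UNIV]\<close> is an atom, so a largest atom begins with the
  largest letter; a longer Lyndon word beginning with it would have to be smaller than its own last
  letter.\<close>

lemma max_atom:
  assumes "l \<in> N" "\<And>e. e \<in> N \<Longrightarrow> e \<le> l"
  shows "l = [Max UNIV]"
proof -
  have "l \<noteq> []" using assms by (auto simp: atom_iff lyndon_nonempty)
  then obtain x t where l: "l = x # t" by (cases l) auto
  have "[Max UNIV] \<le> l" using assms(2) by simp
  moreover have "x \<le> Max UNIV" by simp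
  ultimately have x: "x = Max UNIV" using l
    by (metis Cons_less_Cons list_le_def order_less_le list.inject leD)
  have "t = []"
  proof (rule ccontr)
    assume "t \<noteq> []"
    then obtain s z where t: "t = s @ [z]" by (cases t rule: rev_cases) auto
    have "l < [z]" using l t assms proper_suffix_less_if_lyndon[of l "x # s" "[z]"] by (auto simp: atom_iff)
    moreover have "z \<le> Max UNIV" by simp
    ultimately show False using l x t by (auto simp: leD)
  qed
  then show ?thesis using l x by simp
qed

lemma finite_atoms_short:
  assumes "finite N" "finite W" "W \<noteq> {}" "l \<in> N"
  shows "length l \<le> Max (length ` W) - 1"
proof (cases "\<exists>e\<in>N. l < e")
  case True
  let ?S = "{e \<in> N. l < e}"
  have "finite ?S" "?S \<noteq> {}" using True assms by auto
  then have p: "Min ?S \<in> ?S" "\<And>e. e \<in> ?S \<Longrightarrow> Min ?S \<le> e" by (auto intro: Min_in simp del: mem_Collect_eq)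
  then have "\<exists>q. l @ q \<in> W \<and> prefix q (Min ?S) \<and> q \<noteq> []"
    using assms by (intro consecutive_atoms) auto
  then obtain q where "l @ q \<in> W" "q \<noteq> []" by blast
  then show ?thesis using length_W_Max[of "l @ q"] assms by (cases q) auto
next
  case False
  \<comment> \<open>The largest atom has no successor, but it is a letter, and words of
    \<open>W\<close> have at least two letters.\<close>
  then have "l = [Max UNIV]" using assms max_atom[of l] by (meson not_less)
  moreover obtain w where "w \<in> W" using assms by blast
  then have "2 \<le> Max (length ` W)"
    using length_W[of w] length_W_Max[of w] assms(2) by linarith
  ultimately show ?thesis by simp
qed

lemma finite_atoms_if_short:
  assumes "\<And>l. l \<in> N \<Longrightarrow> length l \<le> k"
  shows "finite N"
proof (rule finite_subset)
  show "N \<subseteq> {w. set w \<subseteq> UNIV \<and> length w \<le> k}" using assms by auto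
  show "finite {w :: 'x list. set w \<subseteq> UNIV \<and> length w \<le> k}" by (rule finite_lists_length_le) simp
qed

text \<open>
  If an atom \<open>l\<close> is at least as long as every word of \<open>W\<close>, then an occurrence of a word of \<open>W\<close>
  in a product of words beginning with \<open>l\<close> touches at most two factors.  The second free
  generator comes from \<open>l @ p\<close>, where \<open>p\<close> is the least proper suffix of \<open>l\<close>.
\<close>

lemma long_atom_append:
  assumes m: "\<And>w. w \<in> W \<Longrightarrow> length w \<le> length l"
    and "l \<in> N" "p \<in> N" "l < p" and min: "\<And>e. lyndon e \<Longrightarrow> e \<in> N \<Longrightarrow> strict_suffix e l \<Longrightarrow> p \<le> e"
  shows "l @ p \<in> N"
proof -
  have "l @ p \<in> NW"
  proof (rule ccontr)
    assume "l @ p \<notin> NW"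
    then obtain q where "l @ q \<in> W" "q \<noteq> []" using W_prefix_atoms assms by metis
    then show False using m[of "l @ q"] by simp
  qed
  then show ?thesis using assms by (auto simp: atom_iff intro: lyndon_append)
qed

lemma pairwise_normal_concat:
  assumes m: "\<And>w l. w \<in> W \<Longrightarrow> l \<in> L \<Longrightarrow> length w \<le> length l"
    and two: "\<And>k l. k \<in> L \<Longrightarrow> l \<in> L \<Longrightarrow> k @ l \<in> NW"
  shows "set ls \<subseteq> L \<Longrightarrow> concat ls \<in> NW"
proof (induction ls)
  case (Cons l ls)
  show ?case
  proof (rule ccontr)
    assume "concat (l # ls) \<notin> NW"
    then obtain w where w: "w \<in> W" "sublist w (l @ concat ls)" by (auto simp: normal_words_def)
    then obtain a b where ab: "l @ concat ls = a @ w @ b" by (auto simp: sublist_def)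
    have "\<not> sublist w (concat ls)" using Cons w by (auto simp: normal_words_def)
    have "length a \<le> length l"
    proof (rule ccontr)
      assume "\<not> length a \<le> length l"
      then have "concat ls = drop (length l) a @ w @ b"
        using arg_cong[OF ab, of "drop (length l)"] by simp
      then show False using \<open>\<not> sublist w (concat ls)\<close> by (auto simp: sublist_def)
    qed
    show False
    proof (cases ls)
      case Nil
      then have "sublist w (l @ l)" using w by (simp add: sublist_append)
      then show False using two[of l l] Cons.prems w by (auto simp: normal_words_def)
    next
      case (Cons k ks)
      have "length (a @ w) \<le> length (l @ k)"
        using \<open>length a \<le> length l\<close> m[of w k] w Cons.prems Cons by auto
      moreover have "prefix (a @ w) ((l @ k) @ concat ks)" using ab Cons by (auto simp: prefix_def)
      moreover have "prefix (l @ k) ((l @ k) @ concat ks)" by simp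
      ultimately have "prefix (a @ w) (l @ k)" using prefix_length_prefix by blast
      then have "sublist w (l @ k)" by (auto simp: prefix_def sublist_def) 
      then show False using two[of l k] Cons.prems w Cons by (auto simp: normal_words_def)
    qed
  qed
qed simp

lemma long_atom_free:
  assumes m: "\<And>w. w \<in> W \<Longrightarrow> length w \<le> length l" and "l \<in> N" "W \<noteq> {}"
  obtains u v where "length u = length v" "u \<noteq> v" "\<And>ls. set ls \<subseteq> {u, v} \<Longrightarrow> concat ls \<in> NW"
proof -
  obtain w where "w \<in> W" using assms by blast
  then have "2 \<le> length l" using m length_W by fastforce
  then obtain u' p where p: "l = u' @ p" "lyndon u'" "lyndon p" "u' < p"
    "\<And>b. strict_suffix b l \<Longrightarrow> b \<noteq> [] \<Longrightarrow> p \<le> b"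
    using standard_factorization[of l] assms by (auto simp: atom_iff)
  have min: "p \<le> e" if "lyndon e" "strict_suffix e l" for e using p that lyndon_nonempty by blast
  have pN: "p \<in> N" using p assms by (auto simp: atom_iff intro: normal_words_sublist)
  have "strict_suffix p l" using p lyndon_nonempty[of u'] by (auto simp: strict_suffix_def suffix_def)
  then have "l < p" using assms p by (auto simp: atom_iff intro: lyndon_less_suffix lyndon_nonempty)
  define k where "k = l @ p"
  have kN: "k \<in> N" unfolding k_def using m assms(2) pN \<open>l < p\<close> min by (intro long_atom_append) auto
  have "l < k" unfolding k_def using p by (intro less_append) (auto simp: lyndon_nonempty)
  \<comment> \<open>\<open>k = l @ p\<close> lies below \<open>p\<close>, hence below every Lyndon
    proper suffix of \<open>l\<close>, so \<open>long_atom_append\<close> applies once more with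
    \<open>k\<close> in the place of \<open>p\<close>.\<close>
  have mink: "k \<le> e" if "lyndon e" "strict_suffix e l" for e
  proof -
    have "k < p" unfolding k_def using p \<open>l < p\<close> assms(2)
      by (intro append_less_if_lyndon) (auto simp: lyndon_nonempty atom_iff)
    then show ?thesis using min[OF that] by simp
  qed
  have lk: "l @ k \<in> N" using m assms(2) kN \<open>l < k\<close> mink by (intro long_atom_append) auto
  have noninc: "a @ b \<in> NW" if "a \<in> N" "b \<in> N" "b \<le> a" for a b
    using concat_normal[of "[a, b]"] that by (auto simp: lyndon_factors_Cons atom_iff)
  have two: "a @ b \<in> NW" if "a \<in> {l, k}" "b \<in> {l, k}" for a b
    using that noninc[of l l] noninc[of k k] noninc[of k l] lk kN assms(2) \<open>l < k\<close> by (auto simp: atom_iff)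
  have len: "length w \<le> length a" if "w \<in> W" "a \<in> {l, k}" for w a
    using that m[of w] by (auto simp: k_def)
  have free: "concat ls \<in> NW" if "set ls \<subseteq> {l, k}" for ls
    using pairwise_normal_concat[of "{l, k}"] len two that by blast
  show thesis
  \<comment> \<open>\<open>l\<close> and \<open>k\<close> differ in length; their two products have
    equal length, so that a product of generators can be decoded block by block.\<close>
  proof (rule that[of "l @ k" "k @ l"])
    have "l @ k < k" using lk kN \<open>l < k\<close> assms by (auto simp: atom_iff intro!: append_less_if_lyndon lyndon_nonempty)
    also have "k \<le> k @ l" by (simp add: prefix_imp_le)
    finally show "l @ k \<noteq> k @ l" by simp
    fix ls assume ls: "set ls \<subseteq> {l @ k, k @ l}"
    have "\<exists>ms. set ms \<subseteq> {l, k} \<and> concat ms = concat ls" using ls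
    proof (induction ls)
      case (Cons a ls)
      then obtain ms where "set ms \<subseteq> {l, k}" "concat ms = concat ls" by auto
      then have "set (l # k # ms) \<subseteq> {l, k} \<and> concat (l # k # ms) = (l @ k) @ concat ls"
        "set (k # l # ms) \<subseteq> {l, k} \<and> concat (k # l # ms) = (k @ l) @ concat ls" by auto
      moreover have "a = l @ k \<or> a = k @ l" using Cons.prems by simp
      ultimately show ?case by (metis concat.simps(2))
    qed (auto intro: exI[of _ "[]"])
    then show "concat ls \<in> NW" using free by metis
  qed simp
qed

text \<open>
  The Anick chain \<open>t\<^sub>k \<dots> t\<^sub>1 t\<^sub>0\<close>, with \<open>t\<^sub>0\<close> a letter, is encoded as the list
  \<open>[t\<^sub>k, \<dots>, t\<^sub>0]\<close>; chains of length \<open>n\<close> span the \<open>n\<close>-th term of the minimal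
  resolution of the field.  The words \<open>a\<close> with \<open>killed c a\<close> are those for which \<open>a\<close> times the basis
  element \<open>c\<close> is the leading term of a cycle, and \<open>step c t\<close> selects the minimal ones.
\<close>

definition killed :: "'x list list \<Rightarrow> 'x list \<Rightarrow> bool" where
  "killed c a \<longleftrightarrow> (case c of [] \<Rightarrow> a \<noteq> [] | u # _ \<Rightarrow> a @ u \<notin> NW)"

definition step :: "'x list list \<Rightarrow> 'x list \<Rightarrow> bool" where
  "step c t \<longleftrightarrow> t \<in> NW \<and> t \<noteq> [] \<and> killed c t \<and> \<not> killed c (tl t)"

primrec chain :: "'x list list \<Rightarrow> bool" where
  "chain [] \<longleftrightarrow> True"
| "chain (t # c) \<longleftrightarrow> chain c \<and> step c t"

lemma killed_Nil [simp]: "killed [] a \<longleftrightarrow> a \<noteq> []"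
  by (simp add: killed_def)

lemma killed_Cons [simp]: "killed (u # c) a \<longleftrightarrow> a @ u \<notin> NW"
  by (simp add: killed_def)

lemma step_Nil: "step [] t \<longleftrightarrow> (\<exists>x. t = [x])"
  by (cases t) (auto simp: step_def)

lemma not_killed_Nil: "chain c \<Longrightarrow> \<not> killed c []"
  by (cases c) (auto simp: step_def)

lemma killed_append: "killed c a \<Longrightarrow> killed c (b @ a)"
  using normal_words_sublist[of "b @ a @ hd c" W "a @ hd c"] by (cases c) (auto simp: sublist_append_rightI)

text \<open>Take the shortest suffix of \<open>a\<close> that \<open>c\<close> kills; it is nonempty
  because a chain does not kill the empty word.\<close>

lemma killed_split:
  assumes "chain c" "a \<in> NW" "killed c a"
  obtains b t where "a = b @ t" "step c t"
  using assms(2,3)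
proof (induction a arbitrary: thesis)
  case Nil
  then show ?case using not_killed_Nil[OF assms(1)] by simp
next
  case (Cons x a)
  show ?case
  proof (cases "killed c a")
    case True
    have "a \<in> NW" using Cons.prems by (meson normal_words_sublist sublist_Cons_right sublist_order.order.refl)
    then obtain b t where "a = b @ t" "step c t" using Cons.IH True by blast
    then show ?thesis using Cons.prems(1)[of "x # b" t] by simp
  next
    case False
    then show ?thesis using Cons.prems(1)[of "[]" "x # a"] Cons.prems by (simp add: step_def)
  qed
qed

text \<open>If two steps of different length end the same word, the shorter one is a suffix of the
  tail of the longer one, so that tail is killed, against minimality. Hence leading terms of
  different generators cannot cancel.\<close>

lemma step_unique:
  assumes "b @ t = b' @ t'" "step c t" "step c t'"
  shows "b = b' \<and> t = t'"
proof -
  have *: "length s' \<le> length s"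
    if "b @ s = b' @ s'" "step c s" "step c s'" for b b' s s'
  proof (rule ccontr)
    assume "\<not> length s' \<le> length s"
    moreover have "suffix s s' \<or> suffix s' s"
      using that(1) suffix_same_cases[of s "b @ s" s'] by (metis suffixI)
    ultimately obtain z where z: "z \<noteq> []" "s' = z @ s"
      by (auto simp: suffix_def)
    then have "killed c (tl s')" using that(2) killed_append[of c s "tl z"] by (simp add: step_def)
    then show False using that(3) by (simp add: step_def)
  qed
  have "length t = length t'" using *[OF assms] *[OF assms(1)[symmetric] assms(3,2)] by simp
  then show ?thesis using assms(1) by simp
qed

lemma step_prefix:
  assumes "step (u # c) t"
  obtains q where "t @ q \<in> W" "prefix q u" "q \<noteq> []"
proof -
  have "t @ u \<notin> NW" "t \<noteq> []" "tl t @ u \<in> NW" "t \<in> NW" using assms by (simp_all add: step_def)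
  then show thesis using W_prefix that by blast
qed

lemma chain_first_factors:
  assumes "chain c"
  shows "sorted_wrt (<) (map first_factor c) \<and> set (map first_factor c) \<subseteq> N"
  using assms
proof (induction c)
  case (Cons t c)
  have t: "t \<in> NW" "t \<noteq> []" using Cons.prems by (auto simp: step_def)
  have "\<forall>u\<in>set c. first_factor t < first_factor u"
  proof (cases c)
    case (Cons u c')
    then obtain q where q: "t @ q \<in> W" "prefix q u" "q \<noteq> []"
      using Cons.prems step_prefix[of u c' t] \<open>chain (t # c)\<close> by auto
    then have "first_factor t < first_factor u"
      using t by (intro first_factor_less lyndon_W) auto
    then show ?thesis using Cons.IH \<open>chain (t # c)\<close> Cons by auto
  qed simp
  then show ?case using Cons t by (auto intro: first_factor_atom)
qed simp

lemma chain_length_le_atoms: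
  assumes "chain c" "finite N"
  shows "length c \<le> card N"
  using chain_first_factors[OF assms(1)] card_strict_sorted[of "map first_factor c" N] assms by simp

text \<open>Neighbours \<open>t\<close>, \<open>u\<close> are joined by a relation
  \<open>t @ q\<close> with \<open>q\<close> a prefix of \<open>u\<close>. It is Lyndon, so
  \<open>t @ q < q\<close> and \<open>q \<le> u\<close>, and the last conjunct, applied to
  \<open>u\<close>, puts \<open>u\<close> below all relations further along.\<close>

lemma chain_relations:
  assumes "chain (t # c)"
  shows "\<exists>ws. length ws = length c \<and> set ws \<subseteq> W \<and> sorted_wrt (<) ws \<and> (\<forall>w\<in>set ws. t \<le> w)"
  using assms
proof (induction c arbitrary: t)
  case Nil
  then show ?case by (intro exI[of _ "[]"]) simp
next
  case (Cons u c)
  from Cons.prems have "chain (u # c)" by simp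
  from Cons.IH[OF this] obtain ws where ws: "length ws = length c" "set ws \<subseteq> W" "sorted_wrt (<) ws" "\<forall>w\<in>set ws. u \<le> w"
    by blast
  obtain q where q: "t @ q \<in> W" "prefix q u" "q \<noteq> []"
    using Cons.prems step_prefix[of u c t] by auto
  have "t \<noteq> []" using Cons.prems by (auto simp: step_def)
  then have "t @ q < q" using q by (intro proper_suffix_less_if_lyndon[OF lyndon_W]) auto
  also have "q \<le> u" using q by (simp add: prefix_imp_le)
  finally have less: "t @ q < w" if "w \<in> set ws" for w using that ws by force
  moreover have "t \<le> t @ q" by (simp add: prefix_imp_le)
  ultimately show ?case using ws q by (intro exI[of _ "(t @ q) # ws"]) force
qed

lemma chain_length_le_relations:
  assumes "chain c" "finite W"
  shows "length c \<le> card W + 1"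
proof (cases c)
  case (Cons t c')
  then obtain ws where "length ws = length c'" "set ws \<subseteq> W" "sorted_wrt (<) ws"
    using chain_relations assms by blast
  then show ?thesis using card_strict_sorted[of ws W] assms Cons by simp
qed simp

text \<open>The bound \<open>b\<close> serves the induction: the tail of the list consists of all
  atoms from its own head on. Neighbours in the list are consecutive atoms, and the last entry is
  the largest letter.\<close>

lemma atoms_chain:
  assumes "sorted_wrt (<) ls" "set ls = {e \<in> N. b \<le> e}" 
  shows "chain ls"
  using assms
proof (induction ls arbitrary: b)
  case (Cons l ls)
  note prems = Cons.prems and IH = Cons.IH
  have mem: "e \<in> set (l # ls) \<longleftrightarrow> e \<in> N \<and> b \<le> e" for e using prems(2) by blast
  have ll: "l \<in> N" "b \<le> l" using mem[of l] by simp_all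
  have less: "l < e" if "e \<in> set ls" for e using prems(1) that by simp
  have l: "l \<in> NW" "l \<noteq> []" using ll by (auto simp: atom_iff lyndon_nonempty)
  have ge: "e \<in> set ls" if "e \<in> N" "l < e" for e
    using mem[of e] that ll by (auto dest: order_less_imp_le order.strict_trans1)
  show ?case
  proof (cases ls)
    case Nil
    have "e \<le> l" if "e \<in> N" for e
      by (rule ccontr) (use ge[OF that] Nil in \<open>simp add: not_le\<close>)
    then have "l = [Max UNIV]" using max_atom[OF ll(1)] by blast
    then show ?thesis using Nil by (simp add: step_Nil)
  next
    case ls: (Cons p ps)
    have "p \<in> set ls" using ls by simp
    then have p: "p \<in> N" "l < p" using mem[of p] less[of p] by simp_all
    have cons: "p \<le> e" if "e \<in> set ls" for e
      using prems(1) that unfolding ls by auto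
    have "e \<in> set ls \<longleftrightarrow> e \<in> N \<and> p \<le> e" for e
      using mem[of e] cons[of e] ge[of e] p(2) by (meson list.set_intros(2) order.strict_trans1 order_less_le_trans)
    then have "chain ls" using IH[of p] prems(1) by auto
    have "strict_suffix (tl l) l" using l by (cases l) (auto simp: strict_suffix_def suffix_def)
    then have "l @ p \<notin> NW" "tl l @ p \<in> NW"
      using consecutive_atoms[OF ll(1) p] cons[OF ge] by blast+
    then show ?thesis using \<open>chain ls\<close> l ls by (simp add: step_def)
  qed
qed simp

lemma top_chain:
  assumes "finite N"
  obtains c where "chain c" "length c = card N"
proof
  show "chain (sorted_list_of_set N)"
    using assms by (intro atoms_chain[of _ "[]"]) auto
  show "length (sorted_list_of_set N) = card N" using assms by simp
qed

subsection \<open>The relations\<close>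

lemma W_product:
  assumes "w \<in> W"
  shows "\<exists>u v. w = u @ v \<and> u \<in> N \<and> v \<in> N \<and> u < v"
proof (rule standard_factorization)
  show "lyndon w" "2 \<le> length w" using lyndon_W length_W assms by blast+
  fix u v assume uv: "w = u @ v" "lyndon u" "lyndon v" "u < v"
  have "sublist u w" "sublist v w" "u \<noteq> w" "v \<noteq> w"
    using uv lyndon_nonempty by auto
  then have "u \<in> NW" "v \<in> NW" using proper_sublist_W_normal assms by blast+
  then show "\<exists>u v. w = u @ v \<and> u \<in> N \<and> v \<in> N \<and> u < v"
    using uv by (auto simp: atom_iff)
qed

definition "atom_pairs = {(u, v). u \<in> N \<and> v \<in> N \<and> u < v}"

lemma W_subset_products: "W \<subseteq> (\<lambda>(u, v). u @ v) ` atom_pairs"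
proof
  fix w assume "w \<in> W"
  then obtain u v where uv: "w = u @ v" "u \<in> N" "v \<in> N" "u < v" using W_product by blast
  show "w \<in> (\<lambda>(u, v). u @ v) ` atom_pairs"
    by (rule image_eqI[of _ _ "(u, v)"]) (use uv in \<open>auto simp: atom_pairs_def\<close>)
qed

lemma finite_W_if_finite_atoms:
  assumes "finite N"
  shows "finite W" "2 * card W \<le> card N * (card N - 1)"
    and "2 * card W = card N * (card N - 1) \<Longrightarrow> u \<in> N \<Longrightarrow> v \<in> N \<Longrightarrow> u < v \<Longrightarrow> u @ v \<in> W"
proof -
  note P = card_ordered_pairs[OF assms, folded atom_pairs_def]
  have fin: "finite ((\<lambda>(u, v). u @ v) ` atom_pairs)" using P by simp
  show "finite W" using finite_subset[OF W_subset_products fin] .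
  have le: "card W \<le> card ((\<lambda>(u, v). u @ v) ` atom_pairs)" using card_mono[OF fin W_subset_products] .
  have le': "card ((\<lambda>(u, v). u @ v) ` atom_pairs) \<le> card atom_pairs" using P by (intro card_image_le)
  show "2 * card W \<le> card N * (card N - 1)" using le le' P by simp
  show "u @ v \<in> W" if "2 * card W = card N * (card N - 1)" "u \<in> N" "v \<in> N" "u < v"
  proof -
    \<comment> \<open>The extremal value turns both inequalities into equalities, so
      \<open>W\<close> is the whole set of products.\<close>
    have "card ((\<lambda>(u, v). u @ v) ` atom_pairs) \<le> card W" using that le' P by simp
    then have "W = (\<lambda>(u, v). u @ v) ` atom_pairs" using card_seteq[OF fin W_subset_products] by simp
    moreover have "(u, v) \<in> atom_pairs" using that by (simp add: atom_pairs_def)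
    ultimately show ?thesis by (metis (no_types, lifting) case_prod_conv image_eqI)
  qed
qed

text \<open>If only letters are atoms, the Lyndon word \<open>[x, y]\<close> with
  \<open>x < y\<close> contains a relation, which can only be the word itself. Conversely a normal
  word then has no ascent and is nonincreasing, whereas the first letter of a Lyndon word of length
  at least two is smaller than the last.\<close>

lemma atoms_eq_letters_iff: "N = range (\<lambda>x. [x]) \<longleftrightarrow> W = {[x, y] | x y. x < y}"
proof
  assume N: "N = range (\<lambda>x. [x])"
  show "W = {[x, y] | x y. x < y}"
  proof
    show "W \<subseteq> {[x, y] | x y. x < y}"
    proof
      fix w assume "w \<in> W"
      then obtain u v where uv: "w = u @ v" "u \<in> N" "v \<in> N" "u < v" using W_product by blast
      then obtain x y where "u = [x]" "v = [y]" unfolding N by blast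
      then show "w \<in> {[x, y] | x y. x < y}" using uv by auto
    qed
    show "{[x, y] | x y. x < y} \<subseteq> W"
    proof
      fix w :: "'x list" assume "w \<in> {[x, y] | x y. x < y}"
      then obtain x y where w: "w = [x, y]" "x < y" by blast
      then have "lyndon ([x] @ [y])" by (intro lyndon_append lyndon_single) simp
      moreover have "w \<notin> N" unfolding N using w by auto
      ultimately have "w \<notin> NW" using w by (simp add: atom_iff)
      then obtain w' where w': "w' \<in> W" "sublist w' w" by (auto simp: normal_words_def)
      then have "w' = w" using length_W[OF w'(1)] w by (auto simp: sublist_Cons_right prefix_Cons)
      then show "w \<in> W" using w' by simp
    qed
  qed
next
  assume W: "W = {[x, y] | x y. x < y}"
  have "\<exists>x. l = [x]" if "l \<in> N" for l
  proof (rule ccontr)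
    assume *: "\<nexists>x. l = [x]"
    have "l \<in> NW" "lyndon l" using that by (auto simp: atom_iff)
    have "2 \<le> length l" using * lyndon_nonempty[OF \<open>lyndon l\<close>] by (cases l; cases "tl l") auto
    have "\<exists>a b. sublist [a, b] l \<and> a < b"
    proof (rule ccontr)
      assume "\<not> ?thesis"
      then have "sorted_wrt (\<ge>) l" by (intro sorted_wrt_if_no_ascent) (auto simp: not_less)
      then have "last l \<le> hd l" using lyndon_nonempty[OF \<open>lyndon l\<close>] by (cases l) (auto split: if_splits)
      moreover obtain x m y where l: "l = x # m @ [y]"
        using \<open>2 \<le> length l\<close> by (cases l; cases "tl l" rule: rev_cases) auto
      then have "l < [y]" using \<open>lyndon l\<close> proper_suffix_less_if_lyndon[of l "x # m" "[y]"] by simp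
      ultimately show False using l by auto
    qed
    then show False using \<open>l \<in> NW\<close> W by (auto simp: normal_words_def)
  qed
  then show "N = range (\<lambda>x. [x])" by auto
qed

lemma card_W_maximal_iff:
  assumes fin: "finite N"
  shows "2 * card W = card N * (card N - 1) \<longleftrightarrow> N = range (\<lambda>x. [x])"
proof
  assume max: "2 * card W = card N * (card N - 1)"
  have "\<exists>x. l = [x]" if l: "l \<in> N" for l
  proof (rule ccontr)
    assume no: "\<nexists>x. l = [x]"
    have "l \<in> NW" "lyndon l" using l by (simp_all add: atom_iff)
    then have "2 \<le> length l" using no lyndon_nonempty[of l] by (cases l; cases "tl l") auto
    then obtain u v where uv: "l = u @ v" "lyndon u" "lyndon v" "u < v"
      by (rule standard_factorization[OF \<open>lyndon l\<close>])
    have "sublist u l" "sublist v l" using uv(1) by auto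
    then have "u \<in> N" "v \<in> N" using uv \<open>l \<in> NW\<close> normal_words_sublist by (auto simp: atom_iff)
    then have "l \<in> W" using finite_W_if_finite_atoms(3)[OF fin max] uv by blast
    then show False using not_normal_W \<open>l \<in> NW\<close> by blast
  qed
  then show "N = range (\<lambda>x. [x])" by auto
next
  assume N: "N = range (\<lambda>x. [x])"
  have "card N = CARD('x)" unfolding N by (rule card_image) (simp add: inj_on_def)
  have "W = (\<lambda>(x, y). [x, y]) ` {(x, y). x < y}"
    using N unfolding atoms_eq_letters_iff by auto
  then have "card W = card {(x :: 'x, y). x < y}" by (simp add: card_image inj_on_def)
  then show "2 * card W = card N * (card N - 1)"
    using card_ordered_pairs(2)[of "UNIV :: 'x set"] \<open>card N = CARD('x)\<close> by simp
qed

end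

section \<open>Counting normal words\<close>

definition power_bounded :: "(nat \<Rightarrow> nat) \<Rightarrow> real \<Rightarrow> bool" where
  "power_bounded c e \<longleftrightarrow> (\<exists>C>0. \<forall>n\<ge>1. real (c n) \<le> C * real n powr e)"

lemma power_bounded_mono:
  assumes "power_bounded c e" "e \<le> e'"
  shows "power_bounded c e'"
proof -
  obtain C where C: "C > 0" "\<And>n. n \<ge> 1 \<Longrightarrow> real (c n) \<le> C * real n powr e"
    using assms(1) by (auto simp: power_bounded_def)
  have "real (c n) \<le> C * real n powr e'" if "n \<ge> 1" for n
  proof -
    have "real n powr e \<le> real n powr e'" using that assms(2) by (intro powr_mono) auto
    then have "C * real n powr e \<le> C * real n powr e'" using C(1) by simp
    then show ?thesis using C(2)[OF that] by simp
  qed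
  then show ?thesis using C(1) by (auto simp: power_bounded_def)
qed

lemma power_bounded_if_le:
  assumes "\<And>n. c n \<le> (n + 1) ^ D"
  shows "power_bounded c (real D)"
  unfolding power_bounded_def
\<comment> \<open>The constant comes from \<open>n + 1 \<le> 2 * n\<close> for positive
  \<open>n\<close>.\<close>
proof (intro exI[of _ "2 ^ D"] conjI allI impI)
  fix n :: nat assume "1 \<le> n"
  have "real (c n) \<le> real ((n + 1) ^ D)" using assms[of n] by (rule of_nat_mono)
  also have "\<dots> \<le> (2 * real n) ^ D"
    unfolding of_nat_power using \<open>1 \<le> n\<close> by (intro power_mono) auto
  also have "\<dots> = 2 ^ D * real n powr real D"
    using \<open>1 \<le> n\<close> by (simp add: power_mult_distrib powr_realpow)
  finally show "real (c n) \<le> 2 ^ D * real n powr real D" .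
qed simp

text \<open>Lower bounds will be known only at multiples of \<open>K\<close>. There they give
  \<open>q ^ s \<le> B * q powr e\<close> with \<open>B\<close> independent of \<open>q\<close>,
  which fails for large \<open>q\<close> if \<open>e < s\<close>.\<close>

lemma power_bounded_exponent_ge:
  assumes "power_bounded c e" "K \<ge> 1" and lower: "\<And>q. (q + 1) ^ s \<le> c (q * K)"
  shows "real s \<le> e"
proof (rule ccontr)
  assume "\<not> real s \<le> e"
  then have a: "real s - e > 0" by simp
  obtain C where C: "C > 0" "\<And>n. n \<ge> 1 \<Longrightarrow> real (c n) \<le> C * real n powr e"
    using assms(1) by (auto simp: power_bounded_def)
  define B where "B = C * real K powr e"
  have "B > 0" using C(1) assms(2) by (simp add: B_def)
  obtain q0 where q0: "B powr (1 / (real s - e)) < real q0" using reals_Archimedean2 by blast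
  define q where "q = q0 + 1"
  have q: "q \<ge> 1" "B powr (1 / (real s - e)) < real q" using q0 by (auto simp: q_def)
  have "real q powr real s = real (q ^ s)" using q by (simp add: powr_realpow)
  also have "\<dots> \<le> real ((q + 1) ^ s)" by (intro of_nat_mono power_mono) auto
  also have "\<dots> \<le> real (c (q * K))" using lower by (rule of_nat_mono)
  also have "\<dots> \<le> C * real (q * K) powr e" using q assms(2) by (intro C(2)) simp
  also have "\<dots> = B * real q powr e" by (simp add: B_def powr_mult)
  finally have "real q powr real s \<le> B * real q powr e" .
  then have "real q powr (real s - e) \<le> B" using q by (simp add: powr_diff divide_simps)
  moreover have "B < real q powr (real s - e)"
  proof -
    have "B = (B powr (1 / (real s - e))) powr (real s - e)" using a \<open>B > 0\<close> by (simp add: powr_powr)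
    also have "\<dots> < real q powr (real s - e)" using q a by (intro powr_less_mono2) auto
    finally show ?thesis .
  qed
  ultimately show False by simp
qed

lemma Inf_power_bounded:
  assumes "\<And>n. c n \<le> (n + 1) ^ D" "K \<ge> 1" "\<And>q. (q + 1) ^ D \<le> c (q * K)"
  shows "Inf {e. power_bounded c e} = real D"
proof -
  have "power_bounded c e \<longleftrightarrow> real D \<le> e" for e
    using power_bounded_mono[OF power_bounded_if_le[OF assms(1)]] power_bounded_exponent_ge[OF _ assms(2,3)]
    by blast
  then have "{e. power_bounded c e} = {real D..}" by (simp add: atLeast_def)
  then show ?thesis by simp
qed

section \<open>Multiplicities of Lyndon factors\<close>

lemma mset_sorted_wrt_unique:
  fixes xs ys :: "'a::linorder list"
  assumes "mset xs = mset ys" "sorted_wrt (\<ge>) xs" "sorted_wrt (\<ge>) ys"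
  shows "xs = ys"
proof -
  have "sorted (rev xs)" "sorted (rev ys)" using assms(2,3) by (simp_all add: sorted_wrt_rev)
  moreover have "mset (rev xs) = mset (rev ys)" using assms(1) by simp
  ultimately have "rev xs = rev ys" by (metis properties_for_sort)
  then show ?thesis by simp
qed

lemma lyndon_fact_mset_inj: "mset (lyndon_fact v) = mset (lyndon_fact w) \<Longrightarrow> v = w"
  using mset_sorted_wrt_unique[of "lyndon_fact v" "lyndon_fact w"] lyndon_fact(1)[of v] lyndon_fact(1)[of w]
    arg_cong[of "lyndon_fact v" "lyndon_fact w" concat] unfolding lyndon_factors_def lyndon_fact(2) by blast

text \<open>The word with the factors \<open>l \<in> S\<close> in multiplicity \<open>f l\<close>;
  \<open>rev\<close> makes the sorted list nonincreasing.\<close>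

definition lyndon_product :: "'x::linorder list set \<Rightarrow> ('x list \<Rightarrow> nat) \<Rightarrow> 'x list" where
  "lyndon_product S f = concat (rev (sorted_list_of_multiset (\<Sum>l\<in>S. replicate_mset (f l) l)))"

lemma lyndon_product:
  assumes "finite S" "\<And>l. l \<in> S \<Longrightarrow> lyndon l"
  shows "mset (lyndon_fact (lyndon_product S f)) = (\<Sum>l\<in>S. replicate_mset (f l) l)"
    and "length (lyndon_product S f) = (\<Sum>l\<in>S. f l * length l)"
proof -
  let ?M = "\<Sum>l\<in>S. replicate_mset (f l) l"
  have set: "set_mset ?M \<subseteq> S"
    using assms(1) by (auto simp: set_mset_sum split: if_splits)
  have "lyndon_factors (rev (sorted_list_of_multiset ?M))"
    unfolding lyndon_factors_def using set assms(2)
    by (auto simp: sorted_wrt_rev intro: sorted_sorted_list_of_multiset)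
  then have "lyndon_fact (lyndon_product S f) = rev (sorted_list_of_multiset ?M)"
    using lyndon_factors_unique lyndon_fact unfolding lyndon_product_def by blast
  then show "mset (lyndon_fact (lyndon_product S f)) = ?M" by simp
  have "length (lyndon_product S f) = sum_mset (image_mset length ?M)"
    unfolding lyndon_product_def length_concat sum_mset_sum_list[symmetric] by simp
  also have "\<dots> = (\<Sum>l\<in>S. f l * length l)"
    using assms(1) by (induction S rule: finite_induct) simp_all
  finally show "length (lyndon_product S f) = (\<Sum>l\<in>S. f l * length l)" .
qed

context lyndon_antichain
begin

definition "normal_count n = card {w \<in> NW. length w \<le> n}"

lemma finite_bounded_words: "finite {w \<in> S. length (w :: 'x list) \<le> n}"
  by (rule finite_subset[of _ "{w. set w \<subseteq> UNIV \<and> length w \<le> n}"])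
    (use finite_lists_length_le[of "UNIV :: 'x set" n] in auto)

text \<open>A normal word is determined by the multiplicities of its factors. These factors are
  atoms, and each multiplicity is at most the length of the word.\<close>

lemma normal_count_le:
  assumes "finite N"
  shows "normal_count n \<le> (n + 1) ^ card N"
proof -
  define F where "F w = restrict (count (mset (lyndon_fact w))) N" for w :: "'x list"
  have cnt: "count (mset (lyndon_fact w)) l = 0" if "w \<in> NW" "l \<notin> N" for w l
    using set_lyndon_fact_normal[OF that(1)] that(2) by (auto simp: count_eq_zero_iff)
  have "inj_on F {w \<in> NW. length w \<le> n}"
  proof (rule inj_onI)
    fix v w assume vw: "v \<in> {w \<in> NW. length w \<le> n}" "w \<in> {w \<in> NW. length w \<le> n}" "F v = F w"
    have "count (mset (lyndon_fact v)) l = count (mset (lyndon_fact w)) l" for l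
    proof (cases "l \<in> N")
      case True
      then show ?thesis using fun_cong[OF vw(3), of l] by (simp add: F_def)
    next
      case False
      have "v \<in> NW" "w \<in> NW" using vw(1,2) by simp_all
      then show ?thesis using cnt[OF _ False] by (simp only: count_mset)
    qed
    then show "v = w" by (intro lyndon_fact_mset_inj multiset_eqI)
  qed
  moreover have "F ` {w \<in> NW. length w \<le> n} \<subseteq> N \<rightarrow>\<^sub>E {..n}"
  proof
    fix h assume "h \<in> F ` {w \<in> NW. length w \<le> n}"
    then obtain w where w: "h = F w" "w \<in> NW" "length w \<le> n" by blast
    have "count (mset (lyndon_fact w)) l \<le> n" for l
    proof -
      have "count (mset (lyndon_fact w)) l \<le> length (lyndon_fact w)"
        unfolding count_mset by (rule count_le_length)
      also have "\<dots> \<le> sum_list (map length (lyndon_fact w))"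
      proof -
        have "length ls \<le> sum_list (map length ls)" if "\<forall>l\<in>set ls. l \<noteq> []" for ls :: "'x list list"
          using that
        proof (induction ls)
          case (Cons l ls)
          then show ?case by (cases l) auto
        qed simp
        then show ?thesis
          using lyndon_fact(1)[of w] lyndon_nonempty by (auto simp: lyndon_factors_def)
      qed
      also have "\<dots> = length w" by (metis length_concat lyndon_fact(2))
      finally show ?thesis using w by simp
    qed
    then show "h \<in> N \<rightarrow>\<^sub>E {..n}" using w by (auto simp: F_def)
  qed
  ultimately have "card {w \<in> NW. length w \<le> n} \<le> card (N \<rightarrow>\<^sub>E {..n})"
    using assms by (intro card_inj_on_le) (auto intro: finite_PiE)
  then show ?thesis using assms by (simp add: normal_count_def card_PiE)
qed

text \<open>Multiplicities up to \<open>q\<close> yield different normal words. As \<open>S\<close>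
  may be any finite set of atoms, infinitely many atoms exclude every exponent.\<close>

lemma normal_count_ge:
  assumes "finite S" "S \<subseteq> N"
  shows "(q + 1) ^ card S \<le> normal_count (q * (\<Sum>l\<in>S. length l))"
proof -
  have lyn: "lyndon l" if "l \<in> S" for l using assms(2) that by (auto simp: atom_iff)
  note prod = lyndon_product[OF assms(1) lyn]
  have count: "count (\<Sum>l\<in>S. replicate_mset (f l) l) k = (if k \<in> S then f k else 0)" for f k
    using assms(1) by (simp add: count_sum)
  have "inj_on (lyndon_product S) (S \<rightarrow>\<^sub>E {..q})"
  proof (rule inj_onI)
    fix f g assume fg: "f \<in> S \<rightarrow>\<^sub>E {..q}" "g \<in> S \<rightarrow>\<^sub>E {..q}" "lyndon_product S f = lyndon_product S g"
    have eq: "(\<Sum>l\<in>S. replicate_mset (f l) l) = (\<Sum>l\<in>S. replicate_mset (g l) l)"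
      using prod(1)[of f] prod(1)[of g] fg(3) by simp
    show "f = g"
    proof (rule PiE_ext[OF fg(1,2)])
      fix k assume "k \<in> S"
      then show "f k = g k" using arg_cong[OF eq, of "\<lambda>M. count M k"] by (simp add: count)
    qed
  qed
  moreover have "lyndon_product S ` (S \<rightarrow>\<^sub>E {..q}) \<subseteq> {w \<in> NW. length w \<le> q * (\<Sum>l\<in>S. length l)}"
  proof
    fix w assume "w \<in> lyndon_product S ` (S \<rightarrow>\<^sub>E {..q})"
    then obtain f where f: "f \<in> S \<rightarrow>\<^sub>E {..q}" "w = lyndon_product S f" by blast
    have "set (lyndon_fact w) = {k. count (mset (lyndon_fact w)) k \<noteq> 0}"
      by (auto simp: count_eq_zero_iff)
    also have "\<dots> \<subseteq> N" using assms(2) by (auto simp: f(2) prod(1) count split: if_splits)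
    finally have "w \<in> NW" using concat_normal[OF lyndon_fact(1)] lyndon_fact(2)[of w] by metis
    moreover have "length w \<le> (\<Sum>l\<in>S. q * length l)"
      unfolding f(2) using f(1) by (subst prod(2)) (auto intro!: sum_mono mult_le_mono1)
    ultimately show "w \<in> {w \<in> NW. length w \<le> q * (\<Sum>l\<in>S. length l)}"
      by (simp add: sum_distrib_left)
  qed
  ultimately have "card (S \<rightarrow>\<^sub>E {..q}) \<le> normal_count (q * (\<Sum>l\<in>S. length l))"
    unfolding normal_count_def using finite_bounded_words by (rule card_inj_on_le)
  then show ?thesis using assms(1) by (simp add: card_PiE)
qed

lemma sum_length_ge_1:
  assumes "finite S" "S \<subseteq> N" "S \<noteq> {}"
  shows "1 \<le> (\<Sum>l\<in>S. length l)"
proof -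
  obtain l where l: "l \<in> S" using assms by blast
  then have "length l \<le> (\<Sum>l\<in>S. length l)" using assms(1) by (intro member_le_sum) auto
  moreover have "l \<in> N" using l assms(2) by blast
  then have "l \<noteq> []" by (simp add: atom_iff lyndon_nonempty)
  ultimately show ?thesis by (cases l) auto
qed

lemma power_bounded_normal_count_iff: "(\<exists>e. power_bounded normal_count e) \<longleftrightarrow> finite N"
proof
  assume "\<exists>e. power_bounded normal_count e"
  then obtain e where e: "power_bounded normal_count e" ..
  show "finite N"
  proof (rule ccontr)
    assume "infinite N"
    then obtain S where S: "finite S" "card S = nat \<lceil>e\<rceil> + 1" "S \<subseteq> N"
      using infinite_arbitrarily_large by blast
    have "S \<noteq> {}" using S by auto
    then have "real (card S) \<le> e"
      using power_bounded_exponent_ge[OF e sum_length_ge_1[OF S(1,3)] normal_count_ge[OF S(1,3)]] by blast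
    then show False using S(2) by linarith
  qed
next
  assume "finite N"
  then show "\<exists>e. power_bounded normal_count e" using power_bounded_if_le normal_count_le by blast
qed

lemma Inf_power_bounded_normal_count:
  assumes "finite N"
  shows "Inf {e. power_bounded normal_count e} = real (card N)"
proof (rule Inf_power_bounded[OF normal_count_le[OF assms] _ normal_count_ge[OF assms]])
  show "1 \<le> (\<Sum>l\<in>N. length l)"
    using assms single_atom by (intro sum_length_ge_1) blast+
qed simp

end

section \<open>The monomial algebra\<close>

type_synonym ('x, 'k) ncpoly = "'x list \<Rightarrow>\<^sub>0 'k"

abbreviation "lookup \<equiv> Poly_Mapping.lookup"
abbreviation "single \<equiv> Poly_Mapping.single"
abbreviation "keys \<equiv> Poly_Mapping.keys"

lemma ring_free_algebra: "ring (free_algebra :: ('x, 'k::field) ncpoly ring)"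
proof -
  have "\<exists>y. x + y = 0" "\<exists>y. y + x = 0" for x :: "'x list \<Rightarrow>\<^sub>0 'k"
    by (rule exI[of _ "- x"], simp)+
  then show ?thesis
    unfolding free_algebra_def ring_of_type_algebra_def
    by unfold_locales (auto simp: Units_def algebra_simps)
qed

lemma free_algebra_simps [simp]:
  "carrier free_algebra = UNIV" "f \<otimes>\<^bsub>free_algebra\<^esub> g = f * g" "f \<oplus>\<^bsub>free_algebra\<^esub> g = f + g"
  "\<zero>\<^bsub>free_algebra\<^esub> = 0" "\<one>\<^bsub>free_algebra\<^esub> = 1"
  by (simp_all add: free_algebra_def ring_of_type_algebra_def)

lemma poly_mapping_sum_single: "p = (\<Sum>w\<in>keys p. single w (lookup p w))"
proof (rule poly_mapping_eqI)
  fix k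
  have "(\<Sum>w\<in>keys p. lookup (single w (lookup p w)) k) =
      (\<Sum>w\<in>keys p. if w = k then lookup p k else 0)"
    by (intro sum.cong) (auto simp: lookup_single when_def)
  then show "lookup p k = lookup
      (\<Sum>w\<in>keys p. single w (lookup p w)) k"
    by (simp add: lookup_sum in_keys_iff)
qed

lemma single_word_mult:
  "single u a * single v b = single (u @ v) (a * b :: 'k::field)"
  by (simp add: mult_single plus_list_def)

lemma poly_one: "(1 :: 'x list \<Rightarrow>\<^sub>0 'k::field) = single [] 1"
  by (simp add: single_one zero_list_def flip: zero_list_def)

lemma keys_mult_words:
  "w \<in> keys (f * g) \<Longrightarrow> \<exists>u v. w = u @ v \<and> u \<in> keys f \<and> v \<in> keys g"
  using keys_mult[of f g] by (auto simp: plus_list_def)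

definition restrict_poly :: "'a set \<Rightarrow> ('a \<Rightarrow>\<^sub>0 'k::zero) \<Rightarrow> ('a \<Rightarrow>\<^sub>0 'k)" where
  "restrict_poly S = Poly_Mapping.mapp (\<lambda>w c. if w \<in> S then c else 0)"

lemma lookup_restrict_poly:
  "lookup (restrict_poly S p) w = (if w \<in> S then lookup p w else 0)"
  by (auto simp: restrict_poly_def lookup_mapp when_def in_keys_iff)

lemma keys_restrict_poly: "keys (restrict_poly S p) = keys p \<inter> S"
  by (auto simp: in_keys_iff lookup_restrict_poly split: if_splits)

lemma restrict_poly_add: "restrict_poly S (p + q) = restrict_poly S p + restrict_poly S q"
  by (rule poly_mapping_eqI) (simp add: lookup_restrict_poly lookup_add)

lemma restrict_poly_diff:
  "restrict_poly S (p - q) = restrict_poly S p - restrict_poly S (q :: 'a \<Rightarrow>\<^sub>0 'k::field)"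
  by (rule poly_mapping_eqI) (simp add: lookup_restrict_poly lookup_minus)

lemma restrict_poly_uminus: "restrict_poly S (- p) = - restrict_poly S (p :: 'a \<Rightarrow>\<^sub>0 'k::field)"
  by (rule poly_mapping_eqI) (simp add: lookup_restrict_poly)

lemma restrict_poly_0 [simp]: "restrict_poly S 0 = 0"
  by (rule poly_mapping_eqI) (simp add: lookup_restrict_poly)

lemma restrict_poly_idem [simp]: "restrict_poly S (restrict_poly S p) = restrict_poly S p"
  by (rule poly_mapping_eqI) (simp add: lookup_restrict_poly)

lemma restrict_poly_id: "keys p \<subseteq> S \<Longrightarrow> restrict_poly S p = p"
  by (rule poly_mapping_eqI) (auto simp: lookup_restrict_poly in_keys_iff)

lemma restrict_poly_single:
  "restrict_poly S (single w c) = (if w \<in> S then single w c else 0)"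
  by (rule poly_mapping_eqI) (auto simp: lookup_restrict_poly lookup_single when_def)

lemma restrict_poly_eq_0_iff:
  "restrict_poly S p = 0 \<longleftrightarrow> (\<forall>w\<in>keys p. w \<notin> S)"
  by (auto simp: poly_mapping_eq_iff fun_eq_iff lookup_restrict_poly in_keys_iff)

section \<open>Normal forms modulo the ideal of \<open>W\<close>\<close>

locale monomial_quotient =
  fixes W :: "'x list set" and I :: "('x, 'k::field) ncpoly set"
    and A :: "('x, 'k) ncpoly set ring"
  assumes I_eq: "I = word_ideal W" and A_eq: "A = quotient_algebra I" and Nil_not_W: "[] \<notin> W"
begin

text \<open>The ideal is spanned by words, so full reduction just deletes the monomials that are not
  normal.\<close>

definition nf :: "('x, 'k) ncpoly \<Rightarrow> ('x, 'k) ncpoly" where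
  "nf = restrict_poly (normal_words W)"

abbreviation res :: "('x, 'k) ncpoly \<Rightarrow> ('x, 'k) ncpoly set" where
  "res \<equiv> residue_class I"

lemma nf_0 [simp]: "nf 0 = 0"
  and nf_nf [simp]: "nf (nf p) = nf p"
  and nf_add: "nf (p + q) = nf p + nf q"
  and nf_diff: "nf (p - q) = nf p - nf q"
  and nf_uminus: "nf (- p) = - nf p"
  and nf_id: "keys p \<subseteq> normal_words W \<Longrightarrow> nf p = p"
  and nf_single: "nf (single w c) = (if w \<in> normal_words W then single w c else 0)"
  and lookup_nf: "lookup (nf p) w = (if w \<in> normal_words W then lookup p w else 0)"
  and keys_nf: "keys (nf p) = keys p \<inter> normal_words W"
  and nf_eq_0_iff: "nf p = 0 \<longleftrightarrow> (\<forall>w\<in>keys p. w \<notin> normal_words W)"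
  by (simp_all add: nf_def restrict_poly_add restrict_poly_diff restrict_poly_uminus restrict_poly_id
      restrict_poly_single lookup_restrict_poly keys_restrict_poly restrict_poly_eq_0_iff)

lemma Nil_normal: "[] \<in> normal_words W"
  using Nil_not_W by (auto simp: normal_words_def)

lemma nf_one [simp]: "nf 1 = 1"
  using Nil_normal by (simp add: poly_one nf_single)

lemma nf_mult_eq_0:
  assumes "nf p = 0"
  shows "nf (q * p) = 0" "nf (p * q) = 0"
proof -
  have p: "w \<notin> normal_words W" if "w \<in> keys p" for w using assms that by (auto simp: nf_eq_0_iff)
  show "nf (q * p) = 0" unfolding nf_eq_0_iff
  proof
    fix w assume "w \<in> keys (q * p)"
    then obtain u v where "w = u @ v" "v \<in> keys p" using keys_mult_words by blast
    then show "w \<notin> normal_words W" using p normal_words_sublist[of w W v] by auto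
  qed
  show "nf (p * q) = 0" unfolding nf_eq_0_iff
  proof
    fix w assume "w \<in> keys (p * q)"
    then obtain u v where "w = v @ u" "v \<in> keys p" using keys_mult_words by blast
    then show "w \<notin> normal_words W" using p normal_words_sublist[of w W v] by auto
  qed
qed

lemma nf_mult_nf: "nf (p * nf q) = nf (p * q)" "nf (nf p * q) = nf (p * q)"
proof -
  have "nf (p * (q - nf q)) = 0" "nf ((p - nf p) * q) = 0" by (rule nf_mult_eq_0, simp add: nf_diff)+
  then show "nf (p * nf q) = nf (p * q)" "nf (nf p * q) = nf (p * q)"
    by (simp_all add: nf_diff algebra_simps)
qed

lemma ideal_nf: "ideal {p. nf p = 0} free_algebra"
proof (rule idealI)
  show "subgroup {p. nf p = 0} (add_monoid free_algebra)"
  proof (intro group.subgroupI)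
    show "Group.group (add_monoid (free_algebra :: ('x, 'k) ncpoly ring))"
      using ring_free_algebra by (intro abelian_group.a_group ring.is_abelian_group)
    fix p assume "p \<in> {p. nf p = 0}"
    moreover have "inv\<^bsub>add_monoid free_algebra\<^esub> p = - p"
    proof (rule group.inv_equality)
      show "Group.group (add_monoid (free_algebra :: ('x, 'k) ncpoly ring))"
        using ring_free_algebra by (intro abelian_group.a_group ring.is_abelian_group)
    qed simp_all
    ultimately show "inv\<^bsub>add_monoid free_algebra\<^esub> p \<in> {p. nf p = 0}" by (simp add: nf_uminus)
  qed (auto simp: nf_add intro: exI[of _ 0])
qed (auto simp: ring_free_algebra nf_mult_eq_0)

text \<open>Words that are not normal are multiples of generators, and the polynomials without
  normal words form an ideal that contains the generators.\<close>

lemma I_iff: "p \<in> I \<longleftrightarrow> nf p = 0"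
proof -
  interpret ring "free_algebra :: ('x, 'k) ncpoly ring" by (rule ring_free_algebra)
  interpret I: ideal I free_algebra unfolding I_eq word_ideal_def by (rule genideal_ideal) simp
  have mem: "single w c \<in> I" if w: "w \<notin> normal_words W" for w c
  proof -
    obtain u where u: "u \<in> W" "sublist u w" using w by (auto simp: normal_words_def)
    then obtain a b where w: "w = a @ u @ b" by (auto simp: sublist_def)
    have "word_monom u \<in> I"
      unfolding I_eq word_ideal_def using u genideal_self[of "word_monom ` W"] by auto
    then have "single a c * word_monom u * single b 1 \<in> I"
      using I.I_l_closed[of "word_monom u" "single a c"] I.I_r_closed by simp
    then show ?thesis by (simp add: word_monom_def single_word_mult w)
  qed
  have sum: "(\<Sum>w\<in>S. f w) \<in> I" if "finite S" "\<And>w. w \<in> S \<Longrightarrow> f w \<in> I" for S f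
    using that
  proof (induction S rule: finite_induct)
    case empty
    then show ?case using I.zero_closed by simp
  next
    case (insert w S)
    then show ?case using I.a_closed[of "f w" "sum f S"] by simp
  qed
  have "I \<subseteq> {p. nf p = 0}"
    unfolding I_eq word_ideal_def
    by (rule genideal_minimal[OF ideal_nf]) (auto simp: word_monom_def nf_single normal_words_def)
  moreover have "p \<in> I" if "nf p = 0"
    using that by (subst poly_mapping_sum_single, intro sum mem) (auto simp: nf_eq_0_iff)
  ultimately show ?thesis by blast
qed

lemma I_ideal: "ideal I free_algebra"
proof -
  have "{p. nf p = 0} = I" using I_iff by blast
  from ideal_nf[unfolded this] show ?thesis .
qed

lemma res_eq: "res p = {q. nf q = nf p}"
proof -
  have "res p = {h + p | h. nf h = 0}"
    by (auto simp: residue_class_def a_r_coset_def' I_iff)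
  also have "\<dots> = {q. nf q = nf p}"
  proof -
    have "\<exists>h. q = h + p \<and> nf h = 0" if "nf q = nf p" for q
      using that by (intro exI[of _ "q - p"]) (simp add: nf_diff)
    then show ?thesis by (auto simp: nf_add)
  qed
  finally show ?thesis .
qed

lemma res_eq_iff: "res p = res q \<longleftrightarrow> nf p = nf q"
proof
  assume "res p = res q"
  moreover have "p \<in> res p" by (simp add: res_eq)
  ultimately have "p \<in> res q" by simp
  then show "nf p = nf q" by (simp add: res_eq)
qed (simp add: res_eq)

lemma res_nf [simp]: "res (nf p) = res p"
  by (simp add: res_eq_iff)

lemma ring_A: "ring A"
  unfolding A_eq quotient_algebra_def by (rule ideal.quotient_is_ring[OF I_ideal])

lemma carrier_A: "carrier A = range res"
  unfolding A_eq quotient_algebra_def FactRing_def A_RCOSETS_def' residue_class_def by auto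

lemma A_simps [simp]:
  "res p \<in> carrier A" "res p \<oplus>\<^bsub>A\<^esub> res q = res (p + q)" "res p \<otimes>\<^bsub>A\<^esub> res q = res (p * q)"
  "\<one>\<^bsub>A\<^esub> = res 1" "\<zero>\<^bsub>A\<^esub> = res 0"
proof -
  interpret ideal I free_algebra by (rule I_ideal)
  show "res p \<in> carrier A" by (simp add: carrier_A)
  show "res p \<oplus>\<^bsub>A\<^esub> res q = res (p + q)"
    using a_rcos_sum[of p q] by (simp add: A_eq quotient_algebra_def FactRing_def residue_class_def)
  show "res p \<otimes>\<^bsub>A\<^esub> res q = res (p * q)"
    using rcoset_mult_add[of p q] by (simp add: A_eq quotient_algebra_def FactRing_def residue_class_def)
  show "\<one>\<^bsub>A\<^esub> = res 1"
    by (simp add: A_eq quotient_algebra_def FactRing_def residue_class_def)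
  have "\<zero>\<^bsub>A\<^esub> = I" by (simp add: A_eq quotient_algebra_def FactRing_def)
  moreover have "I = res 0" unfolding res_eq using I_iff by auto
  ultimately show "\<zero>\<^bsub>A\<^esub> = res 0" by (rule trans)
qed

text \<open>All members of a residue class have the same normal form, so on elements of
  \<open>A\<close> the choice does not affect the value.\<close>

definition rep :: "('x, 'k) ncpoly set \<Rightarrow> ('x, 'k) ncpoly" where
  "rep a = nf (SOME p. p \<in> a)"

lemma rep_res [simp]: "rep (res p) = nf p"
proof -
  have "(SOME q. q \<in> res p) \<in> res p" by (rule someI[of "\<lambda>q. q \<in> res p" p]) (simp add: res_eq)
  then show ?thesis by (simp add: rep_def res_eq)
qed

lemma res_rep: "a \<in> carrier A \<Longrightarrow> res (rep a) = a"
  by (auto simp: carrier_A)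

lemma rep_mult: "a \<in> carrier A \<Longrightarrow> b \<in> carrier A \<Longrightarrow> rep (a \<otimes>\<^bsub>A\<^esub> b) = nf (rep a * rep b)"
  by (auto simp: carrier_A nf_mult_nf)

lemma rep_add: "a \<in> carrier A \<Longrightarrow> b \<in> carrier A \<Longrightarrow> rep (a \<oplus>\<^bsub>A\<^esub> b) = rep a + rep b"
  by (auto simp: carrier_A nf_add)

lemma finsum_res: "finite S \<Longrightarrow> (\<Oplus>\<^bsub>A\<^esub>w\<in>S. res (p w)) = res (\<Sum>w\<in>S. p w)"
proof (induction S rule: finite_induct)
  case empty
  interpret ring A by (rule ring_A)
  show ?case using finsum_empty by simp
next
  case (insert w S)
  interpret ring A by (rule ring_A)
  have "(\<Oplus>\<^bsub>A\<^esub>v\<in>insert w S. res (p v)) = res (p w) \<oplus>\<^bsub>A\<^esub> (\<Oplus>\<^bsub>A\<^esub>v\<in>S. res (p v))"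
    using insert.hyps by (intro finsum_insert) auto
  then show ?case using insert by simp
qed

subsection \<open>Standard finite presentations\<close>

lemma leading_word_single [simp]: "leading_word r (word_monom w :: 'x list \<Rightarrow>\<^sub>0 'k) = w"
  unfolding leading_word_def word_monom_def by (rule the_equality) auto

lemma leading_word_in_keys:
  assumes "admissible_order r" "f \<noteq> 0"
  shows "leading_word r f \<in> keys (f :: 'x list \<Rightarrow>\<^sub>0 'k)"
proof -
  have r: "wf r" "trans r" "total r" using assms by (auto simp: admissible_order_def)
  have ex: "\<exists>u\<in>S. \<forall>v\<in>S. v \<noteq> u \<longrightarrow> (v, u) \<in> r" if "finite S" "S \<noteq> {}" for S
    using that
  proof (induction S rule: finite_ne_induct)
    case (insert x S)
    then obtain u where u: "u \<in> S" "\<forall>v\<in>S. v \<noteq> u \<longrightarrow> (v, u) \<in> r" by blast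
    have "x \<noteq> u" using insert u by blast
    then consider "(x, u) \<in> r" | "(u, x) \<in> r" using r(3) by (auto simp: total_on_def)
    then show ?case
    proof cases
      case 2
      have "(v, x) \<in> r" if "v \<in> S" for v
      proof (cases "v = u")
        case False
        then have "(v, u) \<in> r" using u that by blast
        then show ?thesis using 2 by (rule transD[OF r(2)])
      qed (use 2 in simp)
      then show ?thesis by blast
    qed (use u in blast)
  qed simp
  obtain u where u: "u \<in> keys f" "\<forall>v\<in>keys f. v \<noteq> u \<longrightarrow> (v, u) \<in> r"
    using ex[of "keys f"] assms(2) by auto
  have "leading_word r f = u"
    unfolding leading_word_def
  proof (rule the_equality)
    fix v assume v: "v \<in> keys f \<and> (\<forall>w\<in>keys f. w \<noteq> v \<longrightarrow> (w, v) \<in> r)"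
    show "v = u"
    proof (rule ccontr)
      assume "v \<noteq> u"
      then have "(u, v) \<in> r" using u(1) v by metis
      moreover have "(v, u) \<in> r" using u(2) v \<open>v \<noteq> u\<close> by metis
      ultimately show False using wf_asym[OF r(1), of u v] by simp
    qed
  qed (use u in blast)
  then show ?thesis using u by simp
qed

lemma I_leading_word:
  assumes "admissible_order r" "f \<in> I - {0}"
  shows "\<exists>w\<in>W. sublist w (leading_word r f)"
proof -
  have "nf f = 0" "f \<noteq> 0" using assms(2) I_iff by blast+
  then have "leading_word r f \<notin> normal_words W"
    using leading_word_in_keys[OF assms(1)] nf_eq_0_iff by blast
  then show ?thesis by (simp add: normal_words_def)
qed

lemma word_monom_W:
  assumes "w \<in> W"
  shows "word_monom w \<in> I - {0}"
proof -
  have "w \<notin> normal_words W" using assms by (auto simp: normal_words_def)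
  then have "word_monom w \<in> I" by (simp add: I_iff nf_single word_monom_def)
  moreover have "keys (word_monom w :: 'x list \<Rightarrow>\<^sub>0 'k) \<noteq> {}" by (simp add: word_monom_def)
  ultimately show ?thesis by auto
qed

text \<open>A leading word that divides \<open>w \<in> W\<close> contains itself a word of
  \<open>W\<close>, which is \<open>w\<close> by the antichain property; so every word of
  \<open>W\<close> is a leading word in any Groebner basis. Conversely the words of \<open>W\<close>
  form a reduced basis, whatever the admissible order.\<close>

lemma standard_finite_presentation_iff:
  assumes r: "admissible_order r" and W: "antichain W"
  shows "standard_finite_presentation r I \<longleftrightarrow> finite W"
proof
  have anti: "u = v" if "u \<in> W" "v \<in> W" "sublist u v" for u v
    using W that by (auto simp: antichain_def strict_sublist_def)
  {
    assume "standard_finite_presentation r I"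
    then obtain G where G: "groebner_basis r I G" "finite G"
      by (auto simp: standard_finite_presentation_def reduced_groebner_basis_def)
    have "W \<subseteq> leading_word r ` G"
    proof
      fix w assume w: "w \<in> W"
      have "word_monom w \<in> I - {0}" using w by (rule word_monom_W)
      then obtain g where g: "g \<in> G" "sublist (leading_word r g) w"
        using G(1) unfolding groebner_basis_def by (metis leading_word_single)
      have "g \<in> I - {0}" using G(1) g by (auto simp: groebner_basis_def)
      then obtain u where u: "u \<in> W" "sublist u (leading_word r g)" using I_leading_word[OF r] by blast
      then have "sublist u w" using g sublist_order.order.trans by blast
      then have "u = w" using anti u w by blast
      then have "leading_word r g = w"
        using g(2) u(2) by (intro sublist_order.order.antisym) simp_all
      then show "w \<in> leading_word r ` G" using g by blast
    qed
    then show "finite W" by (rule finite_subset) (simp add: G(2))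
  }
  {
    assume "finite W"
    have "reduced_groebner_basis r I (word_monom ` W)"
      unfolding reduced_groebner_basis_def groebner_basis_def
    proof (intro conjI ballI)
      show "word_monom ` W \<subseteq> I - {0}" by (rule image_subsetI) (rule word_monom_W)
      fix f assume "f \<in> I - {0}"
      then obtain w where "w \<in> W" "sublist w (leading_word r f)"
        using I_leading_word[OF r] by blast
      then show "\<exists>g\<in>word_monom ` W :: ('x, 'k) ncpoly set. sublist (leading_word r g) (leading_word r f)"
        by (intro bexI[of _ "word_monom w"]) simp_all
    next
      fix g :: "'x list \<Rightarrow>\<^sub>0 'k" assume "g \<in> word_monom ` W"
      then obtain w where w: "g = word_monom w" "w \<in> W" by blast
      show "lookup g (leading_word r g) = 1" by (simp add: w, simp add: word_monom_def)
      fix h u assume h: "h \<in> word_monom ` W - {g}" and u: "u \<in> keys g"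
      obtain v where v: "h = word_monom v" "v \<in> W" using h by blast
      then have "v \<noteq> w" using h w(1) by auto
      have "u = w" using u by (simp add: w word_monom_def)
      then show "\<not> sublist (leading_word r h) u"
        using anti[OF v(2) w(2)] \<open>v \<noteq> w\<close> v(1) by auto
    qed
    then show "standard_finite_presentation r I"
      using \<open>finite W\<close> unfolding standard_finite_presentation_def
      by (intro exI[of _ "word_monom ` W"]) simp
  }
qed

subsection \<open>Growth\<close>

lemma scalar_class_eq: "scalar_class I c = res (single [] c)"
  by (simp add: scalar_class_def)

text \<open>The scalars are the image of a field under a nonzero ring homomorphism. Being a subfield
  makes the dimension of a subspace unique.\<close>

lemma subfield_scalars: "subfield (range (scalar_class I)) A"
proof -
  let ?K = "ring_of_type_algebra :: 'k ring"
  have K: "Ring.field ?K" by (rule field_from_type_algebra)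
  interpret K: Ring.field ?K by (rule K)
  interpret A: ring A by (rule ring_A)
  have "ring_hom_ring ?K A (scalar_class I)"
  proof (intro ring_hom_ringI)
    show "ring ?K" "ring A" by (rule K.ring_axioms, rule ring_A)
    show "scalar_class I (x \<otimes>\<^bsub>?K\<^esub> y) = scalar_class I x \<otimes>\<^bsub>A\<^esub> scalar_class I y" for x y
      by (simp add: scalar_class_eq ring_of_type_algebra_def single_word_mult)
    show "scalar_class I (x \<oplus>\<^bsub>?K\<^esub> y) = scalar_class I x \<oplus>\<^bsub>A\<^esub> scalar_class I y" for x y
      by (simp add: scalar_class_eq ring_of_type_algebra_def single_add)
    show "scalar_class I \<one>\<^bsub>?K\<^esub> = \<one>\<^bsub>A\<^esub>"
      by (simp add: scalar_class_eq ring_of_type_algebra_def poly_one)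
    show "scalar_class I x \<in> carrier A" for x by (simp add: scalar_class_eq)
  qed
  moreover have "\<one>\<^bsub>A\<^esub> \<noteq> \<zero>\<^bsub>A\<^esub>" by (simp add: res_eq_iff)
  ultimately have "subfield (scalar_class I ` carrier ?K) A"
    using ring_hom_ring.img_is_subfield(2) K.carrier_is_subfield by blast
  then show ?thesis by (simp add: ring_of_type_algebra_def)
qed

lemma line_extension_words:
  "ring.line_extension A (range (scalar_class I)) (res (word_monom w)) (res ` {f. keys f \<subseteq> S}) =
    res ` {f. keys f \<subseteq> insert w S}" (is "?L = ?R")
proof -
  interpret A: ring A by (rule ring_A)
  have mult: "scalar_class I c \<otimes>\<^bsub>A\<^esub> res (word_monom w) \<oplus>\<^bsub>A\<^esub> res f = res (single w c + f)" for c f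
    by (simp add: scalar_class_eq word_monom_def single_word_mult)
  have "?L = {scalar_class I c \<otimes>\<^bsub>A\<^esub> res (word_monom w) \<oplus>\<^bsub>A\<^esub> res f | c f. keys f \<subseteq> S}"
    by (rule Set.set_eqI) (force simp: A.line_extension_mem_iff)
  also have "\<dots> = {res (single w c + f) | c f. keys f \<subseteq> S}"
    unfolding mult ..
  also have "\<dots> = ?R"
  proof (intro Set.set_eqI iffI)
    fix a assume "a \<in> {res (single w c + f) | c f. keys f \<subseteq> S}"
    then obtain c f where a: "a = res (single w c + f)" "keys f \<subseteq> S" by blast
    have "keys (single w c + f) \<subseteq> insert w S"
      using a(2) keys_add[of "single w c" f] by (auto split: if_splits)
    then show "a \<in> ?R" using a(1) by blast
  next
    fix a assume "a \<in> ?R"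
    then obtain f where f: "a = res f" "keys f \<subseteq> insert w S" by blast
    define g where "g = f - single w (lookup f w)"
    have "f = single w (lookup f w) + g" by (simp add: g_def)
    moreover have "keys g \<subseteq> S"
    proof
      fix v assume v: "v \<in> keys g"
      then have "v \<noteq> w" by (auto simp: g_def in_keys_iff lookup_minus)
      then have "v \<in> keys f" using v by (auto simp: g_def in_keys_iff lookup_minus lookup_single when_def)
      then show "v \<in> S" using f \<open>v \<noteq> w\<close> by blast
    qed
    ultimately have "a = res (single w (lookup f w) + g) \<and> keys g \<subseteq> S"
      using f(1) by simp
    then show "a \<in> {res (single w c + f) | c f. keys f \<subseteq> S}" by blast
  qed
  finally show ?thesis .
qed

text \<open>The dimension predicate grows by adjoining lines; a further normal word is outside the
  span of the earlier ones because its coefficient survives in the normal form.\<close>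

lemma dimension_words:
  assumes "distinct ws" "set ws \<subseteq> normal_words W"
  shows "ring.dimension A (length ws) (range (scalar_class I)) (res ` {f. keys f \<subseteq> set ws})"
  using assms
proof (induction ws)
  case Nil
  interpret A: ring A by (rule ring_A)
  have "{f. keys f \<subseteq> set []} = {0 :: 'x list \<Rightarrow>\<^sub>0 'k}" by auto
  then show ?case using A.zero_dim by simp
next
  case (Cons w ws)
  interpret A: ring A by (rule ring_A)
  have "res (word_monom w) \<notin> res ` {f. keys f \<subseteq> set ws}"
  proof
    assume "res (word_monom w) \<in> res ` {f. keys f \<subseteq> set ws}"
    then obtain f where f: "nf (word_monom w) = nf f" "keys f \<subseteq> set ws"
      by (auto simp: res_eq_iff)
    have "lookup (nf (word_monom w)) w = 1"
      using Cons.prems by (simp add: lookup_nf word_monom_def)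
    moreover have "lookup (nf f) w = 0"
      using f(2) Cons.prems by (auto simp: lookup_nf in_keys_iff)
    ultimately show False using f(1) by simp
  qed
  moreover have "A.dimension (length ws) (range (scalar_class I)) (res ` {f. keys f \<subseteq> set ws})"
    using Cons by simp
  ultimately have "A.dimension (Suc (length ws)) (range (scalar_class I))
      (A.line_extension (range (scalar_class I)) (res (word_monom w)) (res ` {f. keys f \<subseteq> set ws}))"
    by (intro A.Suc_dim) simp_all
  then show ?case by (simp add: line_extension_words)
qed

lemma graded_dim_eq:
  assumes fin: "finite {w \<in> normal_words W. length w = n}"
  shows "graded_dim I n = card {w \<in> normal_words W. length w = n}"
proof -
  interpret A: ring A by (rule ring_A)
  obtain ws where ws: "set ws = {w \<in> normal_words W. length w = n}" "distinct ws"
    using finite_distinct_list[OF fin] by blast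
  have "graded_part I n = res ` {f. keys f \<subseteq> set ws}"
  proof (intro Set.set_eqI iffI)
    fix a assume "a \<in> graded_part I n"
    then obtain f where f: "a = res f" "\<forall>w\<in>keys f. length w = n"
      by (auto simp: graded_part_def)
    have "keys (nf f) \<subseteq> set ws" using f(2) by (auto simp: keys_nf ws)
    then show "a \<in> res ` {f. keys f \<subseteq> set ws}" using f(1) res_nf by blast
  qed (auto simp: graded_part_def ws)
  moreover have "A.dimension (length ws) (range (scalar_class I)) (res ` {f. keys f \<subseteq> set ws})"
    using ws by (intro dimension_words) auto
  ultimately have "A.dim (range (scalar_class I)) (graded_part I n) = length ws"
    using A.dimI[OF subfield_scalars] by (simp add: over_def)
  also have "length ws = card {w \<in> normal_words W. length w = n}" using ws distinct_card by metis
  finally show ?thesis by (simp add: graded_dim_def A_eq)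
qed

subsection \<open>Free subalgebras\<close>

definition subst :: "'x list \<Rightarrow> 'x list \<Rightarrow> bool list \<Rightarrow> 'x list" where
  "subst u v w = concat (map (\<lambda>b. if b then v else u) w)"

lemma subst_simps [simp]:
  "subst u v [] = []" "subst u v (b # w) = (if b then v else u) @ subst u v w"
  by (simp_all add: subst_def)

lemma word_eval_eq:
  "word_eval A (\<lambda>b. res (word_monom (if b then v else u))) w = res (word_monom (subst u v w))"
proof (induction w)
  case Nil
  then show ?case by (simp add: word_eval_def word_monom_def poly_one)
next
  case (Cons b w)
  then show ?case by (simp add: word_eval_def) (simp add: word_monom_def single_word_mult)
qed

lemma algebra_eval_eq:
  "algebra_eval A (scalar_class I) (\<lambda>b. res (word_monom (if b then v else u))) f =
    res (\<Sum>w\<in>keys f. single (subst u v w) (lookup f w))"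
proof -
  interpret A: ring A by (rule ring_A)
  have "algebra_eval A (scalar_class I) (\<lambda>b. res (word_monom (if b then v else u))) f =
      (\<Oplus>\<^bsub>A\<^esub>w\<in>keys f. res (single (subst u v w) (lookup f w)))"
    unfolding algebra_eval_def word_eval_eq
    by (simp add: scalar_class_eq) (simp add: word_monom_def single_word_mult)
  then show ?thesis by (simp add: finsum_res)
qed

text \<open>The evaluation sends words to words, so it is injective iff no image word vanishes in
  \<open>A\<close> and distinct words have distinct images.\<close>

lemma generate_free_subalgebra_iff:
  "generate_free_subalgebra I u v \<longleftrightarrow> inj (subst u v) \<and> range (subst u v) \<subseteq> normal_words W"
proof -
  define E :: "(bool list \<Rightarrow>\<^sub>0 'k) \<Rightarrow> _" where "E f =
    (\<Sum>w\<in>keys f. single (subst u v w) (lookup f w))" for f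
  have gen: "generate_free_subalgebra I u v \<longleftrightarrow> inj (\<lambda>f. res (E f))"
    unfolding generate_free_subalgebra_def A_eq[symmetric] algebra_eval_eq E_def ..
  have E_single: "E (single w 1) = word_monom (subst u v w)" for w
    by (simp add: E_def word_monom_def)
  show ?thesis
  proof
    assume "generate_free_subalgebra I u v"
    then have inj: "res (E f) = res (E g) \<Longrightarrow> f = g" for f g using gen by (simp add: inj_def)
    have "inj (subst u v)"
    proof (rule injI)
      fix w w' assume "subst u v w = subst u v w'"
      then have "single w (1 :: 'k) = single w' 1"
        by (intro inj) (simp add: E_single)
      then show "w = w'" by (metis keys_single one_neq_zero singleton_inject)
    qed
    moreover have "subst u v w \<in> normal_words W" for w
    proof (rule ccontr)
      assume "subst u v w \<notin> normal_words W"
      then have "res (E (single w 1)) = res (E 0)"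
        unfolding E_single res_eq_iff by (simp add: word_monom_def nf_single E_def)
      then have "single w (1 :: 'k) = 0" by (rule inj)
      then show False by (metis keys_single keys_zero one_neq_zero insert_not_empty)
    qed
    ultimately show "inj (subst u v) \<and> range (subst u v) \<subseteq> normal_words W" by blast
  next
    assume a: "inj (subst u v) \<and> range (subst u v) \<subseteq> normal_words W"
    have lookup: "lookup (nf (E f)) (subst u v w) = lookup f w" for f w
    proof -
      have "lookup (nf (E f)) (subst u v w) =
          (\<Sum>x\<in>keys f. if x = w then lookup f w else 0)"
        using a unfolding lookup_nf E_def lookup_sum
        by (auto simp: lookup_single when_def inj_eq intro!: sum.cong)
      then show ?thesis by (simp add: in_keys_iff)
    qed
    have "inj (\<lambda>f. res (E f))"
    proof (rule injI)
      fix f g assume "res (E f) = res (E g)"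
      then have "nf (E f) = nf (E g)" by (simp add: res_eq_iff)
      then have "lookup f w = lookup g w" for w using lookup by metis
      then show "f = g" by (rule poly_mapping_eqI)
    qed
    then show "generate_free_subalgebra I u v" using gen by simp
  qed
qed

end

section \<open>Growth and free subalgebras in terms of atoms\<close>

locale lyndon_quotient = lyndon_antichain W + monomial_quotient W I A
  for W :: "'x::{finite,linorder} list set" and I :: "('x, 'k::field) ncpoly set"
    and A :: "('x, 'k) ncpoly set ring"
begin

lemma sum_graded_dim: "(\<Sum>i\<le>n. graded_dim I i) = normal_count n"
proof -
  have fin: "finite {w \<in> NW. length w = i}" for i
    by (rule finite_subset[OF _ finite_bounded_words[of NW i]]) auto
  have "(\<Sum>i\<le>n. graded_dim I i) = (\<Sum>i\<le>n. card {w \<in> NW. length w = i})"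
    using fin by (simp add: graded_dim_eq)
  also have "\<dots> = card (\<Union>i\<le>n. {w \<in> NW. length w = i})"
    using fin by (intro card_UN_disjoint[symmetric]) auto
  also have "(\<Union>i\<le>n. {w \<in> NW. length w = i}) = {w \<in> NW. length w \<le> n}" by auto
  finally show ?thesis by (simp add: normal_count_def)
qed

lemma growth_bounded_by_iff: "growth_bounded_by I e \<longleftrightarrow> power_bounded normal_count e"
  by (simp add: growth_bounded_by_def power_bounded_def sum_graded_dim)

lemma polynomial_growth_iff: "polynomial_growth I \<longleftrightarrow> finite N"
  using power_bounded_normal_count_iff by (simp add: polynomial_growth_def growth_bounded_by_iff)

lemma gk_dimension_eq: "finite N \<Longrightarrow> gk_dimension I = real (card N)"
  by (simp add: gk_dimension_def growth_bounded_by_iff Inf_power_bounded_normal_count)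

lemma polynomial_growth_of_degree_iff:
  "polynomial_growth_of_degree I d \<longleftrightarrow> finite N \<and> d = real (card N)"
  by (auto simp: polynomial_growth_of_degree_def polynomial_growth_iff gk_dimension_eq)

lemma free_subalgebra_if_long_atom:
  assumes "\<And>w. w \<in> W \<Longrightarrow> length w \<le> length l" "l \<in> N" "W \<noteq> {}"
  shows "\<exists>u v. generate_free_subalgebra I u v"
proof -
  obtain u v where uv: "length u = length v" "u \<noteq> v" "\<And>ls. set ls \<subseteq> {u, v} \<Longrightarrow> concat ls \<in> NW"
    using long_atom_free[OF assms] by blast
  have "inj (subst u v)"
  proof (rule injI)
    fix w w' assume "subst u v w = subst u v w'"
    then show "w = w'"
    proof (induction w arbitrary: w')
      case Nil
      then show ?case using uv(1,2) by (cases w') (auto split: if_splits)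
    next
      case (Cons b w)
      then obtain b' k where w': "w' = b' # k"
        using uv(1,2) by (cases w') (auto split: if_splits)
      then have "(if b then v else u) = (if b' then v else u) \<and> subst u v w = subst u v k"
        using Cons.prems uv(1) by (auto simp: append_eq_append_conv split: if_splits)
      then show ?case using Cons.IH w' uv(2) by (auto split: if_splits)
    qed
  qed
  moreover have "subst u v w \<in> NW" for w
    unfolding subst_def by (rule uv(3)) auto
  ultimately show ?thesis unfolding generate_free_subalgebra_iff by blast
qed

lemma not_polynomial_growth_if_free:
  assumes "generate_free_subalgebra I u v"
  shows "\<not> polynomial_growth I"
proof
  assume "polynomial_growth I"
  then obtain e where e: "power_bounded normal_count e"
    by (auto simp: polynomial_growth_def growth_bounded_by_iff)
  have inj: "inj (subst u v)" and normal: "subst u v w \<in> NW" for w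
    using assms by (auto simp: generate_free_subalgebra_iff)
  define M where "M = length u + length v + 1"
  have len: "length (subst u v w) \<le> length w * M" for w
    by (induction w) (auto simp: M_def)
  have ge: "2 ^ n \<le> normal_count (n * M)" for n
  proof -
    have "card {w :: bool list. set w \<subseteq> UNIV \<and> length w = n} = card (UNIV :: bool set) ^ n"
      by (rule card_lists_length_eq) simp
    then have "2 ^ n = card {w :: bool list. length w = n}" by simp
    also have "\<dots> = card (subst u v ` {w. length w = n})"
      by (rule card_image[symmetric]) (rule inj_on_subset[OF inj], simp)
    also have "\<dots> \<le> normal_count (n * M)"
      unfolding normal_count_def using finite_bounded_words
      by (rule card_mono) (use len normal in auto)
    finally show ?thesis .
  qed
  \<comment> \<open>An exponent above \<open>e\<close>. Since
    \<open>(q + 1) ^ s \<le> 2 ^ (q * s)\<close>, the \<open>2 ^ n\<close> substituted words of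
    length at most \<open>n * M\<close> reach this exponent along the multiples of
    \<open>s * M\<close>.\<close>
  define s where "s = nat \<lceil>e\<rceil> + 1"
  have "real s \<le> e"
  proof (rule power_bounded_exponent_ge[OF e])
    show "1 \<le> s * M" by (simp add: s_def M_def)
    fix q :: nat
    have "q + 1 \<le> 2 ^ q" by (induction q) auto
    then have "(q + 1) ^ s \<le> (2 ^ q) ^ s" by (rule power_mono) simp
    also have "\<dots> = 2 ^ (q * s)" by (simp add: power_mult)
    also have "\<dots> \<le> normal_count (q * (s * M))" using ge[of "q * s"] by (simp add: mult.assoc)
    finally show "(q + 1) ^ s \<le> normal_count (q * (s * M))" .
  qed
  then show False unfolding s_def by linarith
qed

end

section \<open>Left modules and resolutions\<close>

lemma left_moduleI:
  fixes R (structure) and M :: "('r, 'm) module"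
  assumes "ring R"
    and add: "\<And>x y. x \<in> carrier M \<Longrightarrow> y \<in> carrier M \<Longrightarrow> x \<oplus>\<^bsub>M\<^esub> y \<in> carrier M"
    and zero: "\<zero>\<^bsub>M\<^esub> \<in> carrier M"
    and assoc: "\<And>x y z. x \<in> carrier M \<Longrightarrow> y \<in> carrier M \<Longrightarrow> z \<in> carrier M \<Longrightarrow>
      (x \<oplus>\<^bsub>M\<^esub> y) \<oplus>\<^bsub>M\<^esub> z = x \<oplus>\<^bsub>M\<^esub> (y \<oplus>\<^bsub>M\<^esub> z)"
    and comm: "\<And>x y. x \<in> carrier M \<Longrightarrow> y \<in> carrier M \<Longrightarrow> x \<oplus>\<^bsub>M\<^esub> y = y \<oplus>\<^bsub>M\<^esub> x"
    and l_zero: "\<And>x. x \<in> carrier M \<Longrightarrow> \<zero>\<^bsub>M\<^esub> \<oplus>\<^bsub>M\<^esub> x = x"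
    and inv: "\<And>x. x \<in> carrier M \<Longrightarrow> \<exists>y\<in>carrier M. y \<oplus>\<^bsub>M\<^esub> x = \<zero>\<^bsub>M\<^esub>"
    and smult: "\<And>a x. a \<in> carrier R \<Longrightarrow> x \<in> carrier M \<Longrightarrow> a \<odot>\<^bsub>M\<^esub> x \<in> carrier M"
    and l_distr: "\<And>a b x. a \<in> carrier R \<Longrightarrow> b \<in> carrier R \<Longrightarrow> x \<in> carrier M \<Longrightarrow>
      (a \<oplus> b) \<odot>\<^bsub>M\<^esub> x = a \<odot>\<^bsub>M\<^esub> x \<oplus>\<^bsub>M\<^esub> b \<odot>\<^bsub>M\<^esub> x"
    and r_distr: "\<And>a x y. a \<in> carrier R \<Longrightarrow> x \<in> carrier M \<Longrightarrow> y \<in> carrier M \<Longrightarrow>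
      a \<odot>\<^bsub>M\<^esub> (x \<oplus>\<^bsub>M\<^esub> y) = a \<odot>\<^bsub>M\<^esub> x \<oplus>\<^bsub>M\<^esub> a \<odot>\<^bsub>M\<^esub> y"
    and smult_assoc: "\<And>a b x. a \<in> carrier R \<Longrightarrow> b \<in> carrier R \<Longrightarrow> x \<in> carrier M \<Longrightarrow>
      (a \<otimes> b) \<odot>\<^bsub>M\<^esub> x = a \<odot>\<^bsub>M\<^esub> (b \<odot>\<^bsub>M\<^esub> x)"
    and one: "\<And>x. x \<in> carrier M \<Longrightarrow> \<one> \<odot>\<^bsub>M\<^esub> x = x"
  shows "left_module R M"
proof (intro left_module.intro left_module_axioms.intro)
  show "abelian_group M" by (rule abelian_groupI) (fact add zero assoc comm l_zero inv)+
qed (fact assms)+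

context left_module
begin

lemma smult_zero_right: "a \<in> carrier R \<Longrightarrow> a \<odot>\<^bsub>M\<^esub> \<zero>\<^bsub>M\<^esub> = \<zero>\<^bsub>M\<^esub>"
  using smult_r_distr[of a "\<zero>\<^bsub>M\<^esub>" "\<zero>\<^bsub>M\<^esub>"] smult_closed[of a "\<zero>\<^bsub>M\<^esub>"]
  by (simp add: M.add.l_cancel_one)

lemma smult_zero_left: "x \<in> carrier M \<Longrightarrow> \<zero> \<odot>\<^bsub>M\<^esub> x = \<zero>\<^bsub>M\<^esub>"
  using smult_l_distr[of \<zero> \<zero> x] smult_closed[of \<zero> x] by (simp add: M.add.l_cancel_one)

lemma smult_finsum:
  assumes "a \<in> carrier R" "finite S" "\<And>i. i \<in> S \<Longrightarrow> f i \<in> carrier M"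
  shows "a \<odot>\<^bsub>M\<^esub> (\<Oplus>\<^bsub>M\<^esub>i\<in>S. f i) = (\<Oplus>\<^bsub>M\<^esub>i\<in>S. a \<odot>\<^bsub>M\<^esub> f i)"
  using assms(2,3)
proof (induction S rule: finite_induct)
  case empty
  then show ?case using assms(1) by (simp add: smult_zero_right)
next
  case (insert i S)
  then have f: "f \<in> S \<rightarrow> carrier M" "f i \<in> carrier M" by auto
  have "(\<lambda>i. a \<odot>\<^bsub>M\<^esub> f i) \<in> S \<rightarrow> carrier M" "a \<odot>\<^bsub>M\<^esub> f i \<in> carrier M"
    using f assms(1) smult_closed by auto
  then show ?case using insert f assms(1) smult_r_distr by simp
qed

end

locale module_hom = left_module R M + N: left_module R N
  for R :: "('r, 'c) ring_scheme" (structure) and M :: "('r, 'm) module" and N :: "('r, 'n) module" +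
  fixes f
  assumes hom: "f \<in> left_module_hom R M N"
begin

lemma hom_closed [simp]: "x \<in> carrier M \<Longrightarrow> f x \<in> carrier N"
  using hom by (auto simp: left_module_hom_def)

lemma hom_add: "x \<in> carrier M \<Longrightarrow> y \<in> carrier M \<Longrightarrow> f (x \<oplus>\<^bsub>M\<^esub> y) = f x \<oplus>\<^bsub>N\<^esub> f y"
  using hom by (auto simp: left_module_hom_def)

lemma hom_smult: "a \<in> carrier R \<Longrightarrow> x \<in> carrier M \<Longrightarrow> f (a \<odot>\<^bsub>M\<^esub> x) = a \<odot>\<^bsub>N\<^esub> f x"
  using hom by (auto simp: left_module_hom_def)

lemma hom_zero: "f \<zero>\<^bsub>M\<^esub> = \<zero>\<^bsub>N\<^esub>"
  using hom_add[of "\<zero>\<^bsub>M\<^esub>" "\<zero>\<^bsub>M\<^esub>"] hom_closed[of "\<zero>\<^bsub>M\<^esub>"] by (simp add: N.M.add.l_cancel_one)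

lemma hom_minus: "x \<in> carrier M \<Longrightarrow> f (\<ominus>\<^bsub>M\<^esub> x) = \<ominus>\<^bsub>N\<^esub> f x"
  using hom_add[of "\<ominus>\<^bsub>M\<^esub> x" x] hom_zero by (intro N.M.minus_equality[symmetric]) (simp_all add: M.l_neg)

lemma hom_diff: "x \<in> carrier M \<Longrightarrow> y \<in> carrier M \<Longrightarrow> f (x \<ominus>\<^bsub>M\<^esub> y) = f x \<ominus>\<^bsub>N\<^esub> f y"
  by (simp add: M.minus_eq N.M.minus_eq hom_add hom_minus)

lemma hom_finsum:
  assumes "finite S" "\<And>i. i \<in> S \<Longrightarrow> g i \<in> carrier M"
  shows "f (\<Oplus>\<^bsub>M\<^esub>i\<in>S. g i) = (\<Oplus>\<^bsub>N\<^esub>i\<in>S. f (g i))"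
  using assms
proof (induction S rule: finite_induct)
  case empty
  then show ?case by (simp add: hom_zero)
next
  case (insert i S)
  then have g: "g \<in> S \<rightarrow> carrier M" "g i \<in> carrier M" by auto
  then have "(\<lambda>i. f (g i)) \<in> S \<rightarrow> carrier N" "f (g i) \<in> carrier N" by (simp_all add: Pi_iff)
  then show ?case using insert g by (simp add: hom_add)
qed

end

lemma module_homI:
  assumes "left_module R M" "left_module R N" "f \<in> left_module_hom R M N"
  shows "module_hom R M N f"
  using assms by (simp add: module_hom_def module_hom_axioms_def)

lemma left_module_homI:
  assumes "\<And>x. x \<in> carrier M \<Longrightarrow> f x \<in> carrier N"
    and "\<And>x y. x \<in> carrier M \<Longrightarrow> y \<in> carrier M \<Longrightarrow> f (x \<oplus>\<^bsub>M\<^esub> y) = f x \<oplus>\<^bsub>N\<^esub> f y"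
    and "\<And>a x. a \<in> carrier R \<Longrightarrow> x \<in> carrier M \<Longrightarrow> f (a \<odot>\<^bsub>M\<^esub> x) = a \<odot>\<^bsub>N\<^esub> f x"
  shows "f \<in> left_module_hom R M N"
  using assms by (auto simp: left_module_hom_def)

lemma left_module_hom_comp:
  assumes "f \<in> left_module_hom R M N" "g \<in> left_module_hom R N L"
  shows "(\<lambda>x. g (f x)) \<in> left_module_hom R M L"
  using assms by (auto simp: left_module_hom_def Pi_def)

lemma left_module_hom_diff:
  assumes M: "left_module R M" and N: "left_module R N"
    and f: "f \<in> left_module_hom R M N" and g: "g \<in> left_module_hom R M N"
  shows "(\<lambda>x. f x \<ominus>\<^bsub>N\<^esub> g x) \<in> left_module_hom R M N"
proof -
  interpret f: module_hom R M N f by (intro module_homI M N f)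
  interpret g: module_hom R M N g by (intro module_homI M N g)
  show ?thesis
  proof (rule left_module_homI)
    fix x y assume xy: "x \<in> carrier M" "y \<in> carrier M"
    show "f x \<ominus>\<^bsub>N\<^esub> g x \<in> carrier N" using xy by simp
    have c: "f x \<in> carrier N" "f y \<in> carrier N" "g x \<in> carrier N" "g y \<in> carrier N" using xy by simp_all
    show "f (x \<oplus>\<^bsub>M\<^esub> y) \<ominus>\<^bsub>N\<^esub> g (x \<oplus>\<^bsub>M\<^esub> y) = (f x \<ominus>\<^bsub>N\<^esub> g x) \<oplus>\<^bsub>N\<^esub> (f y \<ominus>\<^bsub>N\<^esub> g y)"
      using c xy by (simp add: f.hom_add g.hom_add f.N.M.minus_eq f.N.M.minus_add f.N.M.a_ac)
  next
    fix a x assume ax: "a \<in> carrier R" "x \<in> carrier M"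
    have c: "f x \<in> carrier N" "g x \<in> carrier N" using ax by simp_all
    have "a \<odot>\<^bsub>N\<^esub> (\<ominus>\<^bsub>N\<^esub> g x) = \<ominus>\<^bsub>N\<^esub> (a \<odot>\<^bsub>N\<^esub> g x)"
      using f.N.smult_r_distr[of a "\<ominus>\<^bsub>N\<^esub> g x" "g x"] c ax f.N.smult_closed f.N.smult_zero_right
      by (intro f.N.M.minus_equality[symmetric]) (simp_all add: f.N.M.l_neg)
    then show "f (a \<odot>\<^bsub>M\<^esub> x) \<ominus>\<^bsub>N\<^esub> g (a \<odot>\<^bsub>M\<^esub> x) = a \<odot>\<^bsub>N\<^esub> (f x \<ominus>\<^bsub>N\<^esub> g x)"
      using c ax by (simp add: f.hom_smult g.hom_smult f.N.M.minus_eq f.N.smult_r_distr)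
  qed
qed

lemma left_module_image:
  fixes N :: "('r, 'n) module"
  assumes "module_hom R M N f"
  shows "left_module R (N\<lparr>carrier := f ` carrier M\<rparr>)"
proof -
  interpret module_hom R M N f by fact
  show ?thesis
  proof (rule left_moduleI)
    show "ring R" by (rule R.ring_axioms)
  next
    fix x assume "x \<in> carrier (N\<lparr>carrier := f ` carrier M\<rparr>)"
    then obtain y where y: "x = f y" "y \<in> carrier M" by auto
    have "f (\<ominus>\<^bsub>M\<^esub> y) \<oplus>\<^bsub>N\<^esub> x = \<zero>\<^bsub>N\<^esub>" using y by (simp add: hom_minus N.M.l_neg)
    then show "\<exists>y\<in>carrier (N\<lparr>carrier := f ` carrier M\<rparr>). y \<oplus>\<^bsub>N\<lparr>carrier := f ` carrier M\<rparr>\<^esub> x = \<zero>\<^bsub>N\<lparr>carrier := f ` carrier M\<rparr>\<^esub>"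
      using y by (intro bexI[of _ "f (\<ominus>\<^bsub>M\<^esub> y)"]) simp_all
  next
    show "\<zero>\<^bsub>N\<lparr>carrier := f ` carrier M\<rparr>\<^esub> \<in> carrier (N\<lparr>carrier := f ` carrier M\<rparr>)"
      using hom_zero by (simp add: image_iff) (metis M.zero_closed)
  qed (auto simp: hom_add[symmetric] hom_smult[symmetric] M.a_ac R.a_closed smult_closed
      smult_l_distr smult_r_distr smult_assoc smult_one hom_zero[symmetric])
qed

text \<open>\<open>f\<close> need not be onto \<open>N\<close>; restricting the codomain to the
  image of \<open>f\<close> gives a surjection to which projectivity applies.\<close>

lemma projective_lift:
  fixes P M N :: "('r, ('r, 'u) universe) module"
  assumes P: "projective_module R P" and f: "module_hom R M N f"
    and g: "g \<in> left_module_hom R P N" and im: "g ` carrier P \<subseteq> f ` carrier M"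
  shows "\<exists>h\<in>left_module_hom R P M. \<forall>x\<in>carrier P. f (h x) = g x"
proof -
  interpret f: module_hom R M N f by fact
  let ?N = "N\<lparr>carrier := f ` carrier M\<rparr>"
  have "left_module R M" by (rule f.left_module_axioms)
  moreover have "left_module R ?N" by (rule left_module_image[OF f])
  moreover have "f \<in> left_module_hom R M ?N"
    by (rule left_module_homI) (simp_all add: f.hom_add f.hom_smult)
  moreover have "f ` carrier M = carrier ?N" by simp
  moreover have "g \<in> left_module_hom R P ?N"
    using g im by (auto simp: left_module_hom_def)
  ultimately show ?thesis using P unfolding projective_module_def by blast
qed

section \<open>Comparison of projective resolutions\<close>

locale resolution =
  fixes R :: "('r, 'c) ring_scheme" (structure) and M :: "('r, ('r, 'u) universe) module"
    and P :: "nat \<Rightarrow> ('r, ('r, 'u) universe) module"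
    and d :: "nat \<Rightarrow> ('r, 'u) universe \<Rightarrow> ('r, 'u) universe"
  assumes module_M: "left_module R M" and res: "projective_resolution R M P d"
begin

text \<open>The resolved module stands in the place before \<open>P 0\<close>, so that exactness has
  one form in all degrees.\<close>

definition target :: "nat \<Rightarrow> ('r, ('r, 'u) universe) module" where
  "target i = (case i of 0 \<Rightarrow> M | Suc j \<Rightarrow> P j)"

lemma target_simps [simp]: "target 0 = M" "target (Suc i) = P i"
  by (simp_all add: target_def)

lemma projective: "projective_module R (P i)"
  using res by (simp add: projective_resolution_def)

lemma module_P: "left_module R (P i)"
  using projective by (simp add: projective_module_def)

lemma module_target: "left_module R (target i)"
  using module_M module_P by (cases i) simp_all

lemma d_hom: "module_hom R (P i) (target i) (d i)"
  using res by (intro module_homI module_P module_target) (cases i, simp_all add: projective_resolution_def)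

lemma d_surj: "d 0 ` carrier (P 0) = carrier M"
  using res by (simp add: projective_resolution_def)

lemma exact: "d (Suc i) ` carrier (P (Suc i)) = {x \<in> carrier (P i). d i x = \<zero>\<^bsub>target i\<^esub>}"
  using res by (cases i) (simp_all add: projective_resolution_def)

lemma d_d: "x \<in> carrier (P (Suc i)) \<Longrightarrow> d i (d (Suc i) x) = \<zero>\<^bsub>target i\<^esub>"
  using exact[of i] by blast

end

lemma comparison_map:
  assumes "resolution R M P d" "resolution R M Q e"
  shows "\<exists>f. \<forall>i. f i \<in> left_module_hom R (Q i) (P i) \<and>
    (\<forall>x\<in>carrier (Q 0). d 0 (f 0 x) = e 0 x) \<and>
    (\<forall>x\<in>carrier (Q (Suc i)). d (Suc i) (f (Suc i) x) = f i (e (Suc i) x))"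
proof -
  interpret P: resolution R M P d by fact
  interpret Q: resolution R M Q e by fact
  \<comment> \<open>The invariant carried along: \<open>f\<close> maps cycles to cycles. This puts
    the composite of \<open>f\<close> with \<open>e (Suc i)\<close> inside the image of
    \<open>d (Suc i)\<close> and allows the next lift; in degree 0 it also says that
    \<open>f\<close> lifts the identity of \<open>M\<close>.\<close>
  define A where "A i f \<longleftrightarrow> f \<in> left_module_hom R (Q i) (P i) \<and>
    (\<forall>x\<in>carrier (Q i). e i x = \<zero>\<^bsub>Q.target i\<^esub> \<longrightarrow> d i (f x) = \<zero>\<^bsub>P.target i\<^esub>) \<and>
    (i = 0 \<longrightarrow> (\<forall>x\<in>carrier (Q 0). d 0 (f x) = e 0 x))" for i f
  have start: "\<exists>f. A 0 f"
  proof -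
    interpret e0: module_hom R "Q 0" M "e 0" using Q.d_hom[of 0] by simp
    obtain f where f: "f \<in> left_module_hom R (Q 0) (P 0)" "\<forall>x\<in>carrier (Q 0). d 0 (f x) = e 0 x"
      using projective_lift[OF Q.projective[of 0] P.d_hom[of 0], of "e 0"] e0.hom P.d_surj Q.d_surj by auto
    then have "A 0 f" by (simp add: A_def)
    then show ?thesis by blast
  qed
  have succ: "\<exists>f'. A (Suc i) f' \<and> (\<forall>x\<in>carrier (Q (Suc i)). d (Suc i) (f' x) = f (e (Suc i) x))"
    if A: "A i f" for i f
  proof -
    have f: "f \<in> left_module_hom R (Q i) (P i)" using A by (simp add: A_def)
    interpret f: module_hom R "Q i" "P i" f by (intro module_homI P.module_P Q.module_P f)
    interpret e: module_hom R "Q (Suc i)" "Q i" "e (Suc i)" using Q.d_hom[of "Suc i"] by simp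
    have "f (e (Suc i) x) \<in> d (Suc i) ` carrier (P (Suc i))" if x: "x \<in> carrier (Q (Suc i))" for x
    proof -
      have "e (Suc i) x \<in> carrier (Q i)" "e i (e (Suc i) x) = \<zero>\<^bsub>Q.target i\<^esub>"
        using x Q.d_d by simp_all
      then have "d i (f (e (Suc i) x)) = \<zero>\<^bsub>P.target i\<^esub>" using A unfolding A_def by blast
      then show ?thesis using x unfolding P.exact by simp
    qed
    then have "(\<lambda>x. f (e (Suc i) x)) ` carrier (Q (Suc i)) \<subseteq> d (Suc i) ` carrier (P (Suc i))" by blast
    then obtain f' where f': "f' \<in> left_module_hom R (Q (Suc i)) (P (Suc i))"
      "\<forall>x\<in>carrier (Q (Suc i)). d (Suc i) (f' x) = f (e (Suc i) x)"
      using projective_lift[OF Q.projective P.d_hom[of "Suc i", simplified] left_module_hom_comp[OF e.hom f]]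
      by blast
    then have "A (Suc i) f'" by (simp add: A_def f.hom_zero)
    then show ?thesis using f'(2) by blast
  qed
  obtain f where f: "\<And>i. A i (f i)"
    "\<And>i. \<forall>x\<in>carrier (Q (Suc i)). d (Suc i) (f (Suc i) x) = f i (e (Suc i) x)"
    using dependent_nat_choice[of A "\<lambda>i f f'. \<forall>x\<in>carrier (Q (Suc i)). d (Suc i) (f' x) = f (e (Suc i) x)"]
      start succ by blast
  show ?thesis
    using f(1)[unfolded A_def] f(2) by (intro exI[of _ f]) blast
qed

text \<open>
  If \<open>P\<close> vanishes beyond degree \<open>n\<close>, the identity of any other projective resolution \<open>Q\<close> is
  null-homotopic in degree \<open>n + 1\<close>, because it is homotopic to a map that factors through \<open>P\<close>.
\<close>

lemma null_homotopy_beyond: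
  assumes "resolution R M P d" "resolution R M Q e" "carrier (P (Suc n)) = {\<zero>\<^bsub>P (Suc n)\<^esub>}"
  shows "\<exists>h h'. h \<in> left_module_hom R (Q (Suc n)) (Q (Suc (Suc n))) \<and> h' \<in> left_module_hom R (Q n) (Q (Suc n)) \<and>
    (\<forall>x\<in>carrier (Q (Suc n)). x = e (Suc (Suc n)) (h x) \<oplus>\<^bsub>Q (Suc n)\<^esub> h' (e (Suc n) x))"
proof -
  interpret P: resolution R M P d by fact
  interpret Q: resolution R M Q e by fact
  obtain f where f: "\<And>i. f i \<in> left_module_hom R (Q i) (P i)"
    "\<And>x. x \<in> carrier (Q 0) \<Longrightarrow> d 0 (f 0 x) = e 0 x"
    "\<And>i x. x \<in> carrier (Q (Suc i)) \<Longrightarrow> d (Suc i) (f (Suc i) x) = f i (e (Suc i) x)"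
    using comparison_map[OF assms(1,2)] by blast
  obtain g where g: "\<And>i. g i \<in> left_module_hom R (P i) (Q i)"
    "\<And>x. x \<in> carrier (P 0) \<Longrightarrow> e 0 (g 0 x) = d 0 x"
    "\<And>i x. x \<in> carrier (P (Suc i)) \<Longrightarrow> e (Suc i) (g (Suc i) x) = g i (d (Suc i) x)"
    using comparison_map[OF assms(2,1)] by blast
  \<comment> \<open>The difference between the identity of \<open>Q\<close> and a chain map that
    factors through \<open>P\<close>; this is what has to be contracted.\<close>
  define u where "u i x = x \<ominus>\<^bsub>Q i\<^esub> g i (f i x)" for i x
  have id: "(\<lambda>x. x) \<in> left_module_hom R (Q i) (Q i)" for i
    by (rule left_module_homI) (assumption | rule refl)+
  have u: "u i \<in> left_module_hom R (Q i) (Q i)" for i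
    unfolding u_def using left_module_hom_diff[OF Q.module_P Q.module_P id left_module_hom_comp[OF f(1) g(1)]] .
  have fc: "f i x \<in> carrier (P i)" if "x \<in> carrier (Q i)" for i x
    using f(1)[of i] that by (auto simp: left_module_hom_def)
  have gc: "g i x \<in> carrier (Q i)" if "x \<in> carrier (P i)" for i x
    using g(1)[of i] that by (auto simp: left_module_hom_def)
  have ec: "e (Suc i) x \<in> carrier (Q i)" if "x \<in> carrier (Q (Suc i))" for i x
    using that Q.exact[of i] by blast
  have eu0: "e 0 (u 0 x) = \<zero>\<^bsub>M\<^esub>" if x: "x \<in> carrier (Q 0)" for x
  proof -
    interpret e0: module_hom R "Q 0" M "e 0" using Q.d_hom[of 0] by simp
    have "e 0 (u 0 x) = e 0 x \<ominus>\<^bsub>M\<^esub> e 0 (g 0 (f 0 x))"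
      unfolding u_def using x fc gc by (intro e0.hom_diff) auto
    also have "e 0 (g 0 (f 0 x)) = e 0 x" using x fc f(2) g(2) by simp
    finally show ?thesis using x by (simp add: e0.N.M.r_neg e0.N.M.minus_eq)
  qed
  have eu: "e (Suc i) (u (Suc i) x) = u i (e (Suc i) x)" if x: "x \<in> carrier (Q (Suc i))" for i x
  proof -
    interpret e: module_hom R "Q (Suc i)" "Q i" "e (Suc i)" using Q.d_hom[of "Suc i"] by simp
    have "e (Suc i) (u (Suc i) x) = e (Suc i) x \<ominus>\<^bsub>Q i\<^esub> e (Suc i) (g (Suc i) (f (Suc i) x))"
      unfolding u_def using x fc gc by (intro e.hom_diff) auto
    also have "e (Suc i) (g (Suc i) (f (Suc i) x)) = g i (f i (e (Suc i) x))"
      using x fc f(3) g(3) by simp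
    finally show ?thesis by (simp add: u_def)
  qed
  \<comment> \<open>The homotopy identity restricted to cycles, where its second summand vanishes;
    this much suffices to construct the next \<open>s\<close>.\<close>
  define B where "B i s \<longleftrightarrow> s \<in> left_module_hom R (Q i) (Q (Suc i)) \<and>
    (\<forall>x\<in>carrier (Q i). e i x = \<zero>\<^bsub>Q.target i\<^esub> \<longrightarrow> e (Suc i) (s x) = u i x)" for i s
  have start: "\<exists>s. B 0 s"
  proof -
    have "u 0 x \<in> e (Suc 0) ` carrier (Q (Suc 0))" if "x \<in> carrier (Q 0)" for x
      using eu0[OF that] u[of 0] that unfolding Q.exact[of 0] by (auto simp: left_module_hom_def)
    then have "u 0 ` carrier (Q 0) \<subseteq> e (Suc 0) ` carrier (Q (Suc 0))" by blast
    then obtain s where "s \<in> left_module_hom R (Q 0) (Q (Suc 0))" "\<forall>x\<in>carrier (Q 0). e (Suc 0) (s x) = u 0 x"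
      using projective_lift[OF Q.projective Q.d_hom[of "Suc 0", simplified] u] by blast
    then have "B 0 s" by (simp add: B_def)
    then show ?thesis by blast
  qed
  define C where "C i s s' \<longleftrightarrow> (\<forall>x\<in>carrier (Q (Suc i)).
    u (Suc i) x = e (Suc (Suc i)) (s' x) \<oplus>\<^bsub>Q (Suc i)\<^esub> s (e (Suc i) x))" for i s s'
  have succ: "\<exists>s'. B (Suc i) s' \<and> C i s s'" if B: "B i s" for i s
  proof -
    have s: "s \<in> left_module_hom R (Q i) (Q (Suc i))" using B by (simp add: B_def)
    interpret Qi: left_module R "Q i" by (rule Q.module_P)
    interpret Qs: left_module R "Q (Suc i)" by (rule Q.module_P)
    interpret s: module_hom R "Q i" "Q (Suc i)" s by (intro module_homI Q.module_P s)
    interpret e: module_hom R "Q (Suc i)" "Q i" "e (Suc i)" using Q.d_hom[of "Suc i"] by simp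
    interpret u: module_hom R "Q (Suc i)" "Q (Suc i)" "u (Suc i)" by (intro module_homI Q.module_P u)
    interpret ui: module_hom R "Q i" "Q i" "u i" by (intro module_homI Q.module_P u)
    \<comment> \<open>The part of \<open>u\<close> that the new homotopy map has to cover; its
      values are cycles, hence boundaries.\<close>
    define v where "v x = u (Suc i) x \<ominus>\<^bsub>Q (Suc i)\<^esub> s (e (Suc i) x)" for x
    have v: "v \<in> left_module_hom R (Q (Suc i)) (Q (Suc i))"
      unfolding v_def using left_module_hom_diff[OF Q.module_P Q.module_P u left_module_hom_comp[OF e.hom s]] .
    have "v x \<in> e (Suc (Suc i)) ` carrier (Q (Suc (Suc i)))" if x: "x \<in> carrier (Q (Suc i))" for x
    proof -
      have "e (Suc i) (s (e (Suc i) x)) = u i (e (Suc i) x)"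
        using B x Q.d_d ec unfolding B_def by blast
      then have "e (Suc i) (v x) = u i (e (Suc i) x) \<ominus>\<^bsub>Q i\<^esub> u i (e (Suc i) x)"
        unfolding v_def using x eu by (subst e.hom_diff) simp_all
      also have "\<dots> = \<zero>\<^bsub>Q i\<^esub>" using x by (simp add: Qi.M.r_neg Qi.M.minus_eq)
      finally have "e (Suc i) (v x) = \<zero>\<^bsub>Q i\<^esub>" .
      moreover have "v x \<in> carrier (Q (Suc i))" using v x by (auto simp: left_module_hom_def)
      ultimately show ?thesis unfolding Q.exact by simp
    qed
    then have "v ` carrier (Q (Suc i)) \<subseteq> e (Suc (Suc i)) ` carrier (Q (Suc (Suc i)))" by blast
    then obtain s' where s': "s' \<in> left_module_hom R (Q (Suc i)) (Q (Suc (Suc i)))"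
      "\<forall>x\<in>carrier (Q (Suc i)). e (Suc (Suc i)) (s' x) = v x"
      using projective_lift[OF Q.projective Q.d_hom[of "Suc (Suc i)", simplified] v] by blast
    have "C i s s'"
      unfolding C_def
    proof
      fix x assume x: "x \<in> carrier (Q (Suc i))"
      then have c: "u (Suc i) x \<in> carrier (Q (Suc i))" "s (e (Suc i) x) \<in> carrier (Q (Suc i))" by simp_all
      show "u (Suc i) x = e (Suc (Suc i)) (s' x) \<oplus>\<^bsub>Q (Suc i)\<^esub> s (e (Suc i) x)"
        using c x s'(2) by (simp add: v_def Qs.M.minus_eq Qs.M.a_assoc Qs.M.l_neg)
    qed
    moreover have "B (Suc i) s'"
    proof -
      have "e (Suc (Suc i)) (s' x) = u (Suc i) x"
        if x: "x \<in> carrier (Q (Suc i))" "e (Suc i) x = \<zero>\<^bsub>Q i\<^esub>" for x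
      proof -
        have "u (Suc i) x \<in> carrier (Q (Suc i))" using x by simp
        then show ?thesis using x s'(2) by (simp add: v_def s.hom_zero Qs.M.minus_eq)
      qed
      then show ?thesis using s'(1) by (simp add: B_def)
    qed
    ultimately show ?thesis by blast
  qed
  obtain s where s: "\<And>i. B i (s i)" "\<And>i. C i (s i) (s (Suc i))"
    using dependent_nat_choice[of B C] start succ by blast
  have "x = e (Suc (Suc n)) (s (Suc n) x) \<oplus>\<^bsub>Q (Suc n)\<^esub> s n (e (Suc n) x)" if x: "x \<in> carrier (Q (Suc n))" for x
  proof -
    interpret Qn: left_module R "Q (Suc n)" by (rule Q.module_P)
    interpret g: module_hom R "P (Suc n)" "Q (Suc n)" "g (Suc n)" by (intro module_homI P.module_P Q.module_P g)
    \<comment> \<open>\<open>P\<close> vanishes in this degree, so \<open>u\<close> is the identity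
      there.\<close>
    have "f (Suc n) x = \<zero>\<^bsub>P (Suc n)\<^esub>" using fc[OF x] assms(3) by simp
    then have "u (Suc n) x = x" using x by (simp add: u_def g.hom_zero Qn.M.minus_eq)
    then show ?thesis using s(2)[of n] x unfolding C_def by simp
  qed
  moreover have "s (Suc n) \<in> left_module_hom R (Q (Suc n)) (Q (Suc (Suc n)))"
    "s n \<in> left_module_hom R (Q n) (Q (Suc n))" using s(1) by (simp_all add: B_def)
  ultimately show ?thesis by blast
qed

subsection \<open>Transport of structure\<close>

text \<open>Moves a module along an injection. Free modules consist of functions, whereas
  projectivity and resolutions are stated for modules on \<open>universe\<close>.\<close>

definition transport :: "('b \<Rightarrow> 'm) \<Rightarrow> ('r, 'b) module \<Rightarrow> ('r, 'm) module" where
  "transport e M = (let j = inv_into (carrier M) e in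
    \<lparr>carrier = e ` carrier M, monoid.mult = (\<lambda>x y. e (j x \<otimes>\<^bsub>M\<^esub> j y)), one = e \<one>\<^bsub>M\<^esub>,
     ring.zero = e \<zero>\<^bsub>M\<^esub>, add = (\<lambda>x y. e (j x \<oplus>\<^bsub>M\<^esub> j y)), module.smult = (\<lambda>a x. e (a \<odot>\<^bsub>M\<^esub> j x))\<rparr>)"

lemma transport_simps [simp]:
  "carrier (transport e M) = e ` carrier M" "\<zero>\<^bsub>transport e M\<^esub> = e \<zero>\<^bsub>M\<^esub>"
  "inj_on e (carrier M) \<Longrightarrow> x \<in> carrier M \<Longrightarrow> y \<in> carrier M \<Longrightarrow> e x \<oplus>\<^bsub>transport e M\<^esub> e y = e (x \<oplus>\<^bsub>M\<^esub> y)"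
  "inj_on e (carrier M) \<Longrightarrow> x \<in> carrier M \<Longrightarrow> a \<odot>\<^bsub>transport e M\<^esub> e x = e (a \<odot>\<^bsub>M\<^esub> x)"
  by (simp_all add: transport_def Let_def)

lemma left_module_transport:
  fixes M :: "('r, 'b) module"
  assumes M: "left_module R M" and inj: "inj_on e (carrier M)"
  shows "left_module R (transport e M)"
proof -
  interpret left_module R M by fact
  show ?thesis
  proof (rule left_moduleI)
    show "ring R" by (rule R.ring_axioms)
    fix x assume "x \<in> carrier (transport e M)"
    then obtain y where y: "x = e y" "y \<in> carrier M" by auto
    then show "\<exists>z\<in>carrier (transport e M). z \<oplus>\<^bsub>transport e M\<^esub> x = \<zero>\<^bsub>transport e M\<^esub>"
      using inj by (intro bexI[of _ "e (\<ominus>\<^bsub>M\<^esub> y)"]) (simp_all add: M.l_neg)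
  qed (auto simp: inj M.a_ac smult_closed smult_l_distr smult_r_distr smult_assoc smult_one)
qed

lemma transport_hom:
  assumes "inj_on e (carrier M)"
  shows "e \<in> left_module_hom R M (transport e M)"
  using assms by (intro left_module_homI) simp_all

lemma transport_inv_hom:
  assumes "left_module R M" "inj_on e (carrier M)"
  shows "inv_into (carrier M) e \<in> left_module_hom R (transport e M) M"
proof -
  interpret left_module R M by fact
  show ?thesis by (intro left_module_homI) (auto simp: assms(2) smult_closed)
qed

section \<open>Free modules\<close>

definition term_at :: "'p::zero \<Rightarrow> 's \<Rightarrow> 's \<Rightarrow> 'p" where
  "term_at p s = (\<lambda>t. if t = s then p else 0)"

lemma term_at_eq [simp]: "term_at p s s = p"
  and term_at_neq: "t \<noteq> s \<Longrightarrow> term_at p s t = 0"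
  by (simp_all add: term_at_def)

definition supp :: "('s \<Rightarrow> 'p::zero) \<Rightarrow> 's set" where
  "supp f = {s. f s \<noteq> 0}"

lemma not_in_supp: "s \<notin> supp f \<longleftrightarrow> f s = 0"
  by (simp add: supp_def)

lemma supp_term_at: "supp (term_at p s) \<subseteq> {s}"
  by (auto simp: supp_def term_at_def)

context monomial_quotient
begin

text \<open>Coefficients are stored as normal forms rather than residue classes, so that degrees and
  leading words can be read off directly.\<close>

definition free_mod :: "'s set \<Rightarrow> (('x, 'k) ncpoly set, 's \<Rightarrow> ('x, 'k) ncpoly) module" where
  "free_mod S = \<lparr>carrier = {f. (\<forall>s. nf (f s) = f s) \<and> finite (supp f) \<and> supp f \<subseteq> S},
    monoid.mult = (\<lambda>_ _ _. 0), one = (\<lambda>_. 0), ring.zero = (\<lambda>_. 0),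
    add = (\<lambda>f g s. f s + g s), module.smult = (\<lambda>a f s. nf (rep a * f s))\<rparr>"

lemma free_mod_simps [simp]:
  "\<zero>\<^bsub>free_mod S\<^esub> = (\<lambda>_. 0)" "f \<oplus>\<^bsub>free_mod S\<^esub> g = (\<lambda>s. f s + g s)"
  "a \<odot>\<^bsub>free_mod S\<^esub> f = (\<lambda>s. nf (rep a * f s))"
  by (simp_all add: free_mod_def)

lemma free_mod_carrier:
  "f \<in> carrier (free_mod S) \<longleftrightarrow> (\<forall>s. nf (f s) = f s) \<and> finite (supp f) \<and> supp f \<subseteq> S"
  by (simp add: free_mod_def)

lemma free_mod_add_closed:
  assumes "f \<in> carrier (free_mod S)" "g \<in> carrier (free_mod S)"
  shows "(\<lambda>s. f s + g s) \<in> carrier (free_mod S)"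
proof -
  have "supp (\<lambda>s. f s + g s) \<subseteq> supp f \<union> supp g" by (auto simp: supp_def)
  moreover have "finite (supp f \<union> supp g)" "supp f \<union> supp g \<subseteq> S" using assms by (auto simp: free_mod_carrier)
  ultimately have "finite (supp (\<lambda>s. f s + g s)) \<and> supp (\<lambda>s. f s + g s) \<subseteq> S"
    by (meson finite_subset order.trans)
  then show ?thesis using assms by (simp add: free_mod_carrier nf_add)
qed

lemma free_mod_mult_closed:
  assumes "f \<in> carrier (free_mod S)"
  shows "(\<lambda>s. nf (p * f s)) \<in> carrier (free_mod S)"
proof -
  have "supp (\<lambda>s. nf (p * f s)) \<subseteq> supp f" by (auto simp: supp_def)
  moreover have "finite (supp f)" "supp f \<subseteq> S" using assms by (auto simp: free_mod_carrier)
  ultimately have "finite (supp (\<lambda>s. nf (p * f s))) \<and> supp (\<lambda>s. nf (p * f s)) \<subseteq> S"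
    by (meson finite_subset order.trans)
  then show ?thesis by (simp add: free_mod_carrier)
qed

lemma free_mod_uminus_closed:
  assumes "f \<in> carrier (free_mod S)"
  shows "(\<lambda>s. - f s) \<in> carrier (free_mod S)"
proof -
  have "supp (\<lambda>s. - f s) = supp f" by (auto simp: supp_def)
  then show ?thesis using assms by (simp add: free_mod_carrier nf_uminus)
qed

lemma term_at_closed: "nf p = p \<Longrightarrow> s \<in> S \<Longrightarrow> term_at p s \<in> carrier (free_mod S)"
  using supp_term_at[of p s] finite_subset[OF supp_term_at[of p s]]
  by (auto simp: free_mod_carrier) (simp add: term_at_def)

lemma left_module_free_mod: "left_module A (free_mod S)"
proof (rule left_moduleI)
  fix f assume f: "f \<in> carrier (free_mod S)"
  show "\<exists>g\<in>carrier (free_mod S). g \<oplus>\<^bsub>free_mod S\<^esub> f = \<zero>\<^bsub>free_mod S\<^esub>"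
    using free_mod_uminus_closed[OF f] by (rule bexI[rotated]) simp
  show "\<one>\<^bsub>A\<^esub> \<odot>\<^bsub>free_mod S\<^esub> f = f"
    using f by (simp add: free_mod_carrier)
  fix a assume a: "a \<in> carrier A"
  show "a \<odot>\<^bsub>free_mod S\<^esub> f \<in> carrier (free_mod S)" using f by (simp add: free_mod_mult_closed)
  {
    fix b assume b: "b \<in> carrier A"
    show "(a \<oplus>\<^bsub>A\<^esub> b) \<odot>\<^bsub>free_mod S\<^esub> f = a \<odot>\<^bsub>free_mod S\<^esub> f \<oplus>\<^bsub>free_mod S\<^esub> b \<odot>\<^bsub>free_mod S\<^esub> f"
      using a b by (simp add: rep_add distrib_right nf_add)
    show "(a \<otimes>\<^bsub>A\<^esub> b) \<odot>\<^bsub>free_mod S\<^esub> f = a \<odot>\<^bsub>free_mod S\<^esub> (b \<odot>\<^bsub>free_mod S\<^esub> f)"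
      using a b by (simp add: rep_mult nf_mult_nf mult.assoc)
  }
  fix g assume g: "g \<in> carrier (free_mod S)"
  show "a \<odot>\<^bsub>free_mod S\<^esub> (f \<oplus>\<^bsub>free_mod S\<^esub> g) = a \<odot>\<^bsub>free_mod S\<^esub> f \<oplus>\<^bsub>free_mod S\<^esub> a \<odot>\<^bsub>free_mod S\<^esub> g"
    by (simp add: distrib_left nf_add)
next
  show "ring A" by (rule ring_A)
  show "\<zero>\<^bsub>free_mod S\<^esub> \<in> carrier (free_mod S)" by (simp add: free_mod_carrier supp_def)
qed (simp_all add: free_mod_add_closed ac_simps)

text \<open>The linear extension of a map given on the basis.\<close>

definition lin :: "(('x, 'k) ncpoly set, 'm) module \<Rightarrow> ('s \<Rightarrow> 'm) \<Rightarrow> ('s \<Rightarrow> ('x, 'k) ncpoly) \<Rightarrow> 'm" where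
  "lin M \<phi> f = (\<Oplus>\<^bsub>M\<^esub>s\<in>supp f. res (f s) \<odot>\<^bsub>M\<^esub> \<phi> s)"

lemma lin_superset:
  assumes M: "left_module A M" and "finite T" "supp f \<subseteq> T" "\<And>s. s \<in> T \<Longrightarrow> \<phi> s \<in> carrier M"
  shows "lin M \<phi> f = (\<Oplus>\<^bsub>M\<^esub>s\<in>T. res (f s) \<odot>\<^bsub>M\<^esub> \<phi> s)"
proof -
  interpret left_module A M by fact
  show ?thesis unfolding lin_def
  proof (rule M.add.finprod_mono_neutral_cong_left)
    fix s assume s: "s \<in> T - supp f"
    then have "res (f s) = \<zero>\<^bsub>A\<^esub>" by (simp add: not_in_supp)
    then show "res (f s) \<odot>\<^bsub>M\<^esub> \<phi> s = \<zero>\<^bsub>M\<^esub>" using s assms(4) smult_zero_left by simp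
  next
    show "(\<lambda>s. res (f s) \<odot>\<^bsub>M\<^esub> \<phi> s) \<in> T \<rightarrow> carrier M" using assms(4) smult_closed by simp
  qed (use assms in simp_all)
qed

lemma lin_hom:
  fixes S :: "'s set"
  assumes M: "left_module A M" and \<phi>: "\<And>s. s \<in> S \<Longrightarrow> \<phi> s \<in> carrier M"
  shows "lin M \<phi> \<in> left_module_hom A (free_mod S) M"
proof -
  interpret left_module A M by fact
  have closed: "(\<lambda>s. res (f s) \<odot>\<^bsub>M\<^esub> \<phi> s) \<in> T \<rightarrow> carrier M" if "T \<subseteq> S" for f T
    using that \<phi> smult_closed by (simp add: Pi_iff subset_iff)
  show ?thesis
  proof (rule left_module_homI)
    fix f :: "'s \<Rightarrow> ('x, 'k) ncpoly" assume f: "f \<in> carrier (free_mod S)"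
    then have f': "finite (supp f)" "supp f \<subseteq> S" "\<And>s. nf (f s) = f s" by (auto simp: free_mod_carrier)
    have in_M: "\<phi> s \<in> carrier M" if "s \<in> supp f" for s using that f' \<phi> by blast
    show "lin M \<phi> f \<in> carrier M" unfolding lin_def using closed[OF f'(2)] by (rule M.finsum_closed)
    {
      fix g :: "'s \<Rightarrow> ('x, 'k) ncpoly" assume g: "g \<in> carrier (free_mod S)"
      then have g': "finite (supp g)" "supp g \<subseteq> S" by (auto simp: free_mod_carrier)
      let ?T = "supp f \<union> supp g"
      have T: "finite ?T" "?T \<subseteq> S" using f' g' by auto
      have in_T: "\<phi> s \<in> carrier M" if "s \<in> ?T" for s using that T \<phi> by blast
      have sub: "supp (\<lambda>s. f s + g s) \<subseteq> ?T" by (auto simp: supp_def)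
      have "lin M \<phi> (\<lambda>s. f s + g s) = (\<Oplus>\<^bsub>M\<^esub>s\<in>?T. res (f s + g s) \<odot>\<^bsub>M\<^esub> \<phi> s)"
        by (rule lin_superset[OF M T(1) sub in_T])
      also have "\<dots> = (\<Oplus>\<^bsub>M\<^esub>s\<in>?T. res (f s) \<odot>\<^bsub>M\<^esub> \<phi> s \<oplus>\<^bsub>M\<^esub> res (g s) \<odot>\<^bsub>M\<^esub> \<phi> s)"
      proof (rule M.finsum_cong'[OF refl])
        fix s assume "s \<in> ?T"
        then show "res (f s + g s) \<odot>\<^bsub>M\<^esub> \<phi> s = res (f s) \<odot>\<^bsub>M\<^esub> \<phi> s \<oplus>\<^bsub>M\<^esub> res (g s) \<odot>\<^bsub>M\<^esub> \<phi> s"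
          using in_T smult_l_distr[of "res (f s)" "res (g s)" "\<phi> s"] by simp
      qed (use in_T smult_closed in simp)
      also have "\<dots> = (\<Oplus>\<^bsub>M\<^esub>s\<in>?T. res (f s) \<odot>\<^bsub>M\<^esub> \<phi> s) \<oplus>\<^bsub>M\<^esub> (\<Oplus>\<^bsub>M\<^esub>s\<in>?T. res (g s) \<odot>\<^bsub>M\<^esub> \<phi> s)"
        by (rule M.finsum_addf[OF closed[OF T(2)] closed[OF T(2)]])
      also have "(\<Oplus>\<^bsub>M\<^esub>s\<in>?T. res (f s) \<odot>\<^bsub>M\<^esub> \<phi> s) = lin M \<phi> f"
        by (rule lin_superset[OF M T(1) _ in_T, symmetric]) simp_all
      also have "(\<Oplus>\<^bsub>M\<^esub>s\<in>?T. res (g s) \<odot>\<^bsub>M\<^esub> \<phi> s) = lin M \<phi> g"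
        by (rule lin_superset[OF M T(1) _ in_T, symmetric]) simp_all
      finally show "lin M \<phi> (f \<oplus>\<^bsub>free_mod S\<^esub> g) = lin M \<phi> f \<oplus>\<^bsub>M\<^esub> lin M \<phi> g" by simp
    }
    fix a assume a: "a \<in> carrier A"
    have sub: "supp (\<lambda>s. nf (rep a * f s)) \<subseteq> supp f" by (auto simp: supp_def)
    have "lin M \<phi> (\<lambda>s. nf (rep a * f s)) = (\<Oplus>\<^bsub>M\<^esub>s\<in>supp f. res (nf (rep a * f s)) \<odot>\<^bsub>M\<^esub> \<phi> s)"
      by (rule lin_superset[OF M f'(1) sub in_M])
    also have "\<dots> = (\<Oplus>\<^bsub>M\<^esub>s\<in>supp f. a \<odot>\<^bsub>M\<^esub> (res (f s) \<odot>\<^bsub>M\<^esub> \<phi> s))"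
    proof (rule M.finsum_cong'[OF refl])
      fix s assume s: "s \<in> supp f"
      have "res (nf (rep a * f s)) = res (rep a) \<otimes>\<^bsub>A\<^esub> res (f s)" by simp
      also have "res (rep a) = a" by (rule res_rep[OF a])
      finally show "res (nf (rep a * f s)) \<odot>\<^bsub>M\<^esub> \<phi> s = a \<odot>\<^bsub>M\<^esub> (res (f s) \<odot>\<^bsub>M\<^esub> \<phi> s)"
        using a in_M[OF s] smult_assoc by simp
    qed (use in_M smult_closed a in simp)
    also have "\<dots> = a \<odot>\<^bsub>M\<^esub> lin M \<phi> f"
      unfolding lin_def using in_M smult_closed by (intro smult_finsum[symmetric] a f'(1)) simp
    finally show "lin M \<phi> (a \<odot>\<^bsub>free_mod S\<^esub> f) = a \<odot>\<^bsub>M\<^esub> lin M \<phi> f" by simp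
  qed
qed

lemma lin_term_at:
  assumes M: "left_module A M" and "\<phi> s \<in> carrier M"
  shows "lin M \<phi> (term_at p s) = res p \<odot>\<^bsub>M\<^esub> \<phi> s"
proof -
  interpret left_module A M by fact
  have "lin M \<phi> (term_at p s) = (\<Oplus>\<^bsub>M\<^esub>t\<in>{s}. res (term_at p s t) \<odot>\<^bsub>M\<^esub> \<phi> t)"
    using assms by (intro lin_superset supp_term_at) simp_all
  also have "\<dots> = res p \<odot>\<^bsub>M\<^esub> \<phi> s" using assms(2) smult_closed by simp
  finally show ?thesis .
qed

lemma finsum_free_mod:
  assumes "finite T" "\<And>i. i \<in> T \<Longrightarrow> F i \<in> carrier (free_mod S)"
  shows "(\<Oplus>\<^bsub>free_mod S\<^esub>i\<in>T. F i) = (\<lambda>t. \<Sum>i\<in>T. F i t)"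
  using assms
proof (induction T rule: finite_induct)
  case empty
  interpret left_module A "free_mod S" by (rule left_module_free_mod)
  show ?case by simp
next
  case (insert i T)
  interpret left_module A "free_mod S" by (rule left_module_free_mod)
  have "F \<in> T \<rightarrow> carrier (free_mod S)" "F i \<in> carrier (free_mod S)" using insert.prems by auto
  then have "(\<Oplus>\<^bsub>free_mod S\<^esub>j\<in>insert i T. F j) = F i \<oplus>\<^bsub>free_mod S\<^esub> (\<Oplus>\<^bsub>free_mod S\<^esub>j\<in>T. F j)"
    using insert.hyps by (intro M.finsum_insert)
  then show ?case using insert by simp
qed

lemma free_mod_decompose:
  assumes x: "x \<in> carrier (free_mod S)"
  shows "lin (free_mod S) (term_at 1) x = x"
proof -
  have x': "finite (supp x)" "\<And>s. nf (x s) = x s" "supp x \<subseteq> S" using x by (auto simp: free_mod_carrier)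
  have "term_at (1 :: 'x list \<Rightarrow>\<^sub>0 'k) s \<in> carrier (free_mod S)" if "s \<in> supp x" for s
    using that x' by (intro term_at_closed) auto
  then have "res (x s) \<odot>\<^bsub>free_mod S\<^esub> term_at 1 s \<in> carrier (free_mod S)" if "s \<in> supp x" for s
    using that by (simp add: free_mod_mult_closed)
  then have "lin (free_mod S) (term_at 1) x = (\<lambda>t. \<Sum>s\<in>supp x. (res (x s) \<odot>\<^bsub>free_mod S\<^esub> term_at 1 s) t)"
    unfolding lin_def by (intro finsum_free_mod x'(1))
  also have "\<dots> = x"
  proof
    fix t
    have "(\<Sum>s\<in>supp x. (res (x s) \<odot>\<^bsub>free_mod S\<^esub> term_at 1 s) t) = (\<Sum>s\<in>supp x. if t = s then x t else 0)"
      using x'(2) by (intro sum.cong) (auto simp: term_at_def)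
    also have "\<dots> = x t" using x'(1) by (simp add: not_in_supp)
    finally show "(\<Sum>s\<in>supp x. (res (x s) \<odot>\<^bsub>free_mod S\<^esub> term_at 1 s) t) = x t" .
  qed
  finally show ?thesis .
qed

lemma free_hom_eqI:
  assumes M: "left_module A M" and f: "f \<in> left_module_hom A (free_mod S) M"
    and g: "g \<in> left_module_hom A (free_mod S) M"
    and eq: "\<And>s. s \<in> S \<Longrightarrow> f (term_at 1 s) = g (term_at 1 s)" and x: "x \<in> carrier (free_mod S)"
  shows "f x = g x"
proof -
  have x': "finite (supp x)" "supp x \<subseteq> S" using x by (auto simp: free_mod_carrier)
  interpret f: module_hom A "free_mod S" M f by (intro module_homI left_module_free_mod M f)
  interpret g: module_hom A "free_mod S" M g by (intro module_homI left_module_free_mod M g)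
  have t: "term_at 1 s \<in> carrier (free_mod S)" if "s \<in> supp x" for s
    using that x' by (intro term_at_closed) auto
  then have c: "res (x s) \<odot>\<^bsub>free_mod S\<^esub> term_at 1 s \<in> carrier (free_mod S)" if "s \<in> supp x" for s
    using that f.smult_closed by (simp del: free_mod_simps)
  have "f x = f (lin (free_mod S) (term_at 1) x)" by (simp only: free_mod_decompose[OF x])
  also have "\<dots> = (\<Oplus>\<^bsub>M\<^esub>s\<in>supp x. f (res (x s) \<odot>\<^bsub>free_mod S\<^esub> term_at 1 s))"
    unfolding lin_def using x'(1) c by (rule f.hom_finsum)
  also have "\<dots> = (\<Oplus>\<^bsub>M\<^esub>s\<in>supp x. g (res (x s) \<odot>\<^bsub>free_mod S\<^esub> term_at 1 s))"
  proof (rule f.N.M.finsum_cong'[OF refl])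
    fix s assume s: "s \<in> supp x"
    then show "f (res (x s) \<odot>\<^bsub>free_mod S\<^esub> term_at 1 s) = g (res (x s) \<odot>\<^bsub>free_mod S\<^esub> term_at 1 s)"
      using t[OF s] eq[of s] x'(2) f.hom_smult[of "res (x s)" "term_at 1 s"] g.hom_smult[of "res (x s)" "term_at 1 s"]
      by (simp add: subset_iff del: free_mod_simps)
  qed (use c in \<open>simp del: free_mod_simps\<close>)
  also have "\<dots> = g (lin (free_mod S) (term_at 1) x)"
    unfolding lin_def using x'(1) c by (rule g.hom_finsum[symmetric])
  also have "\<dots> = g x" by (simp only: free_mod_decompose[OF x])
  finally show ?thesis .
qed

text \<open>The lift sends each basis element to a chosen preimage of its value under
  \<open>g\<close>; agreement on the basis gives agreement everywhere.\<close>

lemma projective_transport_free_mod: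
  fixes e :: "('s \<Rightarrow> ('x, 'k) ncpoly) \<Rightarrow> (('x, 'k) ncpoly set, 'u) universe"
  assumes inj: "inj_on e (carrier (free_mod S))"
  shows "projective_module A (transport e (free_mod S))"
  unfolding projective_module_def
proof (intro conjI allI impI)
  let ?F = "free_mod S :: (('x, 'k) ncpoly set, 's \<Rightarrow> ('x, 'k) ncpoly) module"
  show "left_module A (transport e ?F)" by (intro left_module_transport left_module_free_mod inj)
  fix M N :: "(('x, 'k) ncpoly set, (('x, 'k) ncpoly set, 'u) universe) module" and f g
  assume *: "left_module A M \<and> left_module A N \<and> f \<in> left_module_hom A M N \<and>
    f ` carrier M = carrier N \<and> g \<in> left_module_hom A (transport e ?F) N"
  then have M: "left_module A M" and N: "left_module A N" and f: "f \<in> left_module_hom A M N"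
    and surj: "f ` carrier M = carrier N" and g: "g \<in> left_module_hom A (transport e ?F) N" by simp_all
  define \<phi> where "\<phi> s = inv_into (carrier M) f (g (e (term_at 1 s)))" for s
  have ge: "(\<lambda>y. g (e y)) \<in> left_module_hom A ?F N"
    using left_module_hom_comp[OF transport_hom[OF inj] g] .
  have "g (e (term_at 1 s)) \<in> f ` carrier M" if "s \<in> S" for s
    using ge term_at_closed[OF nf_one that] unfolding surj by (auto simp: left_module_hom_def Pi_iff)
  then have \<phi>: "\<phi> s \<in> carrier M" "f (\<phi> s) = g (e (term_at 1 s))" if "s \<in> S" for s
    using that by (simp_all add: \<phi>_def inv_into_into f_inv_into_f)
  have lin: "lin M \<phi> \<in> left_module_hom A ?F M" using \<phi>(1) by (intro lin_hom M)
  define h where "h x = lin M \<phi> (inv_into (carrier ?F) e x)" for x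
  have h: "h \<in> left_module_hom A (transport e ?F) M"
    unfolding h_def by (rule left_module_hom_comp[OF transport_inv_hom[OF left_module_free_mod inj] lin])
  interpret M: left_module A M by fact
  have fl: "f (lin M \<phi> y) = g (e y)" if "y \<in> carrier ?F" for y
  proof (rule free_hom_eqI[OF N left_module_hom_comp[OF lin f] ge _ that])
    fix s assume s: "s \<in> S"
    have "lin M \<phi> (term_at 1 s) = \<one>\<^bsub>A\<^esub> \<odot>\<^bsub>M\<^esub> \<phi> s" using lin_term_at[OF M, of \<phi> s 1] \<phi>(1)[OF s] by simp
    then show "f (lin M \<phi> (term_at 1 s)) = g (e (term_at 1 s))"
      using \<phi>[OF s] M.smult_one by simp
  qed
  show "\<exists>h\<in>left_module_hom A (transport e ?F) M. \<forall>x\<in>carrier (transport e ?F). f (h x) = g x"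
    using h fl by (intro bexI[of _ h]) (auto simp: h_def inj)
qed

subsection \<open>Bases over the field\<close>

text \<open>A combination over \<open>K\<close> is one over \<open>A\<close> with constant
  coefficients, so its linearity is inherited from \<open>lin\<close>.\<close>

definition comb :: "(('x, 'k) ncpoly set, 'm) module \<Rightarrow> ('m \<Rightarrow> 'k) \<Rightarrow> 'm" where
  "comb M c = lin M (\<lambda>b. b) (\<lambda>b. single [] (c b))"

definition scalar_basis :: "(('x, 'k) ncpoly set, 'm) module \<Rightarrow> 'm set \<Rightarrow> bool" where
  "scalar_basis M B \<longleftrightarrow> B \<subseteq> carrier M \<and>
    (\<forall>m\<in>carrier M. \<exists>c. finite (supp c) \<and> supp c \<subseteq> B \<and> comb M c = m) \<and>
    (\<forall>c. finite (supp c) \<and> supp c \<subseteq> B \<and> comb M c = \<zero>\<^bsub>M\<^esub> \<longrightarrow> supp c = {})"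

lemma supp_single: "supp (\<lambda>b. single [] (c b) :: 'x list \<Rightarrow>\<^sub>0 'k) = supp c"
proof -
  have "(single [] a :: 'x list \<Rightarrow>\<^sub>0 'k) = 0 \<longleftrightarrow> a = 0" for a
    by (metis lookup_single_eq lookup_zero single_zero)
  then show ?thesis by (simp add: supp_def)
qed

lemma const_closed:
  "finite (supp c) \<Longrightarrow> supp c \<subseteq> S \<Longrightarrow> (\<lambda>b. single [] (c b)) \<in> carrier (free_mod S)"
  unfolding free_mod_carrier supp_single by (simp add: nf_single Nil_normal)

lemma comb_closed:
  assumes "left_module A M" "finite (supp c)" "supp c \<subseteq> carrier M"
  shows "comb M c \<in> carrier M"
  using lin_hom[OF assms(1), of "carrier M" "\<lambda>b. b"] const_closed[OF assms(2,3)]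
  by (auto simp: comb_def left_module_hom_def Pi_iff)

lemma comb_add:
  assumes "left_module A M" "finite (supp c)" "supp c \<subseteq> carrier M" "finite (supp c')" "supp c' \<subseteq> carrier M"
  shows "comb M (\<lambda>b. c b + c' b) = comb M c \<oplus>\<^bsub>M\<^esub> comb M c'"
proof -
  interpret module_hom A "free_mod (carrier M)" M "lin M (\<lambda>b. b)"
    by (intro module_homI left_module_free_mod lin_hom assms(1))
  show ?thesis
    unfolding comb_def using hom_add[OF const_closed[OF assms(2,3)] const_closed[OF assms(4,5)]]
    by (simp add: single_add)
qed

lemma comb_scale:
  assumes "left_module A M" "finite (supp c)" "supp c \<subseteq> carrier M"
  shows "comb M (\<lambda>b. a * c b) = scalar_class I a \<odot>\<^bsub>M\<^esub> comb M c"
proof -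
  interpret module_hom A "free_mod (carrier M)" M "lin M (\<lambda>b. b)"
    by (intro module_homI left_module_free_mod lin_hom assms(1))
  show ?thesis
    unfolding comb_def using hom_smult[OF _ const_closed[OF assms(2,3)], of "scalar_class I a"]
    by (simp add: scalar_class_eq nf_single Nil_normal single_word_mult)
qed

lemma comb_single:
  assumes "left_module A M" "m \<in> carrier M"
  shows "comb M (term_at 1 m) = m"
proof -
  interpret left_module A M by fact
  have "(\<lambda>b. single [] (term_at (1::'k) m b) :: 'x list \<Rightarrow>\<^sub>0 'k) = term_at 1 m"
    by (rule ext) (simp add: term_at_def poly_one)
  then show ?thesis
    unfolding comb_def using lin_term_at[OF assms(1), of "\<lambda>b. b" m 1] assms(2) smult_one by simp
qed

definition scalar_indep :: "(('x, 'k) ncpoly set, 'm) module \<Rightarrow> 'm set \<Rightarrow> bool" where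
  "scalar_indep M B \<longleftrightarrow> B \<subseteq> carrier M \<and>
    (\<forall>c. finite (supp c) \<and> supp c \<subseteq> B \<and> comb M c = \<zero>\<^bsub>M\<^esub> \<longrightarrow> supp c = {})"

lemma scalar_indep_insert:
  assumes M: "left_module A M" and B: "scalar_indep M B" and m: "m \<in> carrier M"
    and no: "\<nexists>c. finite (supp c) \<and> supp c \<subseteq> B \<and> comb M c = m"
  shows "scalar_indep M (insert m B)"
  unfolding scalar_indep_def
proof (intro conjI allI impI)
  interpret left_module A M by fact
  have BM: "B \<subseteq> carrier M" using B by (simp add: scalar_indep_def)
  show "insert m B \<subseteq> carrier M" using BM m by simp
  fix c assume c: "finite (supp c) \<and> supp c \<subseteq> insert m B \<and> comb M c = \<zero>\<^bsub>M\<^esub>"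
  show "supp c = {}"
  proof (cases "c m = 0")
    case True
    then have "supp c \<subseteq> B" using c by (auto simp: supp_def)
    then show ?thesis using B c by (simp add: scalar_indep_def)
  next
    case False
    \<comment> \<open>Obtained by solving the relation \<open>c\<close> for \<open>m\<close>: the
      unit vector at \<open>m\<close> is \<open>c\<close> divided by \<open>c m\<close>, plus
      \<open>c'\<close>.\<close>
    define c' where "c' b = - (1 / c m) * (if b = m then 0 else c b)" for b
    have sub: "supp c' \<subseteq> supp c - {m}" by (auto simp: supp_def c'_def)
    then have c': "finite (supp c')" "supp c' \<subseteq> B" using c finite_subset by blast+
    then have c'M: "supp c' \<subseteq> carrier M" using BM by blast
    have t: "finite (supp (term_at (1::'k) m))" "supp (term_at (1::'k) m) \<subseteq> carrier M"
      using supp_term_at[of "1::'k" m] m finite_subset by blast+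
    have cM: "supp c \<subseteq> carrier M" using c BM m by blast
    have "term_at (1::'k) m = (\<lambda>b. (1 / c m) * c b + c' b)"
      using False by (auto simp: term_at_def c'_def)
    then have "m = comb M (\<lambda>b. (1 / c m) * c b + c' b)" using comb_single[OF M m] by simp
    also have "\<dots> = comb M (\<lambda>b. (1 / c m) * c b) \<oplus>\<^bsub>M\<^esub> comb M c'"
    proof (rule comb_add[OF M _ _ c'(1) c'M])
      have "supp (\<lambda>b. 1 / c m * c b) \<subseteq> supp c" by (auto simp: supp_def)
      then show "finite (supp (\<lambda>b. 1 / c m * c b))" "supp (\<lambda>b. 1 / c m * c b) \<subseteq> carrier M"
        using c cM finite_subset by blast+
    qed
    also have "comb M (\<lambda>b. (1 / c m) * c b) = \<zero>\<^bsub>M\<^esub>"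
      using comb_scale[OF M _ cM, of "1 / c m"] c by (simp add: smult_zero_right scalar_class_eq)
    also have "\<zero>\<^bsub>M\<^esub> \<oplus>\<^bsub>M\<^esub> comb M c' = comb M c'" using comb_closed[OF M c'(1) c'M] by simp
    finally show ?thesis using no c' by auto
  qed
qed

lemma scalar_basis_exists:
  assumes M: "left_module A M"
  shows "\<exists>B. scalar_basis M B"
proof -
  have "\<exists>B\<in>{B. scalar_indep M B}. \<forall>Y\<in>{B. scalar_indep M B}. B \<subseteq> Y \<longrightarrow> Y = B"
  proof (rule subset_Zorn_nonempty)
    have "scalar_indep M {}" by (simp add: scalar_indep_def)
    then show "{B. scalar_indep M B} \<noteq> {}" by blast
    fix \<C> assume C: "\<C> \<noteq> {}" "subset.chain ({B. scalar_indep M B}) \<C>"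
    have ind: "scalar_indep M B" if "B \<in> \<C>" for B
      using C(2) that by (auto simp: subset_chain_def)
    have "scalar_indep M (\<Union>\<C>)" unfolding scalar_indep_def
    proof (intro conjI allI impI)
      show "\<Union>\<C> \<subseteq> carrier M" using ind by (auto simp: scalar_indep_def)
      fix c assume c: "finite (supp c) \<and> supp c \<subseteq> \<Union>\<C> \<and> comb M c = \<zero>\<^bsub>M\<^esub>"
      then obtain B where "B \<in> \<C>" "supp c \<subseteq> B"
        using finite_subset_Union_chain[of "supp c" \<C>] C by metis
      then show "supp c = {}" using ind[of B] c by (simp add: scalar_indep_def)
    qed
    then show "\<Union>\<C> \<in> {B. scalar_indep M B}" by simp
  qed
  then obtain B where B: "scalar_indep M B" "\<And>Y. scalar_indep M Y \<Longrightarrow> B \<subseteq> Y \<Longrightarrow> Y = B" by blast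
  have "\<exists>c. finite (supp c) \<and> supp c \<subseteq> B \<and> comb M c = m" if m: "m \<in> carrier M" for m
  proof (rule ccontr)
    assume no: "\<nexists>c. finite (supp c) \<and> supp c \<subseteq> B \<and> comb M c = m"
    then have "insert m B = B" using scalar_indep_insert[OF M B(1) m] B(2) by blast
    then have "m \<in> B" by blast
    then have "supp (term_at (1::'k) m) \<subseteq> B" "finite (supp (term_at (1::'k) m))"
      using supp_term_at[of "1::'k" m] finite_subset by blast+
    then show False using no comb_single[OF M m] by blast
  qed
  then have "scalar_basis M B" using B(1) by (simp add: scalar_basis_def scalar_indep_def)
  then show ?thesis by blast
qed

end

section \<open>The chain resolution\<close>

lemma lookup_mult_single:
  "lookup (p * single v q) (w @ v) = lookup (p :: 'x list \<Rightarrow>\<^sub>0 'k::field) w * q"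
proof -
  have "p * single v q =
      (\<Sum>u\<in>keys p. single (u @ v) (lookup p u * q))"
    by (subst (1) poly_mapping_sum_single[of p]) (simp add: sum_distrib_right single_word_mult)
  then have "lookup (p * single v q) (w @ v) =
      (\<Sum>u\<in>keys p. if u = w then lookup p w * q else 0)"
    by (auto simp: lookup_sum lookup_single when_def intro!: sum.cong)
  then show ?thesis by (simp add: in_keys_iff)
qed

text \<open>The empty word has only the trivial factorization. The constant term therefore defines
  an action on the field, and it is also what detects minimality later.\<close>

lemma lookup_mult_Nil:
  "lookup (p * q) [] = lookup p [] * lookup (q :: 'x list \<Rightarrow>\<^sub>0 'k::field) []"
proof -
  define q' where "q' = q - single [] (lookup q [])"
  have "lookup (p * q') [] = 0"
  proof (rule ccontr)
    assume "lookup (p * q') [] \<noteq> 0"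
    then have "[] \<in> keys (p * q')" by (simp add: in_keys_iff)
    then have "[] \<in> keys q'" using keys_mult_words[of "[]" p q'] by auto
    then show False by (simp add: q'_def in_keys_iff lookup_minus)
  qed
  moreover have "p * q = p * single [] (lookup q []) + p * q'"
    by (simp add: q'_def algebra_simps)
  ultimately show ?thesis
    using lookup_mult_single[of p "[]" "lookup q []" "[]"] by (simp add: lookup_add)
qed

text \<open>Degree of a basis element: the letters of the chain count, the element of the module
  does not.\<close>

definition weight :: "'x list list \<times> 'm \<Rightarrow> nat" where
  "weight s = length (concat (fst s))"

text \<open>The bound is strict, so that \<open>below 0\<close> forces zero and starts the induction
  on degrees.\<close>

definition below :: "nat \<Rightarrow> ('x list list \<times> 'm \<Rightarrow> ('x, 'k::field) ncpoly) \<Rightarrow> bool" where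
  "below D f \<longleftrightarrow> (\<forall>s. \<forall>a\<in>keys (f s). length a + weight s < D)"

lemma belowD: "below D f \<Longrightarrow> a \<in> keys (f s) \<Longrightarrow> length a + weight s < D"
  unfolding below_def by blast

lemma below_mono: "below D f \<Longrightarrow> D \<le> D' \<Longrightarrow> below D' f"
  unfolding below_def by (metis order_less_le_trans)

lemma below_add: "below D f \<Longrightarrow> below D g \<Longrightarrow> below D (\<lambda>s. f s + g s)"
  unfolding below_def by (metis Un_iff keys_add subsetD)

lemma below_exists: "finite (supp f) \<Longrightarrow> \<exists>D. below D f"
proof -
  assume "finite (supp f)"
  then have "finite (\<Union>s\<in>supp f. (\<lambda>a. length a + weight s) ` keys (f s))" by simp
  then obtain D where D: "\<forall>n\<in>(\<Union>s\<in>supp f. (\<lambda>a. length a + weight s) ` keys (f s)). n < D"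
    by (auto simp: finite_nat_set_iff_bounded)
  have "length a + weight s < D" if "a \<in> keys (f s)" for a s
  proof -
    have "s \<in> supp f" using that by (auto simp: supp_def)
    then show ?thesis using D that by blast
  qed
  then show "\<exists>D. below D f" by (auto simp: below_def)
qed

context lyndon_quotient
begin

lemma free_mod_nf: "f \<in> carrier (free_mod S) \<Longrightarrow> nf (f s) = f s"
  unfolding free_mod_carrier by blast

definition idx :: "'m set \<Rightarrow> nat \<Rightarrow> ('x list list \<times> 'm) set" where
  "idx B k = {(c, b). chain c \<and> length c = k \<and> b \<in> B}"

abbreviation word_at :: "'x list \<Rightarrow> 's \<Rightarrow> 's \<Rightarrow> ('x, 'k) ncpoly" where
  "word_at t \<equiv> term_at (single t 1)"

text \<open>
  \<open>syzygy k B Q\<close>: the submodule \<open>Q\<close> of the \<open>k\<close>-th free module has as its leading terms exactly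
  the basis elements \<open>(c, b)\<close> multiplied by the words killed by \<open>c\<close>.
\<close>

definition syzygy :: "nat \<Rightarrow> 'm set \<Rightarrow> ('x list list \<times> 'm \<Rightarrow> ('x, 'k) ncpoly) set \<Rightarrow> bool" where
  "syzygy k B Q \<longleftrightarrow> Q \<subseteq> carrier (free_mod (idx B k)) \<and> (\<lambda>_. 0) \<in> Q \<and>
    (\<forall>f\<in>Q. \<forall>g\<in>Q. (\<lambda>s. f s + g s) \<in> Q) \<and> (\<forall>f\<in>Q. \<forall>p. (\<lambda>s. nf (p * f s)) \<in> Q) \<and>
    (\<forall>f\<in>Q. \<forall>D c b a. below (Suc D) f \<longrightarrow> a \<in> keys (f (c, b)) \<longrightarrow>
      length a + weight (c, b) = D \<longrightarrow> killed c a) \<and>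
    (\<forall>c b t. (c, b) \<in> idx B k \<longrightarrow> step c t \<longrightarrow>
      (\<exists>g\<in>Q. below (length t + weight (c, b)) (\<lambda>s. g s - word_at t (c, b) s)))"

text \<open>The generator attached to a chain. The bare monomial is preferred if it lies in
  \<open>Q\<close>; for a trivial module this is always the case, and it is what makes that
  resolution minimal.\<close>

definition gens :: "('x list list \<times> 'm \<Rightarrow> ('x, 'k) ncpoly) set \<Rightarrow> 'x list list \<times> 'm \<Rightarrow>
    'x list list \<times> 'm \<Rightarrow> ('x, 'k) ncpoly" where
  "gens Q s = (case fst s of [] \<Rightarrow> (\<lambda>_. 0) | t # c \<Rightarrow>
    if word_at t (c, snd s) \<in> Q then word_at t (c, snd s)
    else SOME g. g \<in> Q \<and> below (length t + weight (c, snd s)) (\<lambda>r. g r - word_at t (c, snd s) r))"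

lemma gens_Cons:
  assumes Q: "syzygy k B Q" and s: "(t # c, b) \<in> idx B (Suc k)"
  shows "gens Q (t # c, b) \<in> Q"
    and "below (length t + weight (c, b)) (\<lambda>r. gens Q (t # c, b) r - word_at t (c, b) r)"
proof -
  have cb: "(c, b) \<in> idx B k" "step c t" using s by (auto simp: idx_def)
  let ?P = "\<lambda>g. g \<in> Q \<and> below (length t + weight (c, b)) (\<lambda>r. g r - word_at t (c, b) r)"
  have "?P (gens Q (t # c, b))"
  proof (cases "word_at t (c, b) \<in> Q")
    case True
    then show ?thesis by (simp add: gens_def below_def)
  next
    case False
    have "\<exists>g. ?P g" using Q cb unfolding syzygy_def by blast
    then have "?P (SOME g. ?P g)" by (rule someI_ex)
    then show ?thesis using False by (simp add: gens_def)
  qed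
  then show "gens Q (t # c, b) \<in> Q"
    "below (length t + weight (c, b)) (\<lambda>r. gens Q (t # c, b) r - word_at t (c, b) r)" by simp_all
qed

lemma idx_Suc_cases:
  assumes "s \<in> idx B (Suc k)"
  obtains t c b where "s = (t # c, b)" "(c, b) \<in> idx B k" "step c t"
proof -
  obtain c' b where s: "s = (c', b)" by (cases s)
  then obtain t c where "c' = t # c" using assms by (cases c') (auto simp: idx_def)
  then show thesis using that[of t c b] assms s by (simp add: idx_def)
qed

lemma gens_closed:
  assumes Q: "syzygy k B Q" and s: "s \<in> idx B (Suc k)"
  shows "gens Q s \<in> carrier (free_mod (idx B k))"
proof -
  obtain t c b where "s = (t # c, b)" using s by (rule idx_Suc_cases)
  then have "gens Q s \<in> Q" using gens_Cons(1)[OF Q] s by simp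
  moreover have "Q \<subseteq> carrier (free_mod (idx B k))" using Q by (simp add: syzygy_def)
  ultimately show ?thesis by blast
qed

definition diff_map :: "nat \<Rightarrow> 'm set \<Rightarrow> ('x list list \<times> 'm \<Rightarrow> ('x, 'k) ncpoly) set \<Rightarrow>
    ('x list list \<times> 'm \<Rightarrow> ('x, 'k) ncpoly) \<Rightarrow> ('x list list \<times> 'm \<Rightarrow> ('x, 'k) ncpoly)" where
  "diff_map k B Q = lin (free_mod (idx B k)) (gens Q)"

lemma diff_map_hom:
  assumes "syzygy k B Q"
  shows "diff_map k B Q \<in> left_module_hom A (free_mod (idx B (Suc k))) (free_mod (idx B k))"
  unfolding diff_map_def using gens_closed[OF assms] by (intro lin_hom left_module_free_mod)

lemma diff_map_add:
  assumes "syzygy k B Q" "f \<in> carrier (free_mod (idx B (Suc k)))" "g \<in> carrier (free_mod (idx B (Suc k)))"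
  shows "diff_map k B Q (\<lambda>s. f s + g s) = (\<lambda>s. diff_map k B Q f s + diff_map k B Q g s)"
  using diff_map_hom[OF assms(1)] assms(2,3) by (auto simp: left_module_hom_def)

lemma diff_map_mult:
  assumes "syzygy k B Q" "f \<in> carrier (free_mod (idx B (Suc k)))"
  shows "diff_map k B Q (\<lambda>s. nf (p * f s)) = (\<lambda>s. nf (p * diff_map k B Q f s))"
proof -
  have "diff_map k B Q (res p \<odot>\<^bsub>free_mod (idx B (Suc k))\<^esub> f) = res p \<odot>\<^bsub>free_mod (idx B k)\<^esub> diff_map k B Q f"
    using diff_map_hom[OF assms(1)] assms(2) unfolding left_module_hom_def by (simp del: free_mod_simps)
  then show ?thesis by (simp add: nf_mult_nf)
qed

lemma diff_map_eq:
  assumes Q: "syzygy k B Q" and f: "f \<in> carrier (free_mod (idx B (Suc k)))"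
  shows "diff_map k B Q f r = (\<Sum>s\<in>supp f. nf (f s * gens Q s r))"
proof -
  have f': "finite (supp f)" "supp f \<subseteq> idx B (Suc k)" using f by (auto simp: free_mod_carrier)
  have "res (f s) \<odot>\<^bsub>free_mod (idx B k)\<^esub> gens Q s \<in> carrier (free_mod (idx B k))" if "s \<in> supp f" for s
  proof -
    have "gens Q s \<in> carrier (free_mod (idx B k))" using that f'(2) gens_closed[OF Q] by blast
    then show ?thesis by (simp add: free_mod_mult_closed)
  qed
  then show ?thesis
    unfolding diff_map_def lin_def by (subst finsum_free_mod[OF f'(1)]) (simp_all add: nf_mult_nf)
qed

lemma diff_map_term_at:
  assumes Q: "syzygy k B Q" and s: "s \<in> idx B (Suc k)"
  shows "diff_map k B Q (term_at p s) r = nf (p * gens Q s r)"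
proof -
  have "gens Q s \<in> carrier (free_mod (idx B k))" using gens_closed[OF Q s] .
  then show ?thesis
    unfolding diff_map_def by (subst lin_term_at[OF left_module_free_mod]) (simp_all add: nf_mult_nf)
qed

lemma diff_map_image:
  assumes Q: "syzygy k B Q" and f: "f \<in> carrier (free_mod (idx B (Suc k)))"
  shows "diff_map k B Q f \<in> Q"
proof -
  have f': "finite (supp f)" "supp f \<subseteq> idx B (Suc k)" using f by (auto simp: free_mod_carrier)
  have Q': "(\<lambda>_. 0) \<in> Q" "\<And>f g. f \<in> Q \<Longrightarrow> g \<in> Q \<Longrightarrow> (\<lambda>s. f s + g s) \<in> Q"
    "\<And>f p. f \<in> Q \<Longrightarrow> (\<lambda>s. nf (p * f s)) \<in> Q" using Q by (simp_all add: syzygy_def)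
  have "(\<lambda>r. \<Sum>s\<in>T. nf (f s * gens Q s r)) \<in> Q" if "finite T" "T \<subseteq> idx B (Suc k)" for T
    using that
  proof (induction T rule: finite_induct)
    case (insert s T)
    obtain t c b where s: "s = (t # c, b)" using insert.prems by (auto elim: idx_Suc_cases)
    have "gens Q s \<in> Q" using gens_Cons(1)[OF Q] insert.prems s by simp
    then show ?case using Q'(2)[OF Q'(3)[of "gens Q s" "f s"]] insert by simp
  qed (use Q' in simp)
  then show ?thesis using f' by (simp add: diff_map_eq[OF Q f] ext[of "diff_map k B Q f"])
qed

text \<open>Multiplication by \<open>v\<close> moves the leading word \<open>t\<close> to
  \<open>v @ t\<close>, while the lower terms stay below degree \<open>D\<close>; so among monomials
  of degree at least \<open>D\<close> only this one occurs.\<close>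

lemma leading_term_reduce:
  assumes Q: "syzygy k B Q" and s: "(c, b) \<in> idx B k" and t: "step c t"
    and a: "v @ t \<in> NW" and D: "length (v @ t) + weight (c, b) = D" and w: "D \<le> length w + weight r"
  shows "lookup (nf (single v q * gens Q (t # c, b) r)) w =
    (if r = (c, b) \<and> w = v @ t then q else 0)"
proof -
  have "(t # c, b) \<in> idx B (Suc k)" using s t by (simp add: idx_def)
  note g = gens_Cons(2)[OF Q this]
  define \<rho> where "\<rho> r = gens Q (t # c, b) r - word_at t (c, b) r" for r
  have \<rho>: "length x + weight r < length t + weight (c, b)" if "x \<in> keys (\<rho> r)" for x r
    using belowD[OF g] that by (simp add: \<rho>_def)
  have gen: "gens Q (t # c, b) r = word_at t (c, b) r + \<rho> r" by (simp add: \<rho>_def)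
  have zero: "lookup (single v q * \<rho> r) w = 0"
  proof (rule ccontr)
    assume "lookup (single v q * \<rho> r) w \<noteq> 0"
    then have "w \<in> keys (single v q * \<rho> r)" by (simp add: in_keys_iff)
    then obtain u x where ux: "w = u @ x" "u \<in> keys (single v q)"
      "x \<in> keys (\<rho> r)" using keys_mult_words by blast
    then have "u = v" by (auto split: if_splits)
    then show False using \<rho>[OF ux(3)] D w ux(1) by simp
  qed
  have "lookup (single v q * gens Q (t # c, b) r) w =
      lookup (single v q * word_at t (c, b) r) w"
    by (simp add: gen distrib_left lookup_add zero)
  also have "\<dots> = (if r = (c, b) \<and> w = v @ t then q else 0)"
    by (auto simp: term_at_def single_word_mult lookup_single when_def)
  finally have "lookup (single v q * gens Q (t # c, b) r) w =
    (if r = (c, b) \<and> w = v @ t then q else 0)" .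
  then show ?thesis unfolding lookup_nf by (metis a)
qed

text \<open>Cancels the terms of top degree one after the other.\<close>

lemma diff_map_surj:
  assumes Q: "syzygy k B Q"
  shows "f \<in> Q \<Longrightarrow> below D f \<Longrightarrow>
    \<exists>y\<in>carrier (free_mod (idx B (Suc k))). below D y \<and> diff_map k B Q y = f"
proof (induction D arbitrary: f)
  case 0
  have "f s = 0" for s
  proof -
    have "keys (f s) = {}" using belowD[OF 0(2)] by blast
    then show ?thesis by simp
  qed
  then have f: "f = (\<lambda>_. 0)" by blast
  have z: "(\<lambda>_. 0) \<in> carrier (free_mod (idx B (Suc k)))" by (simp add: free_mod_carrier supp_def)
  have "diff_map k B Q (\<lambda>_. 0) r = 0" for r using diff_map_eq[OF Q z] by (simp add: supp_def)
  then show ?case using f z by (intro bexI[of _ "\<lambda>_. 0"]) (auto simp: below_def)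
next
  case (Suc D)
  have Q': "\<And>f. f \<in> Q \<Longrightarrow> f \<in> carrier (free_mod (idx B k))"
    "\<And>f g. f \<in> Q \<Longrightarrow> g \<in> Q \<Longrightarrow> (\<lambda>s. f s + g s) \<in> Q"
    "\<And>f p. f \<in> Q \<Longrightarrow> (\<lambda>s. nf (p * f s)) \<in> Q"
    "\<And>f D c b a. f \<in> Q \<Longrightarrow> below (Suc D) f \<Longrightarrow> a \<in> keys (f (c, b)) \<Longrightarrow>
      length a + weight (c, b) = D \<Longrightarrow> killed c a" using Q unfolding syzygy_def by blast+
  \<comment> \<open>The monomials of degree exactly \<open>D\<close>; their number is the measure of
    the inner induction, which removes one of them at a time.\<close>
  define top where "top f = {(s, a). a \<in> keys (f s) \<and> length a + weight s = D}"
    for f :: "'x list list \<times> 'a \<Rightarrow> ('x, 'k) ncpoly"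
  have fin: "finite (top f)" if "f \<in> Q" for f
  proof (rule finite_subset)
    show "top f \<subseteq> Sigma (supp f) (\<lambda>s. keys (f s))" by (auto simp: top_def supp_def)
    show "finite (Sigma (supp f) (\<lambda>s. keys (f s)))"
      using Q'(1)[OF that] by (auto simp: free_mod_carrier)
  qed
  have IH: "\<And>f. f \<in> Q \<Longrightarrow> below D f \<Longrightarrow>
    \<exists>y\<in>carrier (free_mod (idx B (Suc k))). below D y \<and> diff_map k B Q y = f" by (rule Suc.IH)
  show ?case using Suc.prems
  proof (induction "card (top f)" arbitrary: f rule: less_induct)
    case less
    note fQ = less.prems(1) and fD = less.prems(2)
    have nf_f: "nf (f s) = f s" "supp f \<subseteq> idx B k" for s
      using free_mod_nf[OF Q'(1)[OF fQ]] Q'(1)[OF fQ] by (simp_all add: free_mod_carrier)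
    show ?case
    proof (cases "top f = {}")
      case True
      have "below D f" unfolding below_def
      proof (intro allI ballI)
        fix s a assume a: "a \<in> keys (f s)"
        then have "length a + weight s < Suc D" by (rule belowD[OF fD])
        moreover have "length a + weight s \<noteq> D"
        proof
          assume "length a + weight s = D"
          then have "(s, a) \<in> top f" using a by (simp add: top_def)
          then show False using True by blast
        qed
        ultimately show "length a + weight s < D" by simp
      qed
      then obtain y where "y \<in> carrier (free_mod (idx B (Suc k)))" "below D y" "diff_map k B Q y = f"
        using IH[OF fQ] by blast
      then show ?thesis using below_mono[of D y "Suc D"] by (intro bexI[of _ y]) simp_all
    next
      case False
      then obtain c b a where ca: "a \<in> keys (f (c, b))" "length a + weight (c, b) = D"
        by (auto simp: top_def)
      have s: "(c, b) \<in> idx B k" using nf_f(2) ca(1) by (auto simp: supp_def)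
      then have "chain c" by (simp add: idx_def)
      have "a \<in> NW" using ca(1) nf_f(1)[of "(c, b)"] keys_nf[of "f (c, b)"] by auto
      moreover have "killed c a" by (rule Q'(4)[OF fQ fD ca])
      ultimately obtain v t where vt: "a = v @ t" "step c t" using killed_split[OF \<open>chain c\<close>] by blast
      define q where "q = lookup (f (c, b)) a"
      let ?g = "gens Q (t # c, b)"
      have s': "(t # c, b) \<in> idx B (Suc k)" using s vt by (simp add: idx_def)
      \<comment> \<open>Subtracting this multiple of the generator clears \<open>a\<close> at
        \<open>(c, b)\<close> and changes nothing else in degree \<open>D\<close> or above.\<close>
      define f1 where "f1 r = f r + nf (single v (- q) * ?g r)" for r
      have f1Q: "f1 \<in> Q" unfolding f1_def using Q'(2)[OF fQ Q'(3)[OF gens_Cons(1)[OF Q s']]] .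
      have lookup_f1: "lookup (f1 r) w = (if r = (c, b) \<and> w = a then 0 else lookup (f r) w)"
        if "D \<le> length w + weight r" for r w
        using leading_term_reduce[OF Q s vt(2) _ _ that, of v "- q"] \<open>a \<in> NW\<close> ca(2) vt(1)
        by (simp add: f1_def lookup_add q_def)
      have keys_f1: "w \<in> keys (f r) \<and> \<not> (r = (c, b) \<and> w = a)"
        if "w \<in> keys (f1 r)" "D \<le> length w + weight r" for r w
        using lookup_f1[OF that(2)] that(1) by (auto simp: in_keys_iff split: if_splits)
      have "below (Suc D) f1" unfolding below_def
      proof (intro allI ballI, rule ccontr)
        fix r w assume w: "w \<in> keys (f1 r)" "\<not> length w + weight r < Suc D"
        then have "w \<in> keys (f r)" using keys_f1 by simp
        then show False using w belowD[OF fD] by blast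
      qed
      moreover have "top f1 \<subseteq> top f - {((c, b), a)}" using keys_f1 by (auto simp: top_def)
      moreover have "((c, b), a) \<in> top f" using ca by (simp add: top_def)
      ultimately have "below (Suc D) f1" "top f1 \<subset> top f" by blast+
      moreover from this(2) have "card (top f1) < card (top f)" using fin[OF fQ] by (rule psubset_card_mono[rotated])
      ultimately obtain y1 where y1: "y1 \<in> carrier (free_mod (idx B (Suc k)))" "below (Suc D) y1"
        "diff_map k B Q y1 = f1" using less.hyps[of f1] f1Q by blast
      have "v \<in> NW" using \<open>a \<in> NW\<close> vt(1) normal_words_sublist[of a W v] by simp
      then have y2: "term_at (single v q) (t # c, b) \<in> carrier (free_mod (idx B (Suc k)))"
        using s' by (intro term_at_closed) (simp_all add: nf_single)
      define y where "y r = y1 r + term_at (single v q) (t # c, b) r" for r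
      have "y \<in> carrier (free_mod (idx B (Suc k)))" unfolding y_def by (rule free_mod_add_closed[OF y1(1) y2])
      moreover have "below (Suc D) (term_at (single v q) (t # c, b))"
        using ca(2) vt(1) by (auto simp: below_def term_at_def weight_def split: if_splits)
      then have "below (Suc D) y" unfolding y_def using y1(2) by (intro below_add)
      moreover have "diff_map k B Q y = f"
      proof
        fix r
        have "diff_map k B Q y r = f1 r + nf (single v q * ?g r)"
          unfolding y_def diff_map_add[OF Q y1(1) y2] by (simp add: y1(3) diff_map_term_at[OF Q s'])
        also have "\<dots> = f r + nf (single v (- q) * ?g r + single v q * ?g r)"
          by (simp add: f1_def nf_add)
        also have "single v (- q) * ?g r + single v q * ?g r = 0"
          by (simp add: single_uminus)
        finally show "diff_map k B Q y r = f r" by simp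
      qed
      ultimately show ?thesis by (intro bexI[of _ y] conjI)
    qed
  qed
qed

lemma diff_map_range:
  assumes Q: "syzygy k B Q"
  shows "diff_map k B Q ` carrier (free_mod (idx B (Suc k))) = Q"
proof
  show "diff_map k B Q ` carrier (free_mod (idx B (Suc k))) \<subseteq> Q"
    by (rule image_subsetI) (rule diff_map_image[OF Q])
  show "Q \<subseteq> diff_map k B Q ` carrier (free_mod (idx B (Suc k)))"
  proof
    fix f assume f: "f \<in> Q"
    moreover have "Q \<subseteq> carrier (free_mod (idx B k))" using Q by (simp add: syzygy_def)
    ultimately have "finite (supp f)" by (auto simp: free_mod_carrier)
    then obtain D where "below D f" using below_exists[of f] by blast
    then show "f \<in> diff_map k B Q ` carrier (free_mod (idx B (Suc k)))"
      using diff_map_surj[OF Q f] by blast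
  qed
qed

section \<open>The kernel of a differential\<close>

definition next_syzygy where
  "next_syzygy k B Q = {f \<in> carrier (free_mod (idx B (Suc k))). diff_map k B Q f = (\<lambda>_. 0)}"

text \<open>If \<open>c' = t # c\<close> does not kill \<open>a\<close>, then \<open>a @ t\<close>
  is normal and appears in the differential at \<open>(c, b)\<close>. No other term of
  \<open>f\<close> can cancel it: the lower parts of the generators have too small degree, and by
  \<open>step_unique\<close> the leading word of no other generator fits.\<close>

lemma next_syzygy_killed:
  assumes Q: "syzygy k B Q" and f: "f \<in> next_syzygy k B Q" and D: "below (Suc D) f"
    and a: "a \<in> keys (f (c', b))" "length a + weight (c', b) = D"
  shows "killed c' a"
proof (rule ccontr)
  assume nk: "\<not> killed c' a"
  have fc: "f \<in> carrier (free_mod (idx B (Suc k)))" and f0: "diff_map k B Q f = (\<lambda>_. 0)"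
    using f by (simp_all add: next_syzygy_def)
  have f': "finite (supp f)" "supp f \<subseteq> idx B (Suc k)" using fc by (simp_all add: free_mod_carrier)
  have sf: "(c', b) \<in> supp f" using a(1) by (auto simp: supp_def)
  then have "(c', b) \<in> idx B (Suc k)" using f'(2) by blast
  then obtain t c where tc: "c' = t # c" "(c, b) \<in> idx B k" "step c t" by (auto elim: idx_Suc_cases)
  have at: "a @ t \<in> NW" using nk tc(1) by simp
  have one: "lookup (nf (f s * gens Q s (c, b))) (a @ t) =
      (if s = (c', b) then lookup (f (c', b)) a else 0)" if s: "s \<in> supp f" for s
  proof -
    have "s \<in> idx B (Suc k)" using s f'(2) by blast
    then obtain t2 c2 b2 where s2: "s = (t2 # c2, b2)" "(c2, b2) \<in> idx B k" "step c2 t2"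
      by (rule idx_Suc_cases)
    note g = gens_Cons(2)[OF Q, of t2 c2 b2]
    define \<rho> where "\<rho> r = gens Q s r - word_at t2 (c2, b2) r" for r
    have \<rho>: "length x + weight r < length t2 + weight (c2, b2)" if "x \<in> keys (\<rho> r)" for x r
      using belowD[OF g] \<open>s \<in> idx B (Suc k)\<close> that s2(1) by (simp add: \<rho>_def)
    have gen: "gens Q s r = word_at t2 (c2, b2) r + \<rho> r" for r by (simp add: \<rho>_def)
    have "lookup (f s * \<rho> (c, b)) (a @ t) = 0"
    proof (rule ccontr)
      assume "lookup (f s * \<rho> (c, b)) (a @ t) \<noteq> 0"
      then have "a @ t \<in> keys (f s * \<rho> (c, b))" by (simp add: in_keys_iff)
      then obtain u x where ux: "a @ t = u @ x" "u \<in> keys (f s)"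
        "x \<in> keys (\<rho> (c, b))" using keys_mult_words by blast
      have "length u + weight s \<le> D" using belowD[OF D ux(2)] by simp
      moreover have "length a + length t = length u + length x" using arg_cong[OF ux(1), of length] by simp
      ultimately show False using \<rho>[OF ux(3)] a(2) tc(1) s2(1) by (simp add: weight_def)
    qed
    then have "lookup (f s * gens Q s (c, b)) (a @ t) =
        lookup (f s * word_at t2 (c2, b2) (c, b)) (a @ t)"
      by (simp add: gen distrib_left lookup_add)
    also have "\<dots> = (if s = (c', b) then lookup (f (c', b)) a else 0)"
    proof (cases "s = (c', b)")
      case True
      then have "t2 = t" "c2 = c" "b2 = b" using s2(1) tc(1) by simp_all
      then show ?thesis using True by (simp add: lookup_mult_single)
    next
      case False
      have "lookup (f s * word_at t2 (c2, b2) (c, b)) (a @ t) = 0"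
      proof (rule ccontr)
        assume ne: "\<not> ?thesis"
        then have cb: "(c, b) = (c2, b2)" by (auto simp: term_at_def split: if_splits)
        then have "a @ t \<in> keys (f s * single t2 1)" using ne by (simp add: in_keys_iff)
        then obtain u x where ux: "a @ t = u @ x" "x \<in> keys (single t2 (1 :: 'k))"
          using keys_mult_words by blast
        then have "a @ t = u @ t2" by simp
        then have "t = t2" using step_unique[of a t u t2 c] tc(3) s2(3) cb by simp
        then show False using False s2(1) cb tc(1) by simp
      qed
      then show ?thesis using False by simp
    qed
    finally show ?thesis using at by (simp add: lookup_nf)
  qed
  have "0 = lookup (diff_map k B Q f (c, b)) (a @ t)" by (simp add: f0)
  also have "\<dots> = (\<Sum>s\<in>supp f. if s = (c', b) then lookup (f (c', b)) a else 0)"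
    unfolding diff_map_eq[OF Q fc] lookup_sum by (rule sum.cong[OF refl one])
  also have "\<dots> = lookup (f (c', b)) a" using f'(1) sf by simp
  finally show False using a(1) by (simp add: in_keys_iff)
qed

lemma syzygy_next:
  assumes Q: "syzygy k B Q"
  shows "syzygy (Suc k) B (next_syzygy k B Q)"
  unfolding syzygy_def
proof (intro conjI ballI allI impI)
  show "next_syzygy k B Q \<subseteq> carrier (free_mod (idx B (Suc k)))" by (auto simp: next_syzygy_def)
  have z: "(\<lambda>_. 0) \<in> carrier (free_mod (idx B (Suc k)))" by (simp add: free_mod_carrier supp_def)
  have "diff_map k B Q (\<lambda>_. 0) r = 0" for r using diff_map_eq[OF Q z] by (simp add: supp_def)
  then show "(\<lambda>_. 0) \<in> next_syzygy k B Q" using z by (auto simp: next_syzygy_def)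
next
  fix f g assume "f \<in> next_syzygy k B Q" "g \<in> next_syzygy k B Q"
  then show "(\<lambda>s. f s + g s) \<in> next_syzygy k B Q"
    by (simp add: next_syzygy_def free_mod_add_closed diff_map_add[OF Q])
next
  fix f p assume "f \<in> next_syzygy k B Q"
  then show "(\<lambda>s. nf (p * f s)) \<in> next_syzygy k B Q"
    by (simp add: next_syzygy_def free_mod_mult_closed diff_map_mult[OF Q])
next
  fix f D c b a
  assume "f \<in> next_syzygy k B Q" "below (Suc D) f" "a \<in> keys (f (c, b))"
    "length a + weight (c, b) = D"
  then show "killed c a" by (rule next_syzygy_killed[OF Q])
next
  fix c' b t' assume s: "(c', b) \<in> idx B (Suc k)" and t': "step c' t'"
  obtain t c where tc: "c' = t # c" "(c, b) \<in> idx B k" "step c t" using s by (auto elim: idx_Suc_cases)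
  define E where "E = length t' + weight (c', b)"
  let ?g = "gens Q (c', b)"
  have t'N: "t' \<in> NW" using t' by (simp add: step_def)
  then have e: "word_at t' (c', b) \<in> carrier (free_mod (idx B (Suc k)))"
    using s by (intro term_at_closed) (simp_all add: nf_single)
  have img: "diff_map k B Q (word_at t' (c', b)) \<in> Q" by (rule diff_map_image[OF Q e])
  \<comment> \<open>The word \<open>t' @ t\<close>, which would have degree \<open>E\<close>, is not
    normal because \<open>c'\<close> kills \<open>t'\<close>; the rest is smaller. So the image is
    also the image of some \<open>y\<close> below \<open>E\<close>, and subtracting \<open>y\<close>
    yields a cycle with the leading term \<open>t'\<close> at \<open>(c', b)\<close>.\<close>
  have "below E (diff_map k B Q (word_at t' (c', b)))"
    unfolding below_def
  proof (intro allI ballI)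
    fix r w assume "w \<in> keys (diff_map k B Q (word_at t' (c', b)) r)"
    then have w: "w \<in> keys (single t' 1 * ?g r)" "w \<in> NW"
      by (simp_all add: diff_map_term_at[OF Q s] keys_nf)
    obtain u x where ux: "w = u @ x" "u \<in> keys (single t' (1::'k))"
      "x \<in> keys (?g r)" using keys_mult_words[OF w(1)] by blast
    have u: "u = t'" using ux(2) by simp
    have below: "below (length t + weight (c, b)) (\<lambda>r. ?g r - word_at t (c, b) r)"
      using gens_Cons(2)[OF Q] s tc(1) by simp
    have "x \<in> keys (?g r - word_at t (c, b) r)"
    proof (rule ccontr)
      assume "\<not> ?thesis"
      then have "x \<in> keys (word_at t (c, b) r)"
        using ux(3) by (simp add: in_keys_iff lookup_minus)
      then have "x = t" by (auto simp: term_at_def split: if_splits)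
      then show False using w(2) ux(1) u t' tc(1) by (simp add: step_def)
    qed
    then have "length x + weight r < length t + weight (c, b)" by (rule belowD[OF below])
    then show "length w + weight r < E" using ux(1) u tc(1) by (simp add: E_def weight_def)
  qed
  from diff_map_surj[OF Q img this] obtain y where y: "y \<in> carrier (free_mod (idx B (Suc k)))" "below E y"
    "diff_map k B Q y = diff_map k B Q (word_at t' (c', b))" by blast
  \<comment> \<open>This is \<open>- y\<close>, written as a multiple so that the laws for
    \<open>diff_map\<close> apply.\<close>
  define y' where "y' s = nf (single [] (- 1) * y s)" for s
  have minus: "single [] (- 1) * p = - p" for p :: "'x list \<Rightarrow>\<^sub>0 'k"
    by (metis mult_minus1 poly_one single_uminus)
  have nfy: "nf (y s) = y s" for s by (rule free_mod_nf[OF y(1)])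
  have y'_eq: "y' s = - y s" for s using nfy by (simp add: y'_def minus nf_uminus)
  have y': "y' \<in> carrier (free_mod (idx B (Suc k)))" unfolding y'_def by (rule free_mod_mult_closed[OF y(1)])
  have "diff_map k B Q y' = (\<lambda>s. nf (single [] (- 1) * diff_map k B Q y s))"
    unfolding y'_def by (rule diff_map_mult[OF Q y(1)])
  then have dy': "diff_map k B Q y' = (\<lambda>s. - diff_map k B Q (word_at t' (c', b)) s)"
    by (simp add: minus nf_uminus y(3) diff_map_term_at[OF Q s])
  define g where "g r = word_at t' (c', b) r + y' r" for r
  have "g \<in> next_syzygy k B Q"
    unfolding next_syzygy_def g_def
    using free_mod_add_closed[OF e y'] diff_map_add[OF Q e y'] by (simp add: dy')
  moreover have "below E (\<lambda>r. g r - word_at t' (c', b) r)"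
    using y(2) by (simp add: g_def y'_eq below_def)
  ultimately show "\<exists>g\<in>next_syzygy k B Q. below (length t' + weight (c', b)) (\<lambda>s. g s - word_at t' (c', b) s)"
    unfolding E_def by blast
qed

text \<open>Identifies the free module on \<open>B\<close> with the zeroth term, whose indices carry
  the empty chain.\<close>

definition push :: "('m \<Rightarrow> ('x, 'k) ncpoly) \<Rightarrow> 'x list list \<times> 'm \<Rightarrow> ('x, 'k) ncpoly" where
  "push g s = (if fst s = [] then g (snd s) else 0)"

lemma push_simps [simp]: "push g ([], b) = g b" "push g (t # c, b) = 0"
  by (simp_all add: push_def)

lemma idx_0: "idx B 0 = Pair [] ` B"
  by (auto simp: idx_def)

lemma supp_push:
  fixes g :: "'m \<Rightarrow> ('x, 'k) ncpoly"
  shows "supp (push g) = Pair [] ` supp g"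
proof (rule Set.set_eqI)
  fix s :: "'x list list \<times> 'm"
  obtain c b where s: "s = (c, b)" by (cases s)
  show "s \<in> supp (push g) \<longleftrightarrow> s \<in> Pair [] ` supp g" by (cases c) (auto simp: supp_def s)
qed

lemma push_closed:
  assumes "g \<in> carrier (free_mod B)"
  shows "push g \<in> carrier (free_mod (idx B 0))"
proof -
  have "nf (push g s) = push g s" for s
    using assms by (cases s; cases "fst s") (simp_all add: push_def free_mod_carrier)
  moreover have "finite (supp g)" "supp g \<subseteq> B" using assms by (simp_all add: free_mod_carrier)
  ultimately show ?thesis unfolding free_mod_carrier[of "push g"] supp_push idx_0 by blast
qed

lemma push_hom: "push \<in> left_module_hom A (free_mod B) (free_mod (idx B 0))"
  by (rule left_module_homI) (auto simp: push_closed fun_eq_iff push_def)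

lemma push_term_at:
  fixes b :: 'm
  shows "push (term_at p b) = term_at p ([], b)"
proof
  fix s :: "'x list list \<times> 'm"
  obtain c b' where s: "s = (c, b')" by (cases s)
  show "push (term_at p b) s = term_at p ([], b) s" by (cases c) (auto simp: s term_at_def)
qed

definition augmentation :: "(('x, 'k) ncpoly set, 'm) module \<Rightarrow>
    ('x list list \<times> 'm \<Rightarrow> ('x, 'k) ncpoly) \<Rightarrow> 'm" where
  "augmentation M = lin M snd"

lemma augmentation_hom:
  assumes M: "left_module A M" and B: "B \<subseteq> carrier M"
  shows "augmentation M \<in> left_module_hom A (free_mod (idx B 0)) M"
  unfolding augmentation_def using B by (intro lin_hom M) (auto simp: idx_def)

lemma augmentation_push:
  assumes M: "left_module A M" and B: "B \<subseteq> carrier M" and g: "g \<in> carrier (free_mod B)"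
  shows "augmentation M (push g) = lin M (\<lambda>b. b) g"
proof (rule free_hom_eqI[OF M left_module_hom_comp[OF push_hom augmentation_hom[OF M B]] _ _ g])
  show "lin M (\<lambda>b. b) \<in> left_module_hom A (free_mod B) M" using B by (intro lin_hom M) auto
  fix b assume "b \<in> B"
  then have b: "b \<in> carrier M" using B by blast
  show "augmentation M (push (term_at 1 b)) = lin M (\<lambda>b. b) (term_at 1 b)"
    unfolding push_term_at augmentation_def using b by (simp add: lin_term_at[OF M])
qed

lemma augmentation_comb:
  assumes M: "left_module A M" and B: "B \<subseteq> carrier M" and c: "finite (supp c)" "supp c \<subseteq> B"
  shows "augmentation M (push (\<lambda>b. single [] (c b))) = comb M c"
  unfolding comb_def by (rule augmentation_push[OF M B const_closed[OF c]])

definition first_syzygy where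
  "first_syzygy M B = {f \<in> carrier (free_mod (idx B 0)). augmentation M f = \<zero>\<^bsub>M\<^esub>}"

text \<open>The empty chain kills all words but the empty one. If the empty word had top degree, all
  coefficients of \<open>f\<close> would be constants, and \<open>f\<close> would be a nontrivial
  linear relation over \<open>K\<close> among elements of the basis \<open>B\<close>.\<close>

lemma first_syzygy_killed:
  fixes f :: "'x list list \<times> 'm \<Rightarrow> ('x, 'k) ncpoly"
  assumes M: "left_module A M" and B: "scalar_basis M B"
    and f: "f \<in> first_syzygy M B" and D: "below (Suc D) f"
    and a: "a \<in> keys (f (c, b))" "length a + weight (c, b) = D"
  shows "killed c a"
proof -
  have BM: "B \<subseteq> carrier M" using B by (simp add: scalar_basis_def)
  have fc: "f \<in> carrier (free_mod (idx B 0))" "augmentation M f = \<zero>\<^bsub>M\<^esub>"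
    using f by (simp_all add: first_syzygy_def)
  have supp: "finite (supp f)" "supp f \<subseteq> idx B 0" using fc by (simp_all add: free_mod_carrier)
  have "(c, b) \<in> supp f" using a(1) by (auto simp: supp_def)
  then have c: "c = []" using supp(2) by (auto simp: idx_def)
  have "a \<noteq> []"
  proof
    assume "a = []"
    then have "D = 0" using a(2) c by (simp add: weight_def)
    have keys: "keys (f s) \<subseteq> {[]}" for s
      using belowD[OF D] \<open>D = 0\<close> by fastforce
    define c' where "c' b = lookup (f ([], b)) []" for b
    have f_eq: "f ([], b) = single [] (c' b)" for b
    proof (rule poly_mapping_eqI)
      fix w show "lookup (f ([], b)) w = lookup (single [] (c' b)) w"
        using keys[of "([], b)"] by (cases "w = []") (auto simp: c'_def lookup_single in_keys_iff)
    qed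
    have "f = push (\<lambda>b. single [] (c' b))"
    proof
      fix s :: "'x list list \<times> 'm"
      obtain d b where s: "s = (d, b)" by (cases s)
      show "f s = push (\<lambda>b. single [] (c' b)) s"
      proof (cases d)
        case Nil
        then show ?thesis by (simp add: s f_eq)
      next
        case (Cons t d')
        then have "s \<notin> supp f" using supp(2) s by (auto simp: idx_def)
        then show ?thesis using Cons s by (simp add: not_in_supp)
      qed
    qed
    note f_push = this
    have "supp f = Pair [] ` supp c'" by (subst f_push) (simp add: supp_push supp_single)
    then have c': "finite (supp c')" "supp c' \<subseteq> B"
      using supp finite_imageD[of "Pair []" "supp c'"] by (auto simp: idx_0 inj_on_def)
    have "comb M c' = \<zero>\<^bsub>M\<^esub>" using augmentation_comb[OF M BM c'] fc(2) f_push by simp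
    then have "supp c' = {}" using B c' by (simp add: scalar_basis_def)
    then show False using \<open>supp f = Pair [] ` supp c'\<close> \<open>(c, b) \<in> supp f\<close> by simp
  qed
  then show ?thesis using c by simp
qed

lemma free_mod_diff_closed:
  assumes "f \<in> carrier (free_mod S)" "g \<in> carrier (free_mod S)"
  shows "(\<lambda>s. f s - g s) \<in> carrier (free_mod S)"
  using free_mod_add_closed[OF assms(1) free_mod_uminus_closed[OF assms(2)]] by simp

lemma hom_diff_eq_zero:
  assumes M: "left_module A M" and h: "h \<in> left_module_hom A (free_mod S) M"
    and f: "f \<in> carrier (free_mod S)" and g: "g \<in> carrier (free_mod S)" and eq: "h f = h g"
  shows "h (\<lambda>s. f s - g s) = \<zero>\<^bsub>M\<^esub>"
proof -
  interpret module_hom A "free_mod S" M h by (intro module_homI left_module_free_mod M h)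
  have d: "(\<lambda>s. f s - g s) \<in> carrier (free_mod S)" by (rule free_mod_diff_closed[OF f g])
  have "h f = h (\<lambda>s. f s - g s) \<oplus>\<^bsub>M\<^esub> h g" using hom_add[OF d g] by simp
  then show ?thesis using eq hom_closed[OF d] hom_closed[OF g] by (simp add: N.M.add.r_cancel_one)
qed

lemma syzygy_first:
  fixes B :: "'m set"
  assumes M: "left_module A M" and B: "scalar_basis M B"
  shows "syzygy 0 B (first_syzygy M B)"
proof -
  have BM: "B \<subseteq> carrier M" using B by (simp add: scalar_basis_def)
  interpret module_hom A "free_mod (idx B 0)" M "augmentation M"
    by (intro module_homI left_module_free_mod M augmentation_hom BM)
  show ?thesis unfolding syzygy_def
  proof (intro conjI ballI allI impI)
    show "first_syzygy M B \<subseteq> carrier (free_mod (idx B 0))" by (auto simp: first_syzygy_def)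
    show "(\<lambda>_. 0) \<in> first_syzygy M B"
      using hom_zero M.zero_closed by (simp add: first_syzygy_def)
  next
    fix f g assume "f \<in> first_syzygy M B" "g \<in> first_syzygy M B"
    then show "(\<lambda>s. f s + g s) \<in> first_syzygy M B"
      using hom_add[of f g] free_mod_add_closed[of f _ g] by (simp add: first_syzygy_def)
  next
    fix f p assume f: "f \<in> first_syzygy M B"
    then have "augmentation M (res p \<odot>\<^bsub>free_mod (idx B 0)\<^esub> f) = res p \<odot>\<^bsub>M\<^esub> \<zero>\<^bsub>M\<^esub>"
      using hom_smult[of "res p" f] by (simp add: first_syzygy_def del: free_mod_simps)
    also have "\<dots> = \<zero>\<^bsub>M\<^esub>" by (rule N.smult_zero_right) simp
    finally show "(\<lambda>s. nf (p * f s)) \<in> first_syzygy M B"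
      using f by (simp add: first_syzygy_def free_mod_mult_closed nf_mult_nf)
  next
    fix f D c b a
    assume "f \<in> first_syzygy M B" "below (Suc D) f" "a \<in> keys (f (c, b))"
      "length a + weight (c, b) = D"
    then show "killed c a" by (rule first_syzygy_killed[OF M B])
  next
    fix c b t assume cb: "(c, b) \<in> idx B 0" and t: "step c t"
    then have c: "c = []" and b: "b \<in> B" by (auto simp: idx_def)
    then obtain x where x: "t = [x]" using t by (auto simp: step_Nil)
    have w: "word_at t ([], b) \<in> carrier (free_mod (idx B 0))"
      using b x by (intro term_at_closed) (auto simp: nf_single idx_def)
    then have "augmentation M (word_at t ([], b)) \<in> carrier M" by simp
    \<comment> \<open>Expanding the product of the letter \<open>x\<close> with \<open>b\<close> in
      the basis over \<open>K\<close> gives the cycle: \<open>x\<close> at \<open>b\<close> minus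
      constants. The constants have degree 0, below the degree 1 of \<open>x\<close>.\<close>
    then obtain c' where c': "finite (supp c')" "supp c' \<subseteq> B" "comb M c' = augmentation M (word_at t ([], b))"
      using B by (auto simp: scalar_basis_def)
    let ?p = "push (\<lambda>b. single [] (c' b)) :: 'x list list \<times> 'm \<Rightarrow> ('x, 'k) ncpoly"
    have p: "?p \<in> carrier (free_mod (idx B 0))" by (rule push_closed[OF const_closed[OF c'(1,2)]])
    have "augmentation M (word_at t ([], b)) = augmentation M ?p"
      using augmentation_comb[OF M BM c'(1,2)] c'(3) by simp
    then have "(\<lambda>s. word_at t ([], b) s - ?p s) \<in> first_syzygy M B"
      using hom_diff_eq_zero[OF M hom w p] free_mod_diff_closed[OF w p] by (simp add: first_syzygy_def)
    moreover have "below (length t + weight (c, b)) (\<lambda>s. (word_at t ([], b) s - ?p s) - word_at t (c, b) s)"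
      unfolding below_def
    proof (intro allI ballI)
      fix s a assume a: "a \<in> keys ((word_at t ([], b) s - ?p s) - word_at t (c, b) s)"
      then have "a \<in> keys (?p s)" by (simp add: c in_keys_iff lookup_minus)
      then have "fst s = [] \<and> a = []" by (auto simp: push_def split: if_splits)
      then show "length a + weight s < length t + weight (c, b)" using x by (simp add: weight_def)
    qed
    ultimately show "\<exists>g\<in>first_syzygy M B. below (length t + weight (c, b)) (\<lambda>s. g s - word_at t (c, b) s)"
      by (intro bexI[of _ "\<lambda>s. word_at t ([], b) s - ?p s"])
  qed
qed

primrec nth_syzygy where
  "nth_syzygy M B 0 = first_syzygy M B"
| "nth_syzygy M B (Suc k) = next_syzygy k B (nth_syzygy M B k)"

lemma syzygy_nth:
  assumes "left_module A M" "scalar_basis M B"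
  shows "syzygy k B (nth_syzygy M B k)"
  by (induction k) (simp_all add: syzygy_first[OF assms] syzygy_next)

end

subsection \<open>The resolution inside the universe\<close>

text \<open>Iterated pairing compresses a list to one element, and the recorded length separates
  lists of different lengths. It is applied to the universe, which is infinite.\<close>

lemma inj_list_encoding:
  assumes "infinite (UNIV :: 'a set)"
  shows "\<exists>g :: 'a list \<Rightarrow> 'a. inj g"
proof -
  have "(card_of (UNIV \<times> UNIV :: ('a \<times> 'a) set), card_of (UNIV :: 'a set)) \<in> ordLeq"
    using card_of_Times_same_infinite[OF assms] ordIso_iff_ordLeq by blast
  then obtain p :: "'a \<times> 'a \<Rightarrow> 'a" where p: "inj p" using card_of_ordLeq[of "UNIV \<times> UNIV" UNIV] by auto
  have "(card_of (UNIV :: nat set), card_of (UNIV :: 'a set)) \<in> ordLeq" using assms infinite_iff_card_of_nat by blast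
  then obtain n :: "nat \<Rightarrow> 'a" where n: "inj n" using card_of_ordLeq[of UNIV UNIV] by auto
  define f where "f xs = foldr (\<lambda>x y. p (x, y)) xs (n 0)" for xs
  have f_inj: "xs = ys" if "length xs = length ys" "f xs = f ys" for xs ys
    using that by (induction xs ys rule: list_induct2) (auto simp: f_def dest: injD[OF p])
  have "inj (\<lambda>xs. p (n (length xs), f xs))"
  proof (rule injI)
    fix xs ys assume "p (n (length xs), f xs) = p (n (length ys), f ys)"
    then have "n (length xs) = n (length ys)" "f xs = f ys" by (auto dest: injD[OF p])
    then show "xs = ys" using f_inj injD[OF n] by blast
  qed
  then show ?thesis by blast
qed

text \<open>A finitely supported function is coded by a list of its nonzero values with their
  indices. Chains are countable and enter through \<open>nat\<close>, and a polynomial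
  \<open>p\<close> enters through the summand of ring elements as the set
  \<open>{p}\<close>.\<close>

lemma universe_encoding:
  "\<exists>e :: (('x::{finite,linorder} list list \<times> (('x, 'k::field) ncpoly set, 'u) universe) \<Rightarrow> ('x, 'k) ncpoly) \<Rightarrow>
      (('x, 'k) ncpoly set, 'u) universe. inj_on e {f. finite (supp f)}"
proof -
  let ?U = "UNIV :: (('x, 'k) ncpoly set, 'u) universe set"
  have "infinite (range (Inl :: nat \<Rightarrow> (('x, 'k) ncpoly set, 'u) universe))"
    by (simp add: finite_image_iff)
  then have "infinite ?U" using finite_subset subset_UNIV by blast
  then obtain g :: "(('x, 'k) ncpoly set, 'u) universe list \<Rightarrow> (('x, 'k) ncpoly set, 'u) universe" where g: "inj g"
    using inj_list_encoding by blast
  define q :: "('x list list \<times> (('x, 'k) ncpoly set, 'u) universe) \<Rightarrow> ('x, 'k) ncpoly \<Rightarrow> (('x, 'k) ncpoly set, 'u) universe"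
    where "q s p = g [Inl (to_nat (fst s)), snd s, Inr (Inl {p})]" for s p
  have q_eq: "s = s' \<and> p = p'" if "q s p = q s' p'" for s s' p p'
  proof -
    have "[Inl (to_nat (fst s)), snd s, Inr (Inl {p})] = [Inl (to_nat (fst s')), snd s', Inr (Inl {p'})]"
      using that unfolding q_def by (rule injD[OF g])
    then show ?thesis by (auto simp: prod_eq_iff)
  qed
  define ls where "ls f = (SOME xs. set xs = supp f)"
    for f :: "('x list list \<times> (('x, 'k) ncpoly set, 'u) universe) \<Rightarrow> ('x, 'k) ncpoly"
  have ls: "set (ls f) = supp f" if "finite (supp f)" for f
    unfolding ls_def by (rule someI_ex) (rule finite_list[OF that])
  have "inj_on (\<lambda>f. g (map (\<lambda>s. q s (f s)) (ls f))) {f. finite (supp f)}"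
  proof (rule inj_onI)
    fix f f' assume fin: "f \<in> {f. finite (supp f)}" "f' \<in> {f. finite (supp f)}"
      and "g (map (\<lambda>s. q s (f s)) (ls f)) = g (map (\<lambda>s. q s (f' s)) (ls f'))"
    then have "map (\<lambda>s. q s (f s)) (ls f) = map (\<lambda>s. q s (f' s)) (ls f')" by (intro injD[OF g])
    then have "set (map (\<lambda>s. q s (f s)) (ls f)) = set (map (\<lambda>s. q s (f' s)) (ls f'))" by simp
    then have img: "(\<lambda>s. q s (f s)) ` supp f = (\<lambda>s. q s (f' s)) ` supp f'" using fin ls by simp
    have sub: "h s = h' s" if "(\<lambda>s. q s (h s)) ` supp h = (\<lambda>s. q s (h' s)) ` supp h'" "s \<in> supp h" for h h' s
    proof -
      have "q s (h s) \<in> (\<lambda>s. q s (h' s)) ` supp h'" using that by blast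
      then obtain s' where "q s (h s) = q s' (h' s')" by blast
      then show ?thesis using q_eq by blast
    qed
    show "f = f'"
    proof
      fix s show "f s = f' s"
        using sub[OF img, of s] sub[OF img[symmetric], of s] not_in_supp[of s f] not_in_supp[of s f'] by metis
    qed
  qed
  then show ?thesis by blast
qed

locale chain_resolution = lyndon_quotient W I A
  for W :: "'x::{finite,linorder} list set" and I :: "('x, 'k::field) ncpoly set"
    and A :: "('x, 'k) ncpoly set ring" +
  fixes M :: "(('x, 'k) ncpoly set, (('x, 'k) ncpoly set, 'u) universe) module"
    and B :: "(('x, 'k) ncpoly set, 'u) universe set"
    and e :: "(('x list list \<times> (('x, 'k) ncpoly set, 'u) universe) \<Rightarrow> ('x, 'k) ncpoly) \<Rightarrow>
      (('x, 'k) ncpoly set, 'u) universe"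
  assumes M: "left_module A M" and B: "scalar_basis M B" and e_inj: "inj_on e {f. finite (supp f)}"
begin

abbreviation "F i \<equiv> free_mod (idx B i)"
abbreviation "Q i \<equiv> nth_syzygy M B i"

lemma B_subset: "B \<subseteq> carrier M"
  using B by (simp add: scalar_basis_def)

lemma Q: "syzygy i B (Q i)"
  by (rule syzygy_nth[OF M B])

lemma inj_F: "inj_on e (carrier (F i))"
  by (rule inj_on_subset[OF e_inj]) (auto simp: free_mod_carrier)

definition "P i = transport e (F i)"

definition "decode i = inv_into (carrier (F i)) e"

definition d where
  "d i = (case i of 0 \<Rightarrow> (\<lambda>x. augmentation M (decode 0 x)) | Suc k \<Rightarrow> (\<lambda>x. e (diff_map k B (Q k) (decode (Suc k) x))))"

lemma decode [simp]: "y \<in> carrier (F i) \<Longrightarrow> decode i (e y) = y"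
  by (simp add: decode_def inj_F)

lemma carrier_P: "carrier (P i) = e ` carrier (F i)"
  by (simp add: P_def)

lemma decode_hom: "decode i \<in> left_module_hom A (P i) (F i)"
  unfolding decode_def P_def by (rule transport_inv_hom[OF left_module_free_mod inj_F])

lemma e_hom: "e \<in> left_module_hom A (F i) (P i)"
  unfolding P_def by (rule transport_hom[OF inj_F])

lemma zero_P: "\<zero>\<^bsub>P i\<^esub> = e (\<lambda>_. 0)"
  by (simp add: P_def)

lemma zero_F: "(\<lambda>_. 0) \<in> carrier (F i)"
  by (simp add: free_mod_carrier supp_def)

lemma d_0: "y \<in> carrier (F 0) \<Longrightarrow> d 0 (e y) = augmentation M y"
  by (simp add: d_def)

lemma d_Suc: "y \<in> carrier (F (Suc k)) \<Longrightarrow> d (Suc k) (e y) = e (diff_map k B (Q k) y)"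
  by (simp add: d_def)

lemma diff_map_closed:
  assumes "y \<in> carrier (F (Suc k))"
  shows "diff_map k B (Q k) y \<in> carrier (F k)"
  using diff_map_hom[OF Q, of k] assms by (auto simp: left_module_hom_def)

lemma range_d_Suc: "d (Suc k) ` carrier (P (Suc k)) = e ` Q k"
proof -
  have "d (Suc k) ` carrier (P (Suc k)) = e ` (diff_map k B (Q k) ` carrier (F (Suc k)))"
    unfolding carrier_P image_image by (rule image_cong[OF refl]) (rule d_Suc)
  then show ?thesis by (simp add: diff_map_range[OF Q])
qed

lemma augmentation_surj: "augmentation M ` carrier (F 0) = carrier M"
proof
  show "augmentation M ` carrier (F 0) \<subseteq> carrier M"
    using augmentation_hom[OF M B_subset] by (auto simp: left_module_hom_def)
  show "carrier M \<subseteq> augmentation M ` carrier (F 0)"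
  proof
    fix m assume "m \<in> carrier M"
    then obtain c where c: "finite (supp c)" "supp c \<subseteq> B" "comb M c = m"
      using B unfolding scalar_basis_def by blast
    have "push (\<lambda>b. single [] (c b)) \<in> carrier (F 0)"
      by (rule push_closed[OF const_closed[OF c(1,2)]])
    then show "m \<in> augmentation M ` carrier (F 0)"
      using augmentation_comb[OF M B_subset c(1,2)] c(3) by (intro image_eqI) simp_all
  qed
qed

lemma projective_resolution_P: "projective_resolution A M P d"
  unfolding projective_resolution_def
proof (intro conjI allI)
  show "projective_module A (P i)" for i
    unfolding P_def by (rule projective_transport_free_mod[OF inj_F])
  have "(\<lambda>x. augmentation M (decode 0 x)) \<in> left_module_hom A (P 0) M"
    by (rule left_module_hom_comp[OF decode_hom augmentation_hom[OF M B_subset]])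
  then show "d 0 \<in> left_module_hom A (P 0) M" by (simp add: d_def)
  have "d 0 ` carrier (P 0) = augmentation M ` carrier (F 0)"
    unfolding carrier_P image_image by (rule image_cong[OF refl]) (rule d_0)
  then show "d 0 ` carrier (P 0) = carrier M" using augmentation_surj by simp
  show "d (Suc i) \<in> left_module_hom A (P (Suc i)) (P i)" for i
  proof -
    have "(\<lambda>x. e (diff_map i B (Q i) (decode (Suc i) x))) \<in> left_module_hom A (P (Suc i)) (P i)"
      by (rule left_module_hom_comp[OF left_module_hom_comp[OF decode_hom diff_map_hom[OF Q]] e_hom])
    then show ?thesis by (simp add: d_def)
  qed
  have "{x \<in> carrier (P 0). d 0 x = \<zero>\<^bsub>M\<^esub>} = e ` Q 0"
    by (auto simp: carrier_P d_0 first_syzygy_def)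
  then show "d (Suc 0) ` carrier (P (Suc 0)) = {x \<in> carrier (P 0). d 0 x = \<zero>\<^bsub>M\<^esub>}"
    using range_d_Suc[of 0] by simp
  show "d (Suc (Suc i)) ` carrier (P (Suc (Suc i))) = {x \<in> carrier (P (Suc i)). d (Suc i) x = \<zero>\<^bsub>P i\<^esub>}" for i
  proof -
    have "e (diff_map i B (Q i) y) = e (\<lambda>_. 0) \<longleftrightarrow> diff_map i B (Q i) y = (\<lambda>_. 0)"
      if "y \<in> carrier (F (Suc i))" for y
      using inj_on_eq_iff[OF inj_F diff_map_closed[OF that] zero_F] .
    then have "{x \<in> carrier (P (Suc i)). d (Suc i) x = \<zero>\<^bsub>P i\<^esub>} = e ` Q (Suc i)"
      by (auto simp: carrier_P zero_P d_Suc next_syzygy_def)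
    then show ?thesis using range_d_Suc[of "Suc i"] by simp
  qed
qed

lemma carrier_P_trivial:
  assumes "\<And>c. chain c \<Longrightarrow> length c \<le> n" "n < i"
  shows "carrier (P i) = {\<zero>\<^bsub>P i\<^esub>}"
proof -
  have "idx B i = {}" using assms by (fastforce simp: idx_def)
  then have "carrier (F i) = {\<lambda>_. 0}" by (auto simp: free_mod_carrier supp_def)
  then show ?thesis by (simp add: carrier_P zero_P)
qed

end

context lyndon_quotient
begin

lemma projective_dimension_le:
  fixes M :: "(('x, 'k) ncpoly set, (('x, 'k) ncpoly set, 'u) universe) module"
  assumes M: "left_module A M" and n: "\<And>c. chain c \<Longrightarrow> length c \<le> n"
  shows "projective_dimension A M \<le> enat n"
proof -
  obtain B where B: "scalar_basis M B" using scalar_basis_exists[OF M] by blast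
  obtain e :: "(('x list list \<times> (('x, 'k) ncpoly set, 'u) universe) \<Rightarrow> ('x, 'k) ncpoly) \<Rightarrow>
      (('x, 'k) ncpoly set, 'u) universe" where e: "inj_on e {f. finite (supp f)}"
    using universe_encoding by blast
  interpret chain_resolution W I A M B e
    by (intro chain_resolution.intro chain_resolution_axioms.intro lyndon_quotient_axioms M B e)
  have "\<forall>i>n. carrier (P i) = {\<zero>\<^bsub>P i\<^esub>}" using carrier_P_trivial[OF n] by blast
  then show ?thesis
    unfolding projective_dimension_def using projective_resolution_P by (intro Inf_lower) blast
qed

lemma global_dimension_le:
  assumes "\<And>c. chain c \<Longrightarrow> length c \<le> n"
  shows "global_dimension TYPE('u) A \<le> enat n"
  unfolding global_dimension_def using projective_dimension_le[OF _ assms] by (intro Sup_least) blast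

end

subsection \<open>The trivial module\<close>

context chain_resolution
begin

text \<open>At the start, nonempty words act as zero. Inductively the generators are bare monomials;
  the differential then turns \<open>t\<close> at the chain \<open>u # c0\<close> into
  \<open>t @ u\<close> at \<open>c0\<close>, which is zero because the chain kills
  \<open>t\<close>.\<close>

lemma word_at_in_Q:
  assumes triv: "\<And>p b. b \<in> B \<Longrightarrow> lookup p [] = 0 \<Longrightarrow> res p \<odot>\<^bsub>M\<^esub> b = \<zero>\<^bsub>M\<^esub>"
  shows "(c, b) \<in> idx B k \<Longrightarrow> step c t \<Longrightarrow> word_at t (c, b) \<in> Q k"
proof (induction k arbitrary: c t)
  case 0
  then have c: "c = []" and b: "b \<in> B" by (auto simp: idx_def)
  have t: "t \<noteq> []" "t \<in> NW" using 0(2) by (simp_all add: step_def)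
  have "b \<in> carrier M" using b B_subset by blast
  then have "augmentation M (word_at t (c, b)) = res (single t 1) \<odot>\<^bsub>M\<^esub> b"
    unfolding augmentation_def by (simp add: lin_term_at[OF M])
  also have "\<dots> = \<zero>\<^bsub>M\<^esub>" using t by (intro triv[OF b]) (simp add: lookup_single)
  finally have "augmentation M (word_at t (c, b)) = \<zero>\<^bsub>M\<^esub>" .
  moreover have "word_at t (c, b) \<in> carrier (F 0)"
    using t 0(1) by (intro term_at_closed) (simp_all add: nf_single)
  ultimately show ?case by (simp add: first_syzygy_def)
next
  case (Suc k)
  obtain u c0 where uc: "c = u # c0" "(c0, b) \<in> idx B k" "step c0 u"
    using Suc.prems(1) by (auto elim: idx_Suc_cases)
  have t: "t \<in> NW" "t @ u \<notin> NW" using Suc.prems(2) uc(1) by (simp_all add: step_def)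
  have "word_at u (c0, b) \<in> Q k" using Suc.IH uc by blast
  then have gens: "gens (Q k) (c, b) = word_at u (c0, b)" by (simp add: gens_def uc(1))
  have "diff_map k B (Q k) (word_at t (c, b)) r = 0" for r
    unfolding diff_map_term_at[OF Q Suc.prems(1)] gens
    using t by (simp add: term_at_def single_word_mult nf_single)
  moreover have "word_at t (c, b) \<in> carrier (F (Suc k))"
    using t Suc.prems(1) by (intro term_at_closed) (simp_all add: nf_single)
  ultimately show ?case by (simp add: next_syzygy_def fun_eq_iff)
qed

text \<open>
  For a trivial module the chain resolution is minimal: the boundaries have no constant terms,
  so the identity of a nonzero term is not null-homotopic.
\<close>

lemma no_shorter_resolution:
  assumes triv: "\<And>p b. b \<in> B \<Longrightarrow> lookup p [] = 0 \<Longrightarrow> res p \<odot>\<^bsub>M\<^esub> b = \<zero>\<^bsub>M\<^esub>"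
    and c: "chain c" "length c = Suc n" and b: "b \<in> B"
    and P': "projective_resolution A M P' d'" "carrier (P' (Suc n)) = {\<zero>\<^bsub>P' (Suc n)\<^esub>}"
  shows False
proof -
  interpret P': resolution A M P' d' by (intro resolution.intro M P')
  interpret P: resolution A M P d by (intro resolution.intro M projective_resolution_P)
  obtain h h' where h: "h \<in> left_module_hom A (P (Suc n)) (P (Suc (Suc n)))"
    and h': "h' \<in> left_module_hom A (P n) (P (Suc n))"
    and homotopy: "\<And>x. x \<in> carrier (P (Suc n)) \<Longrightarrow>
      x = d (Suc (Suc n)) (h x) \<oplus>\<^bsub>P (Suc n)\<^esub> h' (d (Suc n) x)"
    using null_homotopy_beyond[OF P'.resolution_axioms P.resolution_axioms P'(2)] by blast
  obtain t c0 where tc: "c = t # c0" using c(2) by (cases c) auto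
  have s: "(c, b) \<in> idx B (Suc n)" and s0: "(c0, b) \<in> idx B n" and t: "step c0 t"
    using c b tc by (auto simp: idx_def)
  have gens_const: "lookup (gens (Q k) r s) [] = 0" if r: "r \<in> idx B (Suc k)" for k r s
  proof -
    obtain t' c' b' where r': "r = (t' # c', b')" "(c', b') \<in> idx B k" "step c' t'"
      using r by (rule idx_Suc_cases)
    have "t' \<noteq> []" using r'(3) by (simp add: step_def)
    then show ?thesis using word_at_in_Q[OF triv r'(2,3)] r'(1)
      by (simp add: gens_def term_at_def lookup_single when_def)
  qed
  \<comment> \<open>The homotopy is evaluated at this basis element. Its own constant coefficient is
    1, whereas both summands have none: \<open>u\<close> is a boundary, and the second is a multiple
    of the nonempty word \<open>t\<close>.\<close>
  let ?y = "term_at 1 (c, b)"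
  have y: "?y \<in> carrier (F (Suc n))" and y0: "term_at 1 (c0, b) \<in> carrier (F n)"
    using s s0 by (simp_all add: term_at_closed)
  have ey: "e ?y \<in> carrier (P (Suc n))" using y by (simp add: carrier_P)
  have "h (e ?y) \<in> carrier (P (Suc (Suc n)))" using h ey by (auto simp: left_module_hom_def)
  then obtain z where z: "z \<in> carrier (F (Suc (Suc n)))" "h (e ?y) = e z" by (auto simp: carrier_P)
  define u where "u = diff_map (Suc n) B (Q (Suc n)) z"
  have u: "u \<in> carrier (F (Suc n))" unfolding u_def by (rule diff_map_closed[OF z(1)])
  have u_const: "lookup (u r) [] = 0" for r
  proof -
    have supp: "supp z \<subseteq> idx B (Suc (Suc n))" using z(1) by (simp add: free_mod_carrier)
    have "lookup (nf (z s * gens (Q (Suc n)) s r)) [] = 0" if "s \<in> supp z" for s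
    proof -
      have "s \<in> idx B (Suc (Suc n))" using that supp by blast
      then show ?thesis by (simp only: lookup_nf lookup_mult_Nil gens_const) simp
    qed
    then show ?thesis unfolding u_def diff_map_eq[OF Q z(1)] lookup_sum by simp
  qed
  have "h' (e (term_at 1 (c0, b))) \<in> carrier (P (Suc n))"
    using h' y0 by (auto simp: left_module_hom_def carrier_P)
  then obtain v where v: "v \<in> carrier (F (Suc n))" "h' (e (term_at 1 (c0, b))) = e v" by (auto simp: carrier_P)
  let ?a = "res (single t 1)"
  have "gens (Q n) (c, b) = word_at t (c0, b)" using word_at_in_Q[OF triv s0 t] by (simp add: gens_def tc)
  then have "diff_map n B (Q n) ?y = ?a \<odot>\<^bsub>F n\<^esub> term_at 1 (c0, b)"
    by (intro ext) (unfold diff_map_term_at[OF Q s], simp add: term_at_def nf_mult_nf)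
  then have "d (Suc n) (e ?y) = ?a \<odot>\<^bsub>P n\<^esub> e (term_at 1 (c0, b))"
    using e_hom[of n] y0 by (simp add: d_Suc[OF y] left_module_hom_def del: free_mod_simps)
  then have "h' (d (Suc n) (e ?y)) = ?a \<odot>\<^bsub>P (Suc n)\<^esub> h' (e (term_at 1 (c0, b)))"
    using h' y0 by (simp add: left_module_hom_def carrier_P)
  also have "\<dots> = ?a \<odot>\<^bsub>P (Suc n)\<^esub> e v" by (simp only: v(2))
  also have "\<dots> = e (?a \<odot>\<^bsub>F (Suc n)\<^esub> v)"
    using e_hom[of "Suc n"] v(1) by (simp add: left_module_hom_def del: free_mod_simps)
  finally have hd: "h' (d (Suc n) (e ?y)) = e (?a \<odot>\<^bsub>F (Suc n)\<^esub> v)" .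
  have av: "?a \<odot>\<^bsub>F (Suc n)\<^esub> v \<in> carrier (F (Suc n))" using v(1) by (simp add: free_mod_mult_closed)
  have "e ?y = e u \<oplus>\<^bsub>P (Suc n)\<^esub> e (?a \<odot>\<^bsub>F (Suc n)\<^esub> v)"
    using homotopy[OF ey] unfolding hd z(2) d_Suc[OF z(1)] u_def .
  also have "\<dots> = e (u \<oplus>\<^bsub>F (Suc n)\<^esub> (?a \<odot>\<^bsub>F (Suc n)\<^esub> v))"
    using e_hom[of "Suc n"] u av by (simp add: left_module_hom_def del: free_mod_simps)
  finally have "?y = u \<oplus>\<^bsub>F (Suc n)\<^esub> (?a \<odot>\<^bsub>F (Suc n)\<^esub> v)"
    using inj_onD[OF inj_F _ y] free_mod_add_closed[OF u av] by simp
  then have "?y (c, b) = (u \<oplus>\<^bsub>F (Suc n)\<^esub> (?a \<odot>\<^bsub>F (Suc n)\<^esub> v)) (c, b)" by (rule arg_cong)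
  then have "(1 :: 'x list \<Rightarrow>\<^sub>0 'k) = u (c, b) + nf (nf (single t 1) * v (c, b))" by simp
  then have "(1 :: 'k) = lookup (u (c, b) + nf (nf (single t 1) * v (c, b))) []"
    by (metis lookup_single_eq poly_one)
  also have "\<dots> = 0"
  proof -
    have "t \<noteq> []" using t by (simp add: step_def)
    then show ?thesis by (simp add: lookup_add u_const lookup_nf lookup_mult_Nil lookup_single)
  qed
  finally show False by simp
qed

end

context lyndon_quotient
begin

text \<open>The field, on which every nonempty word acts as zero.\<close>

definition triv :: "(('x, 'k) ncpoly set, 'k) module" where
  "triv = \<lparr>carrier = UNIV, monoid.mult = (*), one = 1, ring.zero = 0, add = (+),
    module.smult = (\<lambda>a c. lookup (rep a) [] * c)\<rparr>"

lemma triv_simps [simp]: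
  "carrier triv = UNIV" "\<zero>\<^bsub>triv\<^esub> = 0" "x \<oplus>\<^bsub>triv\<^esub> y = x + y"
  "a \<odot>\<^bsub>triv\<^esub> x = lookup (rep a) [] * x"
  by (simp_all add: triv_def)

lemma left_module_triv: "left_module A triv"
proof (rule left_moduleI)
  show "ring A" by (rule ring_A)
  show "\<exists>y\<in>carrier triv. y \<oplus>\<^bsub>triv\<^esub> x = \<zero>\<^bsub>triv\<^esub>" for x by (intro bexI[of _ "- x"]) simp_all
  show "(a \<otimes>\<^bsub>A\<^esub> b) \<odot>\<^bsub>triv\<^esub> x = a \<odot>\<^bsub>triv\<^esub> (b \<odot>\<^bsub>triv\<^esub> x)" if "a \<in> carrier A" "b \<in> carrier A" for a b x
    using that by (simp add: rep_mult lookup_nf Nil_normal lookup_mult_Nil)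
  show "(a \<oplus>\<^bsub>A\<^esub> b) \<odot>\<^bsub>triv\<^esub> x = a \<odot>\<^bsub>triv\<^esub> x \<oplus>\<^bsub>triv\<^esub> b \<odot>\<^bsub>triv\<^esub> x" if "a \<in> carrier A" "b \<in> carrier A" for a b x
    using that by (simp add: rep_add lookup_add distrib_right)
  show "\<one>\<^bsub>A\<^esub> \<odot>\<^bsub>triv\<^esub> x = x" for x by (simp add: poly_one nf_single Nil_normal)
qed (simp_all add: algebra_simps)

text \<open>For the trivial module a chain of length \<open>Suc n\<close> rules out every projective
  resolution whose term in degree \<open>Suc n\<close> vanishes, hence all those of length at most
  \<open>n\<close>.\<close>

lemma global_dimension_ge:
  assumes c: "chain c" "length c = Suc n"
  shows "enat (Suc n) \<le> global_dimension TYPE('u) A"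
proof -
  \<comment> \<open>Scalars enter the universe as singletons of constant polynomials, in the summand
    of ring elements.\<close>
  define \<kappa> :: "'k \<Rightarrow> (('x, 'k) ncpoly set, 'u) universe" where
    "\<kappa> a = Inr (Inl {single [] a})" for a
  have inj: "inj_on \<kappa> (carrier triv)"
    by (rule inj_onI) (metis \<kappa>_def lookup_single_eq singleton_inject sum.inject)
  define M where "M = transport \<kappa> triv"
  have M: "left_module A M" unfolding M_def by (rule left_module_transport[OF left_module_triv inj])
  interpret M: left_module A M by (rule M)
  have M_simps: "carrier M = range \<kappa>" "\<zero>\<^bsub>M\<^esub> = \<kappa> 0" "a \<odot>\<^bsub>M\<^esub> \<kappa> x = \<kappa> (lookup (rep a) [] * x)" for a x
    using inj by (simp_all add: M_def)
  have comb: "comb M f = \<kappa> (f (\<kappa> 1))" if "supp f \<subseteq> {\<kappa> 1}" for f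
  proof -
    have "comb M f = (\<Oplus>\<^bsub>M\<^esub>b\<in>{\<kappa> 1}. res (single [] (f b)) \<odot>\<^bsub>M\<^esub> b)"
      unfolding comb_def using that
      by (intro lin_superset[OF M]) (simp_all add: supp_single M_simps)
    also have "\<dots> = res (single [] (f (\<kappa> 1))) \<odot>\<^bsub>M\<^esub> \<kappa> 1"
      using M.smult_closed[of _ "\<kappa> 1"] by (simp add: M_simps(1))
    also have "\<dots> = \<kappa> (f (\<kappa> 1))" by (simp add: M_simps nf_single Nil_normal)
    finally show ?thesis .
  qed
  have \<kappa>_eq: "\<kappa> x = \<kappa> y \<longleftrightarrow> x = y" for x y using inj by (simp add: inj_on_def) blast
  have B: "scalar_basis M {\<kappa> 1}"
    unfolding scalar_basis_def
  proof (intro conjI ballI allI impI)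
    show "{\<kappa> 1} \<subseteq> carrier M" by (simp add: M_simps)
    fix m assume "m \<in> carrier M"
    then obtain a where a: "m = \<kappa> a" by (auto simp: M_simps)
    have "supp (term_at a (\<kappa> 1)) \<subseteq> {\<kappa> 1}" by (rule supp_term_at)
    moreover from this have "finite (supp (term_at a (\<kappa> 1)))" by (rule finite_subset) simp
    ultimately show "\<exists>c. finite (supp c) \<and> supp c \<subseteq> {\<kappa> 1} \<and> comb M c = m"
      using comb[of "term_at a (\<kappa> 1)"] a by (intro exI[of _ "term_at a (\<kappa> 1)"]) simp
  next
    fix f assume f: "finite (supp f) \<and> supp f \<subseteq> {\<kappa> 1} \<and> comb M f = \<zero>\<^bsub>M\<^esub>"
    then have "f (\<kappa> 1) = 0" using comb[of f] by (simp add: M_simps \<kappa>_eq)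
    then have "\<kappa> 1 \<notin> supp f" by (simp add: not_in_supp)
    then show "supp f = {}" using f by blast
  qed
  obtain e :: "(('x list list \<times> (('x, 'k) ncpoly set, 'u) universe) \<Rightarrow> ('x, 'k) ncpoly) \<Rightarrow>
      (('x, 'k) ncpoly set, 'u) universe" where e: "inj_on e {f. finite (supp f)}"
    using universe_encoding by blast
  interpret R: chain_resolution W I A M "{\<kappa> 1}" e
    by (intro chain_resolution.intro chain_resolution_axioms.intro lyndon_quotient_axioms M B e)
  have triv: "res p \<odot>\<^bsub>M\<^esub> b = \<zero>\<^bsub>M\<^esub>" if "b \<in> {\<kappa> 1}" "lookup p [] = 0" for p b
    using that by (simp add: M_simps lookup_nf)
  have "enat (Suc n) \<le> projective_dimension A M"
    unfolding projective_dimension_def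
  proof (rule Inf_greatest)
    fix k assume "k \<in> {enat m | m. \<exists>P d. projective_resolution A M P d \<and> (\<forall>i>m. carrier (P i) = {\<zero>\<^bsub>P i\<^esub>})}"
    then obtain m P d where m: "k = enat m" "projective_resolution A M P d"
      "\<And>i. i > m \<Longrightarrow> carrier (P i) = {\<zero>\<^bsub>P i\<^esub>}" by blast
    have "\<not> m < Suc n"
      using R.no_shorter_resolution[OF triv c _ m(2) m(3), of "\<kappa> 1"] by blast
    then show "enat (Suc n) \<le> k" using m(1) by simp
  qed
  also have "\<dots> \<le> global_dimension TYPE('u) A"
    unfolding global_dimension_def using M by (intro Sup_upper) blast
  finally show ?thesis .
qed

lemma card_atoms_pos: "finite N \<Longrightarrow> 0 < card N"
  by (metis card_gt_0_iff empty_iff single_atom)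

lemma global_dimension_eq:
  assumes "finite N"
  shows "global_dimension TYPE('u) A = enat (card N)"
proof (rule antisym)
  show "global_dimension TYPE('u) A \<le> enat (card N)"
    by (rule global_dimension_le) (rule chain_length_le_atoms[OF _ assms])
  obtain n where n: "card N = Suc n" using card_atoms_pos[OF assms] by (cases "card N") auto
  obtain c where "chain c" "length c = card N" using top_chain[OF assms] .
  then show "enat (card N) \<le> global_dimension TYPE('u) A"
    using global_dimension_ge[of c n] n by simp
qed

end

theorem theoremB:
  fixes W :: "'x::{finite,linorder} list set"
    and I :: "('x list \<Rightarrow>\<^sub>0 'k::field) set"
    and A :: "('x list \<Rightarrow>\<^sub>0 'k) set ring"
    and N :: "'x list set"
    and wlt :: "('x list \<times> 'x list) set"
  assumes alphabet: "CARD('x) \<ge> 2"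
    and W_nonempty: "W \<noteq> {}"
    and W_lyndon: "\<forall>w\<in>W. lyndon w"
    and W_antichain: "antichain W"
    and W_letters: "W \<inter> range (\<lambda>x. [x]) = {}"
    and I: "I = word_ideal W"
    and A: "A = quotient_algebra I"
    and N: "N = lyndon_atoms W"
    and wlt: "admissible_order wlt"
  shows "(standard_finite_presentation wlt I \<longleftrightarrow> finite W) \<and>
    (\<forall>r m :: nat. finite W \<and> card W = r \<and> m = Max (length ` W) \<longrightarrow>
      global_dimension TYPE('u) A \<le> enat (r + 1) \<and>
      ((polynomial_growth I \<or> (\<exists>u v. generate_free_subalgebra I u v)) \<and>
       \<not> (polynomial_growth I \<and> (\<exists>u v. generate_free_subalgebra I u v))) \<and>
      (polynomial_growth I \<longleftrightarrow> (\<forall>l\<in>N. length l \<le> m - 1))) \<and>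
    (\<forall>d :: real. polynomial_growth_of_degree I d \<longrightarrow>
      (\<exists>n :: nat. global_dimension TYPE('u) A = enat n \<and> real n = d) \<and>
      finite W \<and> d - 1 \<le> real (card W) \<and> real (card W) \<le> d * (d - 1) / 2 \<and>
      standard_finite_presentation wlt I \<and>
      (real (card W) = d * (d - 1) / 2 \<longleftrightarrow>
         d = real CARD('x) \<and> W = {[x, y] | x y. x < y}) \<and>
      (d = real CARD('x) \<and> W = {[x, y] | x y. x < y} \<longleftrightarrow> N = range (\<lambda>x. [x])))"
proof -
  interpret L: lyndon_quotient W I A
  proof
    show "lyndon w" if "w \<in> W" for w using W_lyndon that by blast
    show "antichain W" by (rule W_antichain)
    show "[x] \<notin> W" for x using W_letters by blast
    show "I = word_ideal W" "A = quotient_algebra I" by (rule I, rule A)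
    show "[] \<notin> W" using W_lyndon lyndon_nonempty by blast
  qed
  have sfp: "standard_finite_presentation wlt I \<longleftrightarrow> finite W"
    by (rule L.standard_finite_presentation_iff[OF wlt W_antichain])
  have part2: "global_dimension TYPE('u) A \<le> enat (card W + 1) \<and>
      ((polynomial_growth I \<or> (\<exists>u v. generate_free_subalgebra I u v)) \<and>
       \<not> (polynomial_growth I \<and> (\<exists>u v. generate_free_subalgebra I u v))) \<and>
      (polynomial_growth I \<longleftrightarrow> (\<forall>l\<in>N. length l \<le> Max (length ` W) - 1))" if fin: "finite W"
  proof (intro conjI)
    show "global_dimension TYPE('u) A \<le> enat (card W + 1)"
      by (rule L.global_dimension_le) (rule L.chain_length_le_relations[OF _ fin])
    show short: "polynomial_growth I \<longleftrightarrow> (\<forall>l\<in>N. length l \<le> Max (length ` W) - 1)"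
      unfolding L.polynomial_growth_iff N
      using L.finite_atoms_short[OF _ fin W_nonempty] L.finite_atoms_if_short by blast
    show "polynomial_growth I \<or> (\<exists>u v. generate_free_subalgebra I u v)"
    proof (cases "polynomial_growth I")
      case False
      then obtain l where l: "l \<in> N" "\<not> length l \<le> Max (length ` W) - 1" using short by blast
      \<comment> \<open>Not at most \<open>m - 1\<close> means at least \<open>m\<close>, also with
        truncated subtraction, so \<open>l\<close> is as long as every relation.\<close>
      have "length w \<le> length l" if "w \<in> W" for w
        using L.length_W_Max[OF fin that] l(2) by linarith
      then show ?thesis using L.free_subalgebra_if_long_atom[of l] l(1) W_nonempty N by blast
    qed simp
    show "\<not> (polynomial_growth I \<and> (\<exists>u v. generate_free_subalgebra I u v))"
      using L.not_polynomial_growth_if_free by blast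
  qed
  have part3: "(\<exists>n :: nat. global_dimension TYPE('u) A = enat n \<and> real n = d) \<and>
      finite W \<and> d - 1 \<le> real (card W) \<and> real (card W) \<le> d * (d - 1) / 2 \<and>
      standard_finite_presentation wlt I \<and>
      (real (card W) = d * (d - 1) / 2 \<longleftrightarrow>
         d = real CARD('x) \<and> W = {[x, y] | x y. x < y}) \<and>
      (d = real CARD('x) \<and> W = {[x, y] | x y. x < y} \<longleftrightarrow> N = range (\<lambda>x. [x]))"
    if deg: "polynomial_growth_of_degree I d" for d
  proof -
    have fin: "finite N" and d: "d = real (card N)"
      using deg unfolding L.polynomial_growth_of_degree_iff N by simp_all
    note finN = fin[unfolded N]
    have pos: "0 < card N" using L.card_atoms_pos[OF finN] N by simp
    have finW: "finite W" by (rule L.finite_W_if_finite_atoms(1)[OF finN])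
    \<comment> \<open>Truncated subtraction agrees with the real one because \<open>card N\<close>
      is positive: letters are atoms.\<close>
    have prod: "d * (d - 1) = real (card N * (card N - 1))" using pos d by (simp add: of_nat_diff)
    have half: "real (card W) = d * (d - 1) / 2 \<longleftrightarrow> 2 * card W = card N * (card N - 1)"
    proof -
      have "real (card W) = d * (d - 1) / 2 \<longleftrightarrow> real (2 * card W) = real (card N * (card N - 1))"
        unfolding prod by auto
      then show ?thesis by (simp only: of_nat_eq_iff)
    qed
    have letters: "d = real CARD('x) \<and> W = {[x, y] | x y. x < y} \<longleftrightarrow> N = range (\<lambda>x. [x])"
    proof -
      have "card N = CARD('x)" if "N = range (\<lambda>x. [x])"
        unfolding that by (rule card_image) (simp add: inj_on_def)
      then show ?thesis using L.atoms_eq_letters_iff N d by auto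
    qed
    have "2 * card W \<le> card N * (card N - 1)" using L.finite_W_if_finite_atoms(2)[OF finN] N by simp
    then have "real (2 * card W) \<le> d * (d - 1)" unfolding prod by (rule of_nat_mono)
    then have upper: "real (card W) \<le> d * (d - 1) / 2" by simp
    obtain c where "L.chain c" "length c = card N" using L.top_chain[OF finN] N by auto
    then have lower: "d - 1 \<le> real (card W)" using L.chain_length_le_relations[of c] finW d by simp
    have "global_dimension TYPE('u) A = enat (card N)" using L.global_dimension_eq[OF finN] N by simp
    then show ?thesis
      using d finW lower upper sfp half letters L.card_W_maximal_iff[OF finN] N by auto
  qed
  show ?thesis using sfp part2 part3 by blast
qed

end
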